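(* Let $f$ be a probability density on $[0,1]$ with $f(x)>0$ for all $0<x<1$, and suppose there exist $k_0,k_1\in\mathbb N$ and constants $c_0,c_1>0$ such that $f(x)\sim c_0x^{k_0}$ as $x\to0$ and $f(x)\sim c_1(1-x)^{k_1}$ as $x\to1$. Then for every $H>0$ there exist $N_0>0$ and $A>0$ such that, for all $\alpha$ large enough, there is a discrete probability distribution $P=P_\alpha=\sum_{j}p_j\delta_{\varepsilon_j}$ on $(0,1)$ having at most $N=N_0\sqrt\alpha(\log\alpha)^{3/2}$ points in its support, with $p_j>\alpha^{-A}$ for all $j$, such that for all $p\ge1$ there is a constant $C$ (independent of $\alpha$) with, for $\alpha$ large enough, $$\int_0^1 g_{\alpha,f}(x)\left|\log\left(\frac{g_{\alpha,f}(x)}{g_{\alpha,P}(x)}\right)\right|^p dx\le C\alpha^{-H}.$$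
   Context: Beta densities: for $\alpha>0$, $\varepsilon\in(0,1)$, $g_{\alpha,\varepsilon}(x)=\dfrac{x^{a-1}(1-x)^{b-1}}{B(a,b)}$ on $[0,1]$ with $a=\alpha/(1-\varepsilon)$, $b=\alpha/\varepsilon$, $B(a,b)=\Gamma(a)\Gamma(b)/\Gamma(a+b)$. For a probability density $f$ on $[0,1]$, $g_{\alpha,f}(x)=\int_0^1 f(\varepsilon)g_{\alpha,\varepsilon}(x)\,d\varepsilon$; for a probability $P$, $g_{\alpha,P}(x)=\int g_{\alpha,\varepsilon}(x)\,dP(\varepsilon)$. $\mathbb N$ contains $0$. *)

theory Defs
  imports "HOL-Probability.Probability" "HOL-Library.Landau_Symbols"
begin

definition beta_kernel :: "real \<Rightarrow> real \<Rightarrow> real \<Rightarrow> real" where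
  "beta_kernel \<alpha> \<epsilon> x =
     x powr (\<alpha> / (1 - \<epsilon>) - 1) * (1 - x) powr (\<alpha> / \<epsilon> - 1) / Beta (\<alpha> / (1 - \<epsilon>)) (\<alpha> / \<epsilon>)"

definition prob_density_01 :: "(real \<Rightarrow> real) \<Rightarrow> bool" where
  "prob_density_01 f \<longleftrightarrow>
     (\<forall>x\<in>{0..1}. 0 \<le> f x) \<and> set_integrable lborel {0..1} f \<and> (LINT x:{0..1}|lborel. f x) = 1"

text \<open>
  The mixing parameter ranges over the open interval because the kernel is meaningful only
  for \<open>0 < \<epsilon> < 1\<close> (the endpoints involve division by zero). For \<open>0 < x < 1\<close> and \<open>\<alpha> > 0\<close>
  the kernel is bounded in \<open>\<epsilon>\<close>, so for a probability density \<open>f\<close> the Bochner integral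
  below is a genuine one.
\<close>
definition beta_mix_density :: "real \<Rightarrow> (real \<Rightarrow> real) \<Rightarrow> real \<Rightarrow> real" where
  "beta_mix_density \<alpha> f x = (LINT \<epsilon>:{0<..<1}|lborel. f \<epsilon> * beta_kernel \<alpha> \<epsilon> x)"

definition beta_mix_measure :: "real \<Rightarrow> real measure \<Rightarrow> real \<Rightarrow> real" where
  "beta_mix_measure \<alpha> P x = (LINT \<epsilon>|P. beta_kernel \<alpha> \<epsilon> x)"

end

theory Submission
  imports Defs "HOL-Real_Asymp.Real_Asymp"
begin

text \<open>
  In logit coordinates the Beta kernels are essentially a location family with scale
  \<open>1 / sqrt \<alpha>\<close>. Cut the logit range \<open>|s| \<le> T * ln \<alpha>\<close> into cells of width
  \<open>sqrt (ln \<alpha> / \<alpha>)\<close>. On a cell around \<open>\<epsilon>0\<close>, the kernel at a nearby \<open>x\<close> is a function of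
  \<open>\<epsilon>\<close> times a function of \<open>x\<close> times \<open>exp t\<close> with \<open>t\<close> of order \<open>ln \<alpha>\<close>, and \<open>t\<close> is affine in
  the odds \<open>\<epsilon> / (1 - \<epsilon>)\<close> and their inverse. Truncating the exponential series after \<open>O(ln \<alpha>)\<close>
  terms thus puts every \<open>x\<close>-section of the kernel within \<open>\<alpha> powr (- E)\<close> of one common space of
  dimension \<open>O(sqrt \<alpha> * ln \<alpha> powr (3/2))\<close>, and Caratheodory's theorem compresses (a fine
  discretisation of) \<open>f\<close> to that many atoms with the same integrals on this space.

  The result is mixed, with weight \<open>\<alpha> powr (- E)\<close>, with the uniform distribution on its support and
  on a grid of the same mesh covering logits up to \<open>(ln \<alpha>)\<^sup>2\<close>. This bounds the weights below and
  keeps \<open>\<bar>ln\<bar>\<close> of the discrete mixture at most \<open>(ln \<alpha>) ^ 3\<close> there. Where the smooth mixture is at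
  least \<open>\<alpha> powr (- B)\<close>, the ratio of the mixtures is close to 1; elsewhere the smallness of the
  smooth mixture beats the logarithm, so no lower bound for \<open>f\<close> is needed.
\<close>

section \<open>Discrete reduction of a mixing measure\<close>

text \<open>The parameters \<alpha>/(1 - \<epsilon>) and \<alpha>/\<epsilon> are such that the
  kernel keeps the width 1/sqrt \<alpha> in the logit uniformly in \<epsilon>. The cell width
  balances two demands: a fixed number of cells away the kernel is below any prescribed power of
  \<alpha>, while on these cells the exponent is still O(ln \<alpha>). The count is O(sqrt (\<alpha>
  ln \<alpha>)) cells times O(ln \<alpha>) functions per cell.

  The obstacle is that compression yields an additive error, whereas the logarithm sees the ratio of
  the mixtures. The threshold exponent B must therefore stay below E by more than H, and below the
  threshold a fractional power of the smooth mixture has to pay for the logarithm. All densities are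
  multiplied by \<open>wt\<close>: the factor cancels in the ratio and turns the endpoint
  singularities into the uniform bound e^4 sqrt \<alpha>.

  Since the distribution is fixed before p, the exponents of \<alpha> that define it depend on H
  alone; p only meets powers of ln \<alpha>, or powers of \<alpha> against exp(-c (ln
  \<alpha>)^2).\<close>

lemma exists_nontrivial_relation:
  fixes \<psi> :: "'i \<Rightarrow> 'a \<Rightarrow> real"
  assumes "finite I" "finite S" "card I < card S"
  shows "\<exists>c. (\<exists>s\<in>S. c s \<noteq> 0) \<and> (\<forall>i\<in>I. (\<Sum>s\<in>S. c s * \<psi> i s) = 0)"
  using assms
proof (induction I arbitrary: S \<psi> rule: finite_induct)
  case empty
  then obtain s where "s \<in> S" by fastforce
  then show ?case by (intro exI[of _ "\<lambda>_. 1"]) auto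
next
  case (insert i I)
  show ?case
  proof (cases "\<forall>s\<in>S. \<psi> i s = 0")
    case True
    have "card I < card S" using insert by simp
    from insert.IH[OF insert.prems(1) this, of \<psi>] True show ?thesis
      by (auto intro!: sum.neutral)
  next
    case False
    \<comment> \<open>Gaussian elimination with pivot \<open>s0\<close>: equation \<open>i\<close>
      is solved for the unknown at \<open>s0\<close>, and substituting it into the other equations
      leaves one equation and one unknown fewer.\<close>
    then obtain s0 where s0: "s0 \<in> S" "\<psi> i s0 \<noteq> 0" by auto
    let ?S = "S - {s0}"
    have fin: "finite ?S" and cd: "card I < card ?S"
      using insert s0 by (auto simp: card_Diff_singleton)
    from insert.IH[OF fin cd, of "\<lambda>j s. \<psi> j s - \<psi> j s0 / \<psi> i s0 * \<psi> i s"]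
    obtain c where c: "\<exists>s\<in>?S. c s \<noteq> 0"
      "\<And>j. j \<in> I \<Longrightarrow> (\<Sum>s\<in>?S. c s * (\<psi> j s - \<psi> j s0 / \<psi> i s0 * \<psi> i s)) = 0"
      by blast
    define z where "z = - (\<Sum>s\<in>?S. c s * \<psi> i s) / \<psi> i s0"
    define c' where "c' = c(s0 := z)"
    have sum: "(\<Sum>s\<in>S. c' s * g s) = z * g s0 + (\<Sum>s\<in>?S. c s * g s)" for g
      by (subst sum.remove[OF insert.prems(1) s0(1)]) (auto simp: c'_def intro!: sum.cong)
    have "(\<Sum>s\<in>S. c' s * \<psi> j s) = 0" if "j \<in> insert i I" for j
    proof (cases "j = i")
      case True
      then show ?thesis using s0 by (simp only: sum) (simp add: z_def)
    next
      case False
      then have "(\<Sum>s\<in>?S. c s * \<psi> j s) = \<psi> j s0 / \<psi> i s0 * (\<Sum>s\<in>?S. c s * \<psi> i s)"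
        using c(2)[of j] that
        by (simp add: algebra_simps sum_subtractf sum_distrib_left)
      then show ?thesis unfolding sum z_def by simp
    qed
    moreover have "\<exists>s\<in>S. c' s \<noteq> 0" using c(1) by (auto simp: c'_def)
    ultimately show ?thesis by blast
  qed
qed

text \<open>Conic form of Caratheodory's theorem: with more points than functionals, a linear
  relation is a direction in which the weights can move without changing any of the sums, and moving
  until some weight reaches 0 drops a point. The bound is \<open>card I\<close> without
  \<open>+ 1\<close> because the total mass is conserved only if the constant 1 is among the
  functionals.\<close>

lemma caratheodory_reduction:
  fixes \<psi> :: "'i \<Rightarrow> 'a \<Rightarrow> real"
  assumes "finite I" "finite S" "\<And>s. s \<in> S \<Longrightarrow> 0 \<le> w s"
  shows "\<exists>S' w'. S' \<subseteq> S \<and> card S' \<le> card I \<and> (\<forall>s\<in>S'. 0 \<le> w' s) \<and>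
    (\<forall>i\<in>I. (\<Sum>s\<in>S'. w' s * \<psi> i s) = (\<Sum>s\<in>S. w s * \<psi> i s))"
  using assms(2,3)
proof (induction "card S" arbitrary: S w rule: less_induct)
  case less
  show ?case
  proof (cases "card S \<le> card I")
    case True
    then show ?thesis using less.prems by blast
  next
    case False
    then obtain c0 where c0: "\<exists>s\<in>S. c0 s \<noteq> 0" "\<forall>i\<in>I. (\<Sum>s\<in>S. c0 s * \<psi> i s) = 0"
      using exists_nontrivial_relation[OF assms(1) less.prems(1)] by (metis not_le)
    obtain c where c: "\<exists>s\<in>S. c s > 0" "\<And>i. i \<in> I \<Longrightarrow> (\<Sum>s\<in>S. c s * \<psi> i s) = 0"
    proof (cases "\<exists>s\<in>S. c0 s > 0")
      case True
      then show ?thesis using that c0 by blast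
    next
      case False
      then have "\<exists>s\<in>S. - c0 s > 0" using c0(1) by (meson linorder_neqE_linordered_idom neg_0_less_iff_less)
      then show ?thesis using that[of "\<lambda>s. - c0 s"] c0(2) by (simp add: sum_negf)
    qed
    define R where "R = {s\<in>S. c s > 0}"
    have R: "finite R" "R \<noteq> {}" using less.prems c(1) by (auto simp: R_def)
    \<comment> \<open>The largest step along \<open>- c\<close> that keeps the weights nonnegative.
      Only points with \<open>c s > 0\<close> lose weight, and the minimiser \<open>s1\<close> ends
      with weight 0.\<close>
    define t where "t = Min ((\<lambda>s. w s / c s) ` R)"
    have "t \<in> (\<lambda>s. w s / c s) ` R" unfolding t_def using R by (intro Min_in) auto
    then obtain s1 where s1: "s1 \<in> S" "c s1 > 0" "t = w s1 / c s1" by (auto simp: R_def)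
    have t0: "t \<ge> 0" using s1 less.prems(2) by simp
    define v where "v s = w s - t * c s" for s
    have v0: "0 \<le> v s" if "s \<in> S" for s
    proof (cases "c s > 0")
      case True
      then have "t \<le> w s / c s" unfolding t_def using that R by (intro Min_le) (auto simp: R_def)
      then show ?thesis using True by (simp add: v_def field_simps)
    next
      case False
      then have "t * c s \<le> 0" using t0 by (simp add: mult_nonneg_nonpos)
      then show ?thesis using less.prems(2)[OF that] by (simp add: v_def)
    qed
    have vs1: "v s1 = 0" using s1 by (simp add: v_def)
    have "card (S - {s1}) < card S" using s1 less.prems(1) by (meson card_Diff1_less)
    from less.hyps[OF this, of v] less.prems(1) v0 obtain S' w' where *:
      "S' \<subseteq> S - {s1}" "card S' \<le> card I" "\<forall>s\<in>S'. 0 \<le> w' s"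
      "\<forall>i\<in>I. (\<Sum>s\<in>S'. w' s * \<psi> i s) = (\<Sum>s\<in>S - {s1}. v s * \<psi> i s)" by auto
    have "(\<Sum>s\<in>S - {s1}. v s * \<psi> i s) = (\<Sum>s\<in>S. w s * \<psi> i s)" if "i \<in> I" for i
    proof -
      have "(\<Sum>s\<in>S - {s1}. v s * \<psi> i s) = (\<Sum>s\<in>S. v s * \<psi> i s)"
        using vs1 s1 by (simp add: sum.remove[OF less.prems(1) s1(1)])
      also have "\<dots> = (\<Sum>s\<in>S. w s * \<psi> i s) - t * (\<Sum>s\<in>S. c s * \<psi> i s)"
        by (simp add: v_def algebra_simps sum_subtractf sum_distrib_left)
      finally show ?thesis using c(2)[OF that] by simp
    qed
    with * show ?thesis by (intro exI[of _ S'] exI[of _ w']) auto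
  qed
qed

text \<open>The reduction above acts on finite sums, so the integral is first replaced by one.
  Uniform continuity on the compact product makes one grid good for all \<open>x \<in> X\<close> at
  once; a grid point receives the \<open>f\<close>-mass of all points rounded down to it, so the
  mass is preserved exactly. The number of atoms is uncontrolled here and is cut down
  afterwards.\<close>

lemma discretize_density:
  fixes f :: "real \<Rightarrow> real" and k :: "real \<Rightarrow> 'b::metric_space \<Rightarrow> real"
  assumes "a < b" "compact X" and cont: "continuous_on ({a..b} \<times> X) (\<lambda>(t, x). k t x)"
    and int: "set_integrable lborel {a..b} f" and nn: "\<And>t. t \<in> {a..b} \<Longrightarrow> 0 \<le> f t"
    and "\<delta> > 0"
  shows "\<exists>S \<mu>. finite S \<and> S \<subseteq> {a..b} \<and> (\<forall>s\<in>S. 0 \<le> \<mu> s) \<and>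
    (\<Sum>s\<in>S. \<mu> s) = (LINT t:{a..b}|lborel. f t) \<and>
    (\<forall>x\<in>X. \<bar>(\<Sum>s\<in>S. \<mu> s * k s x) - (LINT t:{a..b}|lborel. f t * k t x)\<bar>
        \<le> \<delta> * (LINT t:{a..b}|lborel. f t))"
proof -
  have "uniformly_continuous_on ({a..b} \<times> X) (\<lambda>(t, x). k t x)"
    using cont assms(2) by (intro compact_uniformly_continuous compact_Times) auto
  then obtain d where d: "d > 0" and unif:
    "\<And>p q. p \<in> {a..b} \<times> X \<Longrightarrow> q \<in> {a..b} \<times> X \<Longrightarrow> dist q p < d \<Longrightarrow>
       dist (case q of (t, x) \<Rightarrow> k t x) (case p of (t, x) \<Rightarrow> k t x) < \<delta>"
    using \<open>\<delta> > 0\<close> unfolding uniformly_continuous_on_def by meson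
  define h where "h t = a + d / 2 * of_int \<lfloor>(t - a) / (d / 2)\<rfloor>" for t
  have h_le: "h t \<le> t" and h_gt: "t - h t < d" for t
  proof -
    let ?q = "(t - a) / (d / 2)"
    have q: "d / 2 * ?q = t - a" using d by simp
    have 1: "d / 2 * of_int \<lfloor>?q\<rfloor> \<le> d / 2 * ?q" using d by (intro mult_left_mono) auto
    have 2: "d / 2 * ?q < d / 2 * (of_int \<lfloor>?q\<rfloor> + 1)" using d by (intro mult_strict_left_mono) linarith+
    show "h t \<le> t" using 1 unfolding h_def q by linarith
    show "t - h t < d" using 2 d unfolding h_def q by (simp add: distrib_left)
  qed
  have h_ge: "h t \<ge> a" if "t \<ge> a" for t
    using that d by (simp add: h_def)
  have h_in: "h t \<in> {a..b}" if "t \<in> {a..b}" for t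
    using that h_le[of t] h_ge[of t] by auto
  define S where "S = h ` {a..b}"
  have "S \<subseteq> (\<lambda>j. a + d / 2 * of_int j) ` {0..\<lfloor>(b - a) / (d / 2)\<rfloor>}"
  proof
    fix s assume "s \<in> S"
    then obtain t where t: "t \<in> {a..b}" "s = h t" by (auto simp: S_def)
    have "0 \<le> \<lfloor>(t - a) / (d / 2)\<rfloor>" using t d by simp
    moreover have "\<lfloor>(t - a) / (d / 2)\<rfloor> \<le> \<lfloor>(b - a) / (d / 2)\<rfloor>"
      using t d by (intro floor_mono divide_right_mono) auto
    ultimately show "s \<in> (\<lambda>j. a + d / 2 * of_int j) ` {0..\<lfloor>(b - a) / (d / 2)\<rfloor>}"
      using t unfolding h_def by auto
  qed
  then have finS: "finite S" by (rule finite_subset) simp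
  have [measurable]: "h \<in> borel_measurable borel" unfolding h_def by measurable
  define F where "F t = indicator {a..b} t * f t" for t
  have intF: "integrable lborel F" using int by (simp add: set_integrable_def F_def[abs_def])
  have [measurable]: "F \<in> borel_measurable borel" using intF by auto
  have F0: "0 \<le> F t" for t using nn by (auto simp: F_def indicator_def)
  have set_F: "(LINT t:{a..b}|lborel. f t * g t) = (LINT t|lborel. F t * g t)" for g
    by (simp add: set_lebesgue_integral_def F_def mult.assoc)
  have set_F1: "(LINT t:{a..b}|lborel. f t) = (LINT t|lborel. F t)"
    using set_F[of "\<lambda>_. 1"] by simp
  have intFS: "integrable lborel (\<lambda>t. F t * indicator {s} (h t))" for s
    by (rule Bochner_Integration.integrable_bound[OF intF]) (auto simp: indicator_def)
  define \<mu> where "\<mu> s = (LINT t|lborel. F t * indicator {s} (h t))" for s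
  have hsum: "F t * g (h t) = (\<Sum>s\<in>S. F t * indicator {s} (h t) * g s)" for t and g :: "real \<Rightarrow> real"
  proof (cases "t \<in> {a..b}")
    case True
    then have "h t \<in> S" by (simp add: S_def)
    then have "(\<Sum>s\<in>S. F t * indicator {s} (h t) * g s) = (\<Sum>s\<in>S. if s = h t then F t * g (h t) else 0)"
      by (intro sum.cong) (auto simp: indicator_def)
    then show ?thesis using finS \<open>h t \<in> S\<close> by simp
  next
    case False
    then show ?thesis by (simp add: F_def)
  qed
  have \<mu>sum: "(\<Sum>s\<in>S. \<mu> s * g s) = (LINT t|lborel. F t * g (h t))"
     and intg: "integrable lborel (\<lambda>t. F t * g (h t))" for g :: "real \<Rightarrow> real"
  proof -
    have eq: "(\<lambda>t. F t * g (h t)) = (\<lambda>t. \<Sum>s\<in>S. F t * indicator {s} (h t) * g s)"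
      by (rule ext, rule hsum)
    have int: "integrable lborel (\<lambda>t. F t * indicator {s} (h t) * g s)" for s
      using intFS by (rule integrable_mult_left)
    show "integrable lborel (\<lambda>t. F t * g (h t))"
      unfolding eq using int by (intro Bochner_Integration.integrable_sum)
    show "(\<Sum>s\<in>S. \<mu> s * g s) = (LINT t|lborel. F t * g (h t))"
      unfolding eq \<mu>_def using int by (subst Bochner_Integration.integral_sum) simp_all
  qed
  have "\<bar>(\<Sum>s\<in>S. \<mu> s * k s x) - (LINT t:{a..b}|lborel. f t * k t x)\<bar>
        \<le> \<delta> * (LINT t:{a..b}|lborel. f t)" if x: "x \<in> X" for x
  proof -
    have close: "\<bar>k (h t) x - k t x\<bar> \<le> \<delta>" if t: "t \<in> {a..b}" for t
      using unif[of "(t, x)" "(h t, x)"] t h_in[OF t] x h_le[of t] h_gt[of t]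
      by (simp add: dist_Pair_Pair dist_real_def)
    have ck: "continuous_on {a..b} (\<lambda>t. k t x)"
      using continuous_on_compose2[OF cont, of "{a..b}" "\<lambda>t. (t, x)"] x
      by (simp add: continuous_on_Pair image_subset_iff)
    have meas: "(\<lambda>t. F t * k t x) \<in> borel_measurable lborel"
    proof -
      have "(\<lambda>t. indicator {a..b} t *\<^sub>R k t x) \<in> borel_measurable borel"
        using ck by (rule borel_measurable_continuous_on_indicator[rotated]) simp
      then have "(\<lambda>t. F t * (indicator {a..b} t *\<^sub>R k t x)) \<in> borel_measurable borel"
        by (intro borel_measurable_times) auto
      also have "(\<lambda>t. F t * (indicator {a..b} t *\<^sub>R k t x)) = (\<lambda>t. F t * k t x)"
        by (auto simp: F_def indicator_def)
      finally show ?thesis by simp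
    qed
    have int1: "integrable lborel (\<lambda>t. F t * k (h t) x)" using intg[of "\<lambda>t. k t x"] .
    have bd: "\<bar>F t * k (h t) x - F t * k t x\<bar> \<le> \<delta> * F t" for t
    proof (cases "t \<in> {a..b}")
      case True
      have "F t * \<bar>k (h t) x - k t x\<bar> \<le> F t * \<delta>"
        using close[OF True] F0 by (rule mult_left_mono)
      then show ?thesis using F0[of t] by (simp add: abs_mult flip: right_diff_distrib) (simp add: mult.commute)
    qed (simp add: F_def)
    \<comment> \<open>Integrability of \<open>F t * k t x\<close> is obtained by difference: the
      rounded integrand is a finite sum, and the deviation from it is dominated by
      \<open>\<delta> * F\<close>.\<close>
    have int3: "integrable lborel (\<lambda>t. F t * k (h t) x - F t * k t x)"
      by (rule Bochner_Integration.integrable_bound[OF integrable_mult_right[OF intF, of \<delta>]])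
        (use bd meas int1 in \<open>auto intro!: borel_measurable_diff order.trans[OF bd]\<close>)
    have int2: "integrable lborel (\<lambda>t. F t * k t x)"
      using Bochner_Integration.integrable_diff[OF int1 int3] by simp
    have "\<bar>(\<Sum>s\<in>S. \<mu> s * k s x) - (LINT t:{a..b}|lborel. f t * k t x)\<bar>
      = \<bar>LINT t|lborel. F t * k (h t) x - F t * k t x\<bar>"
      unfolding \<mu>sum[of "\<lambda>s. k s x"] set_F using int1 int2 by simp
    also have "\<dots> \<le> (LINT t|lborel. \<bar>F t * k (h t) x - F t * k t x\<bar>)"
      by (rule integral_abs_bound)
    also have "\<dots> \<le> (LINT t|lborel. \<delta> * F t)"
      using int3 intF bd by (intro integral_mono) auto
    finally show ?thesis by (simp add: set_F1)
  qed
  moreover have "(\<Sum>s\<in>S. \<mu> s) = (LINT t:{a..b}|lborel. f t)"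
    using \<mu>sum[of "\<lambda>_. 1"] by (simp add: set_F1)
  moreover have "S \<subseteq> {a..b}" using h_in by (auto simp: S_def)
  moreover have "0 \<le> \<mu> s" for s unfolding \<mu>_def using F0 by (intro integral_nonneg_AE) auto
  ultimately show ?thesis using finS by blast
qed

section \<open>The Beta kernel in logit coordinates\<close>

definition wt :: "real \<Rightarrow> real" where "wt x = x * (1 - x)"

definition logit :: "real \<Rightarrow> real" where "logit x = ln x - ln (1 - x)"

definition expit :: "real \<Rightarrow> real" where "expit s = 1 / (1 + exp (- s))"

text \<open>Multiplying the kernel by \<open>wt x\<close>, the Jacobian of the logit map, turns it into
  \<open>knorm \<alpha> \<epsilon> * exp (- \<alpha> * kdiv \<epsilon> x)\<close>. Here \<open>kdiv\<close> is the Kullback-Leibler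
  divergence \<open>KL(Bernoulli \<epsilon>, Bernoulli x)\<close> divided by \<open>\<epsilon> * (1 - \<epsilon>)\<close>; that scaling makes it comparable to the
  squared logit distance, uniformly in \<open>\<epsilon>\<close>.\<close>
definition kdiv :: "real \<Rightarrow> real \<Rightarrow> real" where
  "kdiv \<epsilon> x = (ln \<epsilon> - ln x) / (1 - \<epsilon>) + (ln (1 - \<epsilon>) - ln (1 - x)) / \<epsilon>"

text \<open>The value of \<open>wkernel \<alpha> \<epsilon>\<close> at its maximum
  \<open>x = \<epsilon>\<close>, where \<open>kdiv\<close> vanishes.\<close>

definition knorm :: "real \<Rightarrow> real \<Rightarrow> real" where
  "knorm \<alpha> \<epsilon> = \<epsilon> powr (\<alpha> / (1 - \<epsilon>)) * (1 - \<epsilon>) powr (\<alpha> / \<epsilon>) / Beta (\<alpha> / (1 - \<epsilon>)) (\<alpha> / \<epsilon>)"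

definition wkernel :: "real \<Rightarrow> real \<Rightarrow> real \<Rightarrow> real" where
  "wkernel \<alpha> \<epsilon> x = knorm \<alpha> \<epsilon> * exp (- \<alpha> * kdiv \<epsilon> x)"

lemma wt_pos: "0 < x \<Longrightarrow> x < 1 \<Longrightarrow> 0 < wt x"
  by (simp add: wt_def)

lemma wt_le: "0 < x \<Longrightarrow> x < 1 \<Longrightarrow> wt x \<le> x" "0 < x \<Longrightarrow> x < 1 \<Longrightarrow> wt x \<le> 1 - x"
  by (simp_all add: wt_def mult_left_le mult_right_le_one_le mult_left_le_one_le)

lemma expit_bounds: "0 < expit s" "expit s < 1"
  by (simp_all add: expit_def add_pos_pos)

lemma logit_expit [simp]: "logit (expit s) = s"
proof -
  have "1 - expit s = exp (- s) / (1 + exp (- s))"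
  proof -
    have "1 + exp (- s) \<noteq> 0" using exp_gt_zero[of "- s"] by linarith
    then show ?thesis by (simp add: expit_def divide_simps)
  qed
  moreover have "0 < 1 + exp (- s)" by (simp add: add_pos_pos)
  ultimately show ?thesis
    by (simp add: logit_def expit_def ln_div)
qed

lemma wt_expit: "wt (expit s) \<ge> exp (- \<bar>s\<bar>) / 4"
proof -
  have "wt (expit s) = 1 / ((1 + exp (- s)) * (1 + exp s))"
  proof -
    have nz: "1 + exp s \<noteq> 0" using exp_gt_zero[of s] by linarith
    have e: "expit s = exp s / (1 + exp s)"
      using nz by (simp add: expit_def exp_minus divide_simps)
    have e1: "1 - expit s = 1 / (1 + exp s)" using nz unfolding e by (simp add: divide_simps)
    have "wt (expit s) = 1 / (1 + exp (- s)) * (1 / (1 + exp s))"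
      unfolding wt_def e1 by (simp only: expit_def)
    then show ?thesis by simp
  qed
  moreover have "(1 + exp (- s)) * (1 + exp s) \<le> 4 * exp \<bar>s\<bar>"
  proof -
    have 1: "(1 + exp (- s)) * (1 + exp s) = 2 + exp s + exp (- s)"
      by (simp add: algebra_simps flip: exp_add)
    have "exp s \<le> exp \<bar>s\<bar>" "exp (- s) \<le> exp \<bar>s\<bar>" "1 \<le> exp \<bar>s\<bar>" by auto
    then show ?thesis unfolding 1 by linarith
  qed
  ultimately have "wt (expit s) \<ge> 1 / (4 * exp \<bar>s\<bar>)"
    by (simp only:) (intro divide_left_mono, auto intro!: mult_pos_pos add_pos_pos)
  then show ?thesis by (simp add: exp_minus field_simps)
qed

lemma abs_logit_le:
  assumes "0 < x" "x < 1"
  shows "\<bar>logit x\<bar> \<le> - ln (wt x)"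
proof -
  have "ln x \<le> 0" "ln (1 - x) \<le> 0" using assms by auto
  moreover have "ln (wt x) = ln x + ln (1 - x)" using assms by (simp add: wt_def ln_mult)
  ultimately show ?thesis by (simp add: logit_def)
qed

text \<open>\<open>kdiv \<epsilon>\<close> as a function of the logit difference; its derivative is
  \<open>(exp d - 1) / (1 - \<epsilon> + \<epsilon> * exp d)\<close>.\<close>
definition ldiv :: "real \<Rightarrow> real \<Rightarrow> real" where
  "ldiv \<epsilon> d = ln (1 - \<epsilon> + \<epsilon> * exp d) / (\<epsilon> * (1 - \<epsilon>)) - d / (1 - \<epsilon>)"

text \<open>The argument of the logarithm in \<open>ldiv\<close> becomes (1 - \<epsilon>)/(1 - x),
  and 1/(\<epsilon>(1 - \<epsilon>)) splits into 1/\<epsilon> + 1/(1 - \<epsilon>).\<close>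

lemma kdiv_eq_ldiv:
  assumes "0 < \<epsilon>" "\<epsilon> < 1" "0 < x" "x < 1"
  shows "kdiv \<epsilon> x = ldiv \<epsilon> (logit x - logit \<epsilon>)"
proof -
  define Z where "Z = 1 - \<epsilon> + \<epsilon> * exp (logit x - logit \<epsilon>)"
  have "exp (logit x - logit \<epsilon>) = x * (1 - \<epsilon>) / ((1 - x) * \<epsilon>)"
    using assms by (simp add: logit_def exp_diff)
  then have "Z = (1 - \<epsilon>) / (1 - x)"
    using assms by (simp add: Z_def field_simps)
  then have Z: "ln Z = ln (1 - \<epsilon>) - ln (1 - x)" using assms by (simp add: ln_div)
  have "ldiv \<epsilon> (logit x - logit \<epsilon>) = ln Z / (\<epsilon> * (1 - \<epsilon>)) - (logit x - logit \<epsilon>) / (1 - \<epsilon>)"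
    by (simp add: ldiv_def Z_def)
  also have "\<dots> = kdiv \<epsilon> x"
  proof -
    define q where "q = ln (1 - \<epsilon>) - ln (1 - x)"
    have 1: "logit x - logit \<epsilon> = q - (ln \<epsilon> - ln x)" by (simp add: logit_def q_def)
    have 2: "q / (\<epsilon> * (1 - \<epsilon>)) = q / \<epsilon> + q / (1 - \<epsilon>)" using assms by (simp add: divide_simps)
      (simp add: algebra_simps)
    show ?thesis unfolding Z 1 kdiv_def q_def[symmetric] 2 diff_divide_distrib by simp
  qed
  finally show ?thesis by simp
qed

text \<open>Uniformity in \<epsilon> comes from \<open>Z t\<close> being a weighted mean of 1 and
  \<open>exp t\<close>, hence lying between them. On [0, 1] the derivative of
  \<open>ldiv \<epsilon>\<close> is thus between t/e and e t, which integrates to the quadratic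
  bounds; monotonicity carries the value at 1 to all larger d.\<close>

lemma ldiv_pos_arg:
  assumes \<epsilon>: "0 < \<epsilon>" "\<epsilon> < 1" and d: "0 \<le> d"
  shows "0 \<le> ldiv \<epsilon> d" "d \<le> 1 \<Longrightarrow> d\<^sup>2 / (2 * exp 1) \<le> ldiv \<epsilon> d"
    "d \<le> 1 \<Longrightarrow> ldiv \<epsilon> d \<le> exp 1 * d\<^sup>2 / 2" "1 \<le> d \<Longrightarrow> 1 / (2 * exp 1) \<le> ldiv \<epsilon> d"
proof -
  define Z where "Z t = 1 - \<epsilon> + \<epsilon> * exp t" for t :: real
  have Z1: "1 \<le> Z t" and Z2: "Z t \<le> exp t" if "t \<ge> 0" for t
  proof -
    have "1 \<le> exp t" using that by simp
    then have "0 \<le> \<epsilon> * (exp t - 1)" "0 \<le> (1 - \<epsilon>) * (exp t - 1)" using \<epsilon> by auto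
    then show "1 \<le> Z t" "Z t \<le> exp t" by (auto simp: Z_def algebra_simps)
  qed
  have der: "(ldiv \<epsilon> has_real_derivative ((exp t - 1) / Z t)) (at t)" if "t \<ge> 0" for t
  proof -
    have "Z t > 0" using Z1[OF that] by simp
    have "(Z has_real_derivative \<epsilon> * exp t) (at t)"
      unfolding Z_def[abs_def] by (auto intro!: derivative_eq_intros)
    then have "((\<lambda>d. ln (Z d)) has_real_derivative \<epsilon> * exp t / Z t) (at t)"
      using \<open>Z t > 0\<close> by (auto intro!: derivative_eq_intros)
    from DERIV_diff[OF DERIV_cdivide[OF this] DERIV_cdivide[OF DERIV_ident]]
    have "((\<lambda>d. ln (1 - \<epsilon> + \<epsilon> * exp d) / (\<epsilon> * (1 - \<epsilon>)) - d / (1 - \<epsilon>)) has_real_derivative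
       (\<epsilon> * exp t / Z t / (\<epsilon> * (1 - \<epsilon>)) - 1 / (1 - \<epsilon>))) (at t)"
      unfolding Z_def by blast
    moreover have "\<epsilon> * exp t / Z t / (\<epsilon> * (1 - \<epsilon>)) - 1 / (1 - \<epsilon>) = (exp t - 1) / Z t"
    proof -
      have "\<epsilon> * exp t / Z t / (\<epsilon> * (1 - \<epsilon>)) - 1 / (1 - \<epsilon>) = (exp t - Z t) / (Z t * (1 - \<epsilon>))"
        using \<epsilon> \<open>Z t > 0\<close> by (simp add: diff_divide_distrib)
      also have "exp t - Z t = (exp t - 1) * (1 - \<epsilon>)" by (simp add: Z_def algebra_simps)
      finally show ?thesis using \<epsilon> by simp
    qed
    ultimately show ?thesis unfolding ldiv_def[abs_def] by simp
  qed
  have L0: "ldiv \<epsilon> 0 = 0" by (simp add: ldiv_def)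
  have mono: "ldiv \<epsilon> u \<le> ldiv \<epsilon> v" if "0 \<le> u" "u \<le> v" for u v
  proof (rule DERIV_nonneg_imp_nondecreasing[OF that(2)])
    fix t assume "u \<le> t" "t \<le> v"
    then have t: "0 \<le> t" using that by simp
    then have "0 \<le> (exp t - 1) / Z t" using Z1[OF t] by (intro divide_nonneg_nonneg) auto
    with der[OF t] show "\<exists>y. (ldiv \<epsilon> has_real_derivative y) (at t) \<and> 0 \<le> y" by blast
  qed
  show "0 \<le> ldiv \<epsilon> d" using mono[of 0 d] d L0 by simp
  have lower: "u\<^sup>2 / (2 * exp 1) \<le> ldiv \<epsilon> u" if u: "0 \<le> u" "u \<le> 1" for u
  proof -
    have "ldiv \<epsilon> 0 - 0\<^sup>2 / (2 * exp 1) \<le> ldiv \<epsilon> u - u\<^sup>2 / (2 * exp 1)"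
    proof (rule DERIV_nonneg_imp_nondecreasing[OF u(1)])
      fix t assume t: "0 \<le> t" "t \<le> u"
      have "((\<lambda>t. ldiv \<epsilon> t - t\<^sup>2 / (2 * exp 1)) has_real_derivative
         ((exp t - 1) / Z t - t / exp 1)) (at t)"
        by (auto intro!: derivative_eq_intros der t)
      moreover have "t / exp 1 \<le> (exp t - 1) / Z t"
      proof -
        have "t / exp 1 \<le> t / exp t" using t u by (intro divide_left_mono) auto
        also have "\<dots> \<le> (exp t - 1) / exp t" using exp_ge_add_one_self[of t]
          by (intro divide_right_mono) (linarith | simp)+
        also have "\<dots> \<le> (exp t - 1) / Z t" using Z1[OF t(1)] Z2[OF t(1)] t
          by (intro divide_left_mono) auto
        finally show ?thesis .
      qed
      ultimately show "\<exists>y. ((\<lambda>t. ldiv \<epsilon> t - t\<^sup>2 / (2 * exp 1)) has_real_derivative y) (at t) \<and> 0 \<le> y"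
        by force
    qed
    then show ?thesis using L0 by simp
  qed
  show "d \<le> 1 \<Longrightarrow> d\<^sup>2 / (2 * exp 1) \<le> ldiv \<epsilon> d" using lower d by simp
  show "1 / (2 * exp 1) \<le> ldiv \<epsilon> d" if "1 \<le> d" using lower[of 1] mono[of 1 d] that by simp
  show "ldiv \<epsilon> d \<le> exp 1 * d\<^sup>2 / 2" if d1: "d \<le> 1"
  proof -
    have "exp 1 * 0\<^sup>2 / 2 - ldiv \<epsilon> 0 \<le> exp 1 * d\<^sup>2 / 2 - ldiv \<epsilon> d"
    proof (rule DERIV_nonneg_imp_nondecreasing[OF d])
      fix t assume t: "0 \<le> t" "t \<le> d"
      have "((\<lambda>t. exp 1 * t\<^sup>2 / 2 - ldiv \<epsilon> t) has_real_derivative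
         (exp 1 * t - (exp t - 1) / Z t)) (at t)"
        by (auto intro!: derivative_eq_intros der t)
      moreover have "(exp t - 1) / Z t \<le> exp 1 * t"
      proof -
        have "(exp t - 1) / Z t \<le> (exp t - 1) / 1" using Z1[OF t(1)] t
          by (intro divide_left_mono) auto
        also have "\<dots> \<le> exp t * t"
        proof -
          have "exp t * (1 - t) \<le> exp t * exp (- t)"
            using exp_ge_add_one_self[of "-t"] by (intro mult_left_mono) auto
          then show ?thesis by (simp add: algebra_simps flip: exp_add)
        qed
        also have "\<dots> \<le> exp 1 * t" using t d1 by (intro mult_right_mono) auto
        finally show ?thesis .
      qed
      ultimately show "\<exists>y. ((\<lambda>t. exp 1 * t\<^sup>2 / 2 - ldiv \<epsilon> t) has_real_derivative y) (at t) \<and> 0 \<le> y"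
        by force
    qed
    then show ?thesis using L0 by simp
  qed
qed

lemma kdiv_flip: "kdiv (1 - \<epsilon>) (1 - x) = kdiv \<epsilon> x"
  by (simp add: kdiv_def)

lemma logit_flip: "logit (1 - x) = - logit x"
  by (simp add: logit_def)

text \<open>Exchanging (\<epsilon>, x) with (1 - \<epsilon>, 1 - x) preserves \<open>kdiv\<close>
  and flips the sign of the logit difference, so nonnegative differences suffice.\<close>

lemma kdiv_bounds:
  assumes \<epsilon>: "0 < \<epsilon>" "\<epsilon> < 1" and x: "0 < x" "x < 1"
  defines "d \<equiv> \<bar>logit x - logit \<epsilon>\<bar>"
  shows kdiv_nonneg: "0 \<le> kdiv \<epsilon> x"
    and kdiv_lower: "min (d\<^sup>2) 1 / (2 * exp 1) \<le> kdiv \<epsilon> x"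
    and kdiv_upper: "d \<le> 1 \<Longrightarrow> kdiv \<epsilon> x \<le> exp 1 * d\<^sup>2 / 2"
proof -
  have "\<exists>\<epsilon>'. 0 < \<epsilon>' \<and> \<epsilon>' < 1 \<and> kdiv \<epsilon> x = ldiv \<epsilon>' d"
  proof (cases "logit x \<ge> logit \<epsilon>")
    case True
    then show ?thesis using kdiv_eq_ldiv[OF \<epsilon> x] \<epsilon> by (auto simp: d_def)
  next
    case False
    have "kdiv \<epsilon> x = kdiv (1 - \<epsilon>) (1 - x)" by (simp add: kdiv_flip)
    also have "\<dots> = ldiv (1 - \<epsilon>) d"
      using False \<epsilon> x by (subst kdiv_eq_ldiv) (auto simp: logit_flip d_def)
    finally show ?thesis using \<epsilon> by (intro exI[of _ "1 - \<epsilon>"]) auto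
  qed
  then obtain \<epsilon>' where e': "0 < \<epsilon>'" "\<epsilon>' < 1" "kdiv \<epsilon> x = ldiv \<epsilon>' d" by blast
  have d: "0 \<le> d" by (simp add: d_def)
  note L = ldiv_pos_arg[OF e'(1,2) d]
  show "0 \<le> kdiv \<epsilon> x" using L(1) e' by simp
  show "d \<le> 1 \<Longrightarrow> kdiv \<epsilon> x \<le> exp 1 * d\<^sup>2 / 2" using L(3) e' by simp
  show "min (d\<^sup>2) 1 / (2 * exp 1) \<le> kdiv \<epsilon> x"
  proof (cases "d \<le> 1")
    case True
    have "min (d\<^sup>2) 1 / (2 * exp 1) \<le> d\<^sup>2 / (2 * exp 1)" by (intro divide_right_mono) auto
    then show ?thesis using L(2)[OF True] e' by simp
  next
    case False
    have "min (d\<^sup>2) 1 / (2 * exp 1) \<le> 1 / (2 * exp 1)" by (intro divide_right_mono) auto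
    then show ?thesis using L(4) False e' by simp
  qed
qed

text \<open>Complements the quadratic lower bound, which saturates at logit distance 1: this one
  keeps growing as x tends to 0. After multiplication by 1 - \<epsilon>, the second term of
  \<open>kdiv\<close> is at least -1 by ln y \<le> y - 1; nonnegativity of \<open>kdiv\<close> then
  removes the factor.\<close>

lemma kdiv_ge_ln:
  assumes \<epsilon>: "0 < \<epsilon>" "\<epsilon> < 1" and x: "0 < x" "x < 1"
  shows "ln \<epsilon> - ln x - 1 \<le> kdiv \<epsilon> x"
proof -
  have "ln (1 - x) - ln (1 - \<epsilon>) = ln ((1 - x) / (1 - \<epsilon>))" using assms by (simp add: ln_div)
  also have "\<dots> \<le> (1 - x) / (1 - \<epsilon>) - 1" using assms by (intro ln_le_minus_one) auto
  also have "\<dots> = (\<epsilon> - x) / (1 - \<epsilon>)" using assms by (simp add: field_simps)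
  finally have "(1 - \<epsilon>) / \<epsilon> * (ln (1 - x) - ln (1 - \<epsilon>)) \<le> (1 - \<epsilon>) / \<epsilon> * ((\<epsilon> - x) / (1 - \<epsilon>))"
    using assms by (intro mult_left_mono) auto
  also have "\<dots> = 1 - x / \<epsilon>" using assms by (simp add: field_simps)
  also have "\<dots> \<le> 1" using assms by simp
  finally have "(1 - \<epsilon>) / \<epsilon> * (ln (1 - x) - ln (1 - \<epsilon>)) \<le> 1" .
  moreover have "(1 - \<epsilon>) * kdiv \<epsilon> x = ln \<epsilon> - ln x - (1 - \<epsilon>) / \<epsilon> * (ln (1 - x) - ln (1 - \<epsilon>))"
    using assms unfolding kdiv_def by (simp add: field_simps)
  ultimately have "ln \<epsilon> - ln x - 1 \<le> (1 - \<epsilon>) * kdiv \<epsilon> x" by linarith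
  also have "\<dots> \<le> kdiv \<epsilon> x" using kdiv_nonneg[OF assms] assms by (simp add: mult_left_le_one_le)
  finally show ?thesis .
qed

text \<open>The mean of \<open>kdiv_ge_ln\<close> and its mirror image. Of \<alpha> only \<alpha>
  \<ge> 1 is exploited; the resulting factor sqrt (wt x / wt \<epsilon>) is what gives decay at the
  endpoints.\<close>

lemma exp_kdiv_le:
  assumes \<epsilon>: "0 < \<epsilon>" "\<epsilon> < 1" and x: "0 < x" "x < 1" and \<alpha>: "1 \<le> \<alpha>"
  shows "exp (- \<alpha> * kdiv \<epsilon> x) \<le> exp 1 * wt x powr (1/2) * wt \<epsilon> powr (- (1/2))"
proof -
  have "ln (wt \<epsilon>) = ln \<epsilon> + ln (1 - \<epsilon>)" "ln (wt x) = ln x + ln (1 - x)"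
    using assms by (auto simp: wt_def ln_mult)
  moreover have "ln (1 - \<epsilon>) - ln (1 - x) - 1 \<le> kdiv \<epsilon> x"
    using kdiv_ge_ln[of "1 - \<epsilon>" "1 - x"] assms by (simp add: kdiv_flip)
  ultimately have "(ln (wt \<epsilon>) - ln (wt x)) / 2 - 1 \<le> kdiv \<epsilon> x"
    using kdiv_ge_ln[OF \<epsilon> x] by argo
  also have "\<dots> \<le> \<alpha> * kdiv \<epsilon> x" using mult_right_mono[OF \<alpha> kdiv_nonneg[OF \<epsilon> x]] by simp
  finally have "- \<alpha> * kdiv \<epsilon> x \<le> 1 + ln (wt x) / 2 - ln (wt \<epsilon>) / 2" by (simp add: field_simps)
  then have "exp (- \<alpha> * kdiv \<epsilon> x) \<le> exp (1 + ln (wt x) / 2 - ln (wt \<epsilon>) / 2)" by simp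
  also have "\<dots> = exp 1 * exp (1/2 * ln (wt x)) * exp (- 1/2 * ln (wt \<epsilon>))"
    unfolding exp_add[symmetric] by simp
  also have "\<dots> = exp 1 * wt x powr (1/2) * wt \<epsilon> powr (- (1/2))"
    using wt_pos[OF \<epsilon>] wt_pos[OF x] by (simp add: powr_def)
  finally show ?thesis .
qed

section \<open>Bounds for the normalising constant and the kernel\<close>

lemma beta_integrand_eq:
  assumes \<epsilon>: "0 < \<epsilon>" "\<epsilon> < 1" and x: "0 < x" "x < 1"
  shows "x powr (\<alpha> / (1 - \<epsilon>) - 1) * (1 - x) powr (\<alpha> / \<epsilon> - 1) =
    \<epsilon> powr (\<alpha> / (1 - \<epsilon>)) * (1 - \<epsilon>) powr (\<alpha> / \<epsilon>) * exp (- \<alpha> * kdiv \<epsilon> x) / wt x"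
proof -
  have "exp (- \<alpha> * kdiv \<epsilon> x) = exp (\<alpha> / (1 - \<epsilon>) * (ln x - ln \<epsilon>) + \<alpha> / \<epsilon> * (ln (1 - x) - ln (1 - \<epsilon>)))"
    unfolding kdiv_def using \<epsilon> by (simp add: field_simps)
  also have "\<dots> = (x powr (\<alpha> / (1 - \<epsilon>)) / \<epsilon> powr (\<alpha> / (1 - \<epsilon>))) * ((1 - x) powr (\<alpha> / \<epsilon>) / (1 - \<epsilon>) powr (\<alpha> / \<epsilon>))"
    using \<epsilon> x by (simp add: powr_def exp_add exp_diff right_diff_distrib)
  finally have "\<epsilon> powr (\<alpha> / (1 - \<epsilon>)) * (1 - \<epsilon>) powr (\<alpha> / \<epsilon>) * exp (- \<alpha> * kdiv \<epsilon> x) =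
      x powr (\<alpha> / (1 - \<epsilon>)) * (1 - x) powr (\<alpha> / \<epsilon>)"
    using \<epsilon> by simp
  moreover have "x powr (\<alpha> / (1 - \<epsilon>) - 1) = x powr (\<alpha> / (1 - \<epsilon>)) / x"
    "(1 - x) powr (\<alpha> / \<epsilon> - 1) = (1 - x) powr (\<alpha> / \<epsilon>) / (1 - x)"
    unfolding powr_diff using x by auto
  ultimately show ?thesis by (simp add: wt_def)
qed

lemma wkernel_eq:
  assumes \<epsilon>: "0 < \<epsilon>" "\<epsilon> < 1" and x: "0 < x" "x < 1"
  shows "beta_kernel \<alpha> \<epsilon> x = wkernel \<alpha> \<epsilon> x / wt x"
  unfolding beta_kernel_def beta_integrand_eq[OF assms] wkernel_def knorm_def by simp

lemma Beta_pos:
  fixes a b :: real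
  shows "0 < a \<Longrightarrow> 0 < b \<Longrightarrow> 0 < Beta a b"
  by (simp add: Beta_def Gamma_real_pos)

lemma knorm_pos: "0 < \<epsilon> \<Longrightarrow> \<epsilon> < 1 \<Longrightarrow> 0 < \<alpha> \<Longrightarrow> 0 < knorm \<alpha> \<epsilon>"
  unfolding knorm_def by (intro divide_pos_pos mult_pos_pos Beta_pos) auto

text \<open>Only the window \<open>|logit x - logit \<epsilon>| \<le> 1 / sqrt \<alpha>\<close> of the Beta integral is used.\<close>
lemma knorm_upper:
  assumes \<epsilon>: "0 < \<epsilon>" "\<epsilon> < 1" and \<alpha>: "1 \<le> \<alpha>"
  shows "knorm \<alpha> \<epsilon> \<le> exp 4 * sqrt \<alpha>"
proof -
  define a b where "a = \<alpha> / (1 - \<epsilon>)" and "b = \<alpha> / \<epsilon>"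
  have ab: "a > 0" "b > 0" using assms by (auto simp: a_def b_def)
  define p where "p = \<epsilon> powr a * (1 - \<epsilon>) powr b"
  have p: "p > 0" using \<epsilon> by (simp add: p_def)
  define \<delta> where "\<delta> = 1 / sqrt \<alpha>"
  have \<delta>: "0 < \<delta>" "\<delta> \<le> 1" "\<alpha> * \<delta>\<^sup>2 = 1" using \<alpha> by (auto simp: \<delta>_def power_divide)
  define Z where "Z = 1 - \<epsilon> + \<epsilon> * exp \<delta>"
  \<comment> \<open>The point with logit \<open>logit \<epsilon> + \<delta>\<close>; the integral is
    restricted to \<open>{\<epsilon>..x1}\<close>, the right half of the window.\<close>
  define x1 where "x1 = \<epsilon> * exp \<delta> / Z"
  have e1: "1 < exp \<delta>" "exp \<delta> \<le> exp 1" using \<delta> by auto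
  have "0 \<le> \<epsilon> * (exp \<delta> - 1)" "0 \<le> (1 - \<epsilon>) * (exp \<delta> - 1)" using \<epsilon> e1 by auto
  then have Z: "1 \<le> Z" "Z \<le> exp \<delta>" by (auto simp: Z_def algebra_simps)
  have x1b: "1 - x1 = (1 - \<epsilon>) / Z" using Z by (simp add: x1_def field_simps) (simp add: Z_def algebra_simps)
  have x1c: "x1 - \<epsilon> = wt \<epsilon> * (exp \<delta> - 1) / Z"
    using Z by (simp add: x1_def field_simps) (simp add: Z_def wt_def algebra_simps)
  have x1_1: "x1 < 1" using x1b Z \<epsilon> by (metis diff_gt_0_iff_gt divide_pos_pos less_le_trans zero_less_one)
  have x1_0: "\<epsilon> \<le> x1"
  proof -
    have "0 \<le> wt \<epsilon> * (exp \<delta> - 1) / Z" using wt_pos[OF \<epsilon>] e1 Z by (intro divide_nonneg_nonneg mult_nonneg_nonneg) auto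
    then show ?thesis using x1c by linarith
  qed
  have logit_x1: "logit x1 = logit \<epsilon> + \<delta>"
    using Z \<epsilon> unfolding logit_def x1b unfolding x1_def by (simp add: ln_div ln_mult)
  let ?g = "\<lambda>x. x powr (a - 1) * (1 - x) powr (b - 1)"
  \<comment> \<open>On this interval the exponent costs at most e/2 \<le> 3/2 and \<open>wt\<close>
    grows by at most the factor e; the length of the interval is at least wt \<epsilon> *
    \<delta>/e. Together this gives p * \<delta> * exp(-7/2), rounded down to exp(-4).\<close>
  have lower: "p * exp (- 3/2) / (exp 1 * wt \<epsilon>) \<le> ?g x" if "x \<in> {\<epsilon>..x1}" for x
  proof -
    have x: "0 < x" "x < 1" using that x1_1 \<epsilon> by auto
    have m1: "logit \<epsilon> \<le> logit x" "logit x \<le> logit x1"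
      using that x \<epsilon> x1_1 unfolding logit_def by (auto intro!: diff_mono)
    then have d: "\<bar>logit x - logit \<epsilon>\<bar> \<le> \<delta>" using logit_x1 by simp
    have "kdiv \<epsilon> x \<le> exp 1 * \<bar>logit x - logit \<epsilon>\<bar>\<^sup>2 / 2"
      using d \<delta> by (intro kdiv_upper \<epsilon> x) auto
    also have "\<dots> \<le> exp 1 * \<delta>\<^sup>2 / 2"
      using d by (intro divide_right_mono mult_left_mono power_mono) auto
    finally have "\<alpha> * kdiv \<epsilon> x \<le> \<alpha> * (exp 1 * \<delta>\<^sup>2 / 2)" using \<alpha> by (intro mult_left_mono) auto
    also have "\<dots> = exp 1 / 2 * (\<alpha> * \<delta>\<^sup>2)" by simp
    also have "\<dots> \<le> 3/2" using \<delta>(3) exp_le by simp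
    finally have k: "exp (- 3/2) \<le> exp (- \<alpha> * kdiv \<epsilon> x)" by simp
    have "x \<le> x1" using that by simp
    also have "x1 \<le> \<epsilon> * exp 1"
    proof -
      have "x1 \<le> \<epsilon> * exp \<delta> / 1" unfolding x1_def using Z \<epsilon> by (intro divide_left_mono) auto
      also have "\<dots> \<le> \<epsilon> * exp 1" using e1 \<epsilon> by (simp add: mult_left_mono)
      finally show ?thesis .
    qed
    finally have "wt x \<le> (\<epsilon> * exp 1) * (1 - \<epsilon>)" unfolding wt_def
      using that x by (intro mult_mono) auto
    then have w: "wt x \<le> exp 1 * wt \<epsilon>" by (simp add: wt_def mult_ac)
    have "p * exp (- 3/2) / (exp 1 * wt \<epsilon>) \<le> p * exp (- \<alpha> * kdiv \<epsilon> x) / wt x"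
      using p k w wt_pos[OF x] by (intro frac_le mult_left_mono) auto
    also have "\<dots> = ?g x" unfolding a_def b_def beta_integrand_eq[OF \<epsilon> x] p_def by simp
    finally show ?thesis .
  qed
  have gi: "?g integrable_on {0..1}" "integral {0..1} ?g = Beta a b"
    using has_integral_Beta_real[OF ab] by (auto simp: has_integral_iff)
  have gi': "?g integrable_on {\<epsilon>..x1}"
    by (rule integrable_on_subinterval[OF gi(1)]) (use \<epsilon> x1_1 in auto)
  have "p * exp (- 3/2) / (exp 1 * wt \<epsilon>) * (x1 - \<epsilon>) = integral {\<epsilon>..x1} (\<lambda>_. p * exp (- 3/2) / (exp 1 * wt \<epsilon>))"
    using x1_0 by simp
  also have "\<dots> \<le> integral {\<epsilon>..x1} ?g" using lower by (intro integral_le gi') auto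
  also have "\<dots> \<le> integral {0..1} ?g" using gi gi' \<epsilon> x1_1 by (intro integral_subset_le) auto
  finally have B: "p * exp (- 3/2) / (exp 1 * wt \<epsilon>) * (x1 - \<epsilon>) \<le> Beta a b" using gi by simp
  have "\<delta> / exp 1 \<le> (exp \<delta> - 1) / Z" using Z e1 exp_ge_add_one_self[of \<delta>] \<delta> by (intro frac_le) linarith+
  then have "wt \<epsilon> * (\<delta> / exp 1) \<le> x1 - \<epsilon>" using wt_pos[OF \<epsilon>]
    unfolding x1c times_divide_eq_right[symmetric] by (intro mult_left_mono) auto
  then have "p * exp (- 3/2) / (exp 1 * wt \<epsilon>) * (wt \<epsilon> * (\<delta> / exp 1)) \<le> p * exp (- 3/2) / (exp 1 * wt \<epsilon>) * (x1 - \<epsilon>)"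
    using p wt_pos[OF \<epsilon>] by (intro mult_left_mono) auto
  then have "p * exp (- 3/2) / (exp 1 * wt \<epsilon>) * (wt \<epsilon> * (\<delta> / exp 1)) \<le> Beta a b" using B by linarith
  moreover have "p * exp (- 3/2) / (exp 1 * wt \<epsilon>) * (wt \<epsilon> * (\<delta> / exp 1)) = p * \<delta> * (exp (-3/2) / (exp 1 * exp 1))"
    using wt_pos[OF \<epsilon>] by simp
  moreover have "exp (-3/2) / (exp 1 * exp 1) = exp (-7/2::real)"
    by (simp flip: exp_add exp_diff)
  moreover have "exp (-7/2::real) \<ge> exp (-4)" by simp
  ultimately have "p * \<delta> * exp (-4) \<le> Beta a b" using p \<delta>
    by (smt (verit) mult_left_mono mult_pos_pos)
  then have "p \<le> Beta a b * (exp 4 * sqrt \<alpha>)" using \<alpha> by (simp add: \<delta>_def exp_minus field_simps)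
  then show ?thesis using Beta_pos[OF ab] unfolding knorm_def p_def a_def b_def
    by (simp add: field_simps)
qed

text \<open>By \<open>exp_kdiv_le\<close> the Beta integrand is dominated by a multiple of the
  integrand of Beta(1/2, 1/2). The order sqrt \<alpha> is lost, which is harmless because the bound
  is later applied only inside a logarithm.\<close>

lemma knorm_lower:
  assumes \<epsilon>: "0 < \<epsilon>" "\<epsilon> < 1" and \<alpha>: "1 \<le> \<alpha>"
  shows "wt \<epsilon> powr (1/2) / (exp 1 * Beta (1/2) (1/2)) \<le> knorm \<alpha> \<epsilon>"
proof -
  define a b where "a = \<alpha> / (1 - \<epsilon>)" and "b = \<alpha> / \<epsilon>"
  have ab: "a > 0" "b > 0" using assms by (auto simp: a_def b_def)
  define p where "p = \<epsilon> powr a * (1 - \<epsilon>) powr b"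
  have p: "p > 0" using \<epsilon> by (simp add: p_def)
  have "Beta a b \<le> p * exp 1 * wt \<epsilon> powr (- (1/2)) * Beta (1/2) (1/2)"
  proof (rule has_integral_le)
    show "((\<lambda>x. x powr (a - 1) * (1 - x) powr (b - 1)) has_integral Beta a b) {0<..<1}"
      using has_integral_Beta_real[OF ab] by (simp add: has_integral_Icc_iff_Ioo)
    show "((\<lambda>x. p * exp 1 * wt \<epsilon> powr (- (1/2)) * (x powr (1/2 - 1) * (1 - x) powr (1/2 - 1)))
        has_integral p * exp 1 * wt \<epsilon> powr (- (1/2)) * Beta (1/2) (1/2)) {0<..<1}"
      using has_integral_Beta_real[of "1/2" "1/2"]
      by (intro has_integral_mult_right) (simp add: has_integral_Icc_iff_Ioo)
    fix x :: real assume "x \<in> {0<..<1}"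
    then have x: "0 < x" "x < 1" by auto
    have "x powr (a - 1) * (1 - x) powr (b - 1) = p * exp (- \<alpha> * kdiv \<epsilon> x) / wt x"
      unfolding a_def b_def beta_integrand_eq[OF \<epsilon> x] p_def by simp
    also have "\<dots> \<le> p * (exp 1 * wt x powr (1/2) * wt \<epsilon> powr (- (1/2))) / wt x"
      using p wt_pos[OF x] by (intro divide_right_mono mult_left_mono exp_kdiv_le \<epsilon> x \<alpha>) auto
    also have "\<dots> = p * exp 1 * wt \<epsilon> powr (- (1/2)) * (wt x powr (1/2) / wt x powr 1)"
      using wt_pos[OF x] by simp
    also have "wt x powr (1/2) / wt x powr 1 = wt x powr (1/2 - 1)" by (simp only: powr_diff)
    also have "\<dots> = x powr (1/2 - 1) * (1 - x) powr (1/2 - 1)"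
      using x by (simp add: wt_def powr_mult)
    finally show "x powr (a - 1) * (1 - x) powr (b - 1) \<le>
      p * exp 1 * wt \<epsilon> powr (- (1/2)) * (x powr (1/2 - 1) * (1 - x) powr (1/2 - 1))" .
  qed
  then have "p / (p * exp 1 * wt \<epsilon> powr (- (1/2)) * Beta (1/2) (1/2)) \<le> p / Beta a b"
    using p Beta_pos[OF ab] wt_pos[OF \<epsilon>] Beta_pos[of "1/2" "1/2"] by (intro divide_left_mono mult_pos_pos) auto
  moreover have "p / (p * exp 1 * wt \<epsilon> powr (- (1/2)) * Beta (1/2) (1/2)) = wt \<epsilon> powr (1/2) / (exp 1 * Beta (1/2) (1/2))"
    using p wt_pos[OF \<epsilon>] by (simp add: powr_minus field_simps)
  ultimately show ?thesis unfolding knorm_def p_def a_def b_def by simp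
qed

lemma wkernel_pos: "0 < \<epsilon> \<Longrightarrow> \<epsilon> < 1 \<Longrightarrow> 0 < \<alpha> \<Longrightarrow> 0 < wkernel \<alpha> \<epsilon> x"
  by (simp add: wkernel_def knorm_pos)

lemma wkernel_le:
  assumes "0 < \<epsilon>" "\<epsilon> < 1" "0 < x" "x < 1" "1 \<le> \<alpha>"
  shows "wkernel \<alpha> \<epsilon> x \<le> exp 4 * sqrt \<alpha>"
proof -
  have "wkernel \<alpha> \<epsilon> x \<le> (exp 4 * sqrt \<alpha>) * 1" unfolding wkernel_def
    using assms knorm_upper[of \<epsilon> \<alpha>] kdiv_nonneg[of \<epsilon> x] knorm_pos[of \<epsilon> \<alpha>]
    by (intro mult_mono) auto
  then show ?thesis by simp
qed

lemma wkernel_le_wt: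
  assumes "0 < \<epsilon>" "\<epsilon> < 1" "0 < x" "x < 1" "1 \<le> \<alpha>"
  shows "wkernel \<alpha> \<epsilon> x \<le> exp 5 * sqrt \<alpha> * wt x powr (1/2) * wt \<epsilon> powr (- (1/2))"
proof -
  have "wkernel \<alpha> \<epsilon> x \<le> (exp 4 * sqrt \<alpha>) * (exp 1 * wt x powr (1/2) * wt \<epsilon> powr (- (1/2)))"
    unfolding wkernel_def
    using assms knorm_upper[of \<epsilon> \<alpha>] exp_kdiv_le[of \<epsilon> x \<alpha>] knorm_pos[of \<epsilon> \<alpha>]
    by (intro mult_mono) auto
  also have "\<dots> = (exp 4 * exp 1) * sqrt \<alpha> * wt x powr (1/2) * wt \<epsilon> powr (- (1/2))" by simp
  also have "exp 4 * exp 1 = exp (5::real)" by (simp flip: exp_add)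
  finally show ?thesis .
qed

section \<open>Mixture densities\<close>

lemma measurable_rGamma [measurable]: "(rGamma :: real \<Rightarrow> real) \<in> borel_measurable borel"
  by (intro borel_measurable_continuous_onI continuous_on_rGamma)

text \<open>The reciprocal Gamma function is continuous everywhere, so in this form continuity and
  measurability in \<epsilon> need no discussion of the poles of Gamma.\<close>

lemma inverse_Beta_eq: "1 / Beta a b = rGamma a * rGamma b / rGamma (a + b)" for a b :: real
  by (simp add: Beta_def Gamma_def field_simps)

lemma continuous_on_wkernel:
  assumes "0 < \<theta>" "0 < \<xi>" "0 < \<alpha>"
  shows "continuous_on ({\<theta>..1 - \<theta>} \<times> {\<xi>..1 - \<xi>}) (\<lambda>(\<epsilon>, x). wkernel \<alpha> \<epsilon> x)"
proof -
  have rG: "continuous_on A (\<lambda>p. rGamma (g p))" if "continuous_on A g"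
    for A :: "(real \<times> real) set" and g :: "real \<times> real \<Rightarrow> real"
    using continuous_on_compose2[OF continuous_on_rGamma that subset_UNIV] .
  have eq: "wkernel \<alpha> \<epsilon> x = \<epsilon> powr (\<alpha> / (1 - \<epsilon>)) * (1 - \<epsilon>) powr (\<alpha> / \<epsilon>) *
      (rGamma (\<alpha> / (1 - \<epsilon>)) * rGamma (\<alpha> / \<epsilon>) / rGamma (\<alpha> / (1 - \<epsilon>) + \<alpha> / \<epsilon>)) *
      exp (- \<alpha> * kdiv \<epsilon> x)" for \<epsilon> x
    unfolding wkernel_def knorm_def inverse_Beta_eq[symmetric] by simp
  have nz: "False" if "rGamma (\<alpha> / (1 - \<epsilon>) + \<alpha> / \<epsilon>) = 0" "0 < \<epsilon>" "\<epsilon> < 1" for \<epsilon>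
  proof -
    have "0 < \<alpha> / (1 - \<epsilon>) + \<alpha> / \<epsilon>" using that assms by (simp add: add_pos_pos)
    then show ?thesis using that(1) by (auto simp: rGamma_eq_zero_iff dest: nonpos_Ints_nonpos)
  qed
  show ?thesis unfolding case_prod_unfold eq kdiv_def
    using assms by (intro continuous_intros rG) (auto dest!: nz simp del: rGamma_eq_zero_iff)
qed

text \<open>These hold for all parameters because \<open>0 powr c = 0\<close> even for negative c.
  The endpoints thereby need no exception in the final integral.\<close>

lemma beta_kernel_0 [simp]: "beta_kernel \<alpha> \<epsilon> 0 = 0" and beta_kernel_1 [simp]: "beta_kernel \<alpha> \<epsilon> 1 = 0"
  by (simp_all add: beta_kernel_def)

lemma measurable_beta_kernel [measurable]:
  assumes [measurable]: "g \<in> borel_measurable N" "h \<in> borel_measurable N"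
  shows "(\<lambda>p. beta_kernel \<alpha> (g p) (h p)) \<in> borel_measurable N"
proof -
  have eq: "beta_kernel \<alpha> \<epsilon> x = x powr (\<alpha> / (1 - \<epsilon>) - 1) * (1 - x) powr (\<alpha> / \<epsilon> - 1) *
    (rGamma (\<alpha> / (1 - \<epsilon>)) * rGamma (\<alpha> / \<epsilon>) / rGamma (\<alpha> / (1 - \<epsilon>) + \<alpha> / \<epsilon>))" for \<epsilon> x
    unfolding beta_kernel_def inverse_Beta_eq[symmetric] by simp
  show ?thesis unfolding eq by measurable
qed

lemma set_integrable_wt_powr:
  assumes "c > -1"
  shows "set_integrable lborel {0..1} (\<lambda>x. wt x powr c)"
proof -
  have "set_integrable lborel {0..1} (\<lambda>t. t powr ((c + 1) - 1) * (1 - t) powr ((c + 1) - 1))"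
    using assms by (intro integrable_Beta) auto
  also have "?this \<longleftrightarrow> ?thesis"
    by (intro set_integrable_cong) (auto simp: wt_def powr_mult)
  finally show ?thesis .
qed

section \<open>The mixing density and its smooth mixture\<close>

locale density_01 =
  fixes f :: "real \<Rightarrow> real"
  assumes dens: "prob_density_01 f"
begin

lemma f_nonneg: "0 < \<epsilon> \<Longrightarrow> \<epsilon> < 1 \<Longrightarrow> 0 \<le> f \<epsilon>"
  using dens by (simp add: prob_density_01_def)

lemma integrable_f: "set_integrable lborel {0<..<1} f"
  by (rule set_integrable_subset[of lborel "{0..1}"]) (use dens in \<open>auto simp: prob_density_01_def\<close>)

lemma integral_f: "(LINT \<epsilon>:{0<..<1}|lborel. f \<epsilon>) = 1"
proof -
  have "(LINT \<epsilon>:{0<..<1}|lborel. f \<epsilon>) = (LINT \<epsilon>:{0..1}|lborel. f \<epsilon>)"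
    unfolding set_lebesgue_integral_def
  proof (rule integral_cong_AE)
    show "AE x in lborel. indicat_real {0<..<1} x *\<^sub>R f x = indicat_real {0..1} x *\<^sub>R f x"
      using AE_lborel_singleton[of 0] AE_lborel_singleton[of 1]
      by eventually_elim (auto simp: indicator_def)
  qed (use integrable_f dens in \<open>auto simp: set_integrable_def prob_density_01_def\<close>)
  then show ?thesis using dens by (simp add: prob_density_01_def)
qed

lemma measurable_f [measurable]: "(\<lambda>\<epsilon>. indicator {0<..<1} \<epsilon> * f \<epsilon>) \<in> borel_measurable borel"
  using integrable_f by (auto simp: set_integrable_def)

text \<open>\<open>f\<close> is known to be measurable only after restriction to the unit interval,
  so the product with \<open>h\<close> is formed from the restricted version.\<close>

lemma set_integrable_f_mult:
  assumes A: "A \<in> sets borel" "A \<subseteq> {0<..<1}" and g: "set_integrable lborel {0<..<1} g"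
    and [measurable]: "h \<in> borel_measurable borel"
    and le: "\<And>\<epsilon>. \<epsilon> \<in> A \<Longrightarrow> \<bar>f \<epsilon> * h \<epsilon>\<bar> \<le> g \<epsilon>"
  shows "set_integrable lborel A (\<lambda>\<epsilon>. f \<epsilon> * h \<epsilon>)"
proof -
  have "set_integrable lborel A g" using A by (intro set_integrable_subset[OF g]) auto
  then show ?thesis unfolding set_integrable_def
  proof (rule Bochner_Integration.integrable_bound)
    have "(\<lambda>\<epsilon>. indicator A \<epsilon> * ((indicator {0<..<1} \<epsilon> * f \<epsilon>) * h \<epsilon>)) \<in> borel_measurable borel"
      using A(1) by measurable
    also have "(\<lambda>\<epsilon>. indicator A \<epsilon> * ((indicator {0<..<1} \<epsilon> * f \<epsilon>) * h \<epsilon>)) = (\<lambda>\<epsilon>. indicat_real A \<epsilon> *\<^sub>R (f \<epsilon> * h \<epsilon>))"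
      using A(2) by (intro ext) (auto simp: indicator_def)
    finally show "(\<lambda>\<epsilon>. indicat_real A \<epsilon> *\<^sub>R (f \<epsilon> * h \<epsilon>)) \<in> borel_measurable lborel" by simp
    show "AE x in lborel. norm (indicat_real A x *\<^sub>R (f x * h x)) \<le> norm (indicat_real A x *\<^sub>R g x)"
    proof (rule AE_I2)
      show "norm (indicat_real A x *\<^sub>R (f x * h x)) \<le> norm (indicat_real A x *\<^sub>R g x)" for x
        using le[of x] by (auto simp: indicator_def)
    qed
  qed
qed

end

text \<open>The finiteness of this weighted integral is all that the proof uses of the behaviour of \<open>f\<close> at
  the endpoints: it controls both the tail mass of \<open>f\<close> and the mixture density near \<open>0\<close> and \<open>1\<close>.\<close>
locale mixing_density = density_01 +
  assumes int_wt: "set_integrable lborel {0<..<1} (\<lambda>\<epsilon>. f \<epsilon> * wt \<epsilon> powr (- (1/2)))"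
begin

definition M where "M = (LINT \<epsilon>:{0<..<1}|lborel. f \<epsilon> * wt \<epsilon> powr (- (1/2)))"

lemma M_nonneg: "0 \<le> M"
  unfolding M_def set_lebesgue_integral_def
  by (intro Bochner_Integration.integral_nonneg) (auto simp: indicator_def intro!: mult_nonneg_nonneg f_nonneg)

lemma measurable_wkernel: "(\<lambda>\<epsilon>. wkernel \<alpha> \<epsilon> x) \<in> borel_measurable borel"
proof -
  have eq: "wkernel \<alpha> \<epsilon> x = \<epsilon> powr (\<alpha> / (1 - \<epsilon>)) * (1 - \<epsilon>) powr (\<alpha> / \<epsilon>) *
      (rGamma (\<alpha> / (1 - \<epsilon>)) * rGamma (\<alpha> / \<epsilon>) / rGamma (\<alpha> / (1 - \<epsilon>) + \<alpha> / \<epsilon>)) *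
      exp (- \<alpha> * kdiv \<epsilon> x)" for \<epsilon>
    unfolding wkernel_def knorm_def inverse_Beta_eq[symmetric] by simp
  show ?thesis unfolding eq kdiv_def by measurable
qed

context
  fixes \<alpha> x :: real
  assumes \<alpha>: "1 \<le> \<alpha>" and x: "0 < x" "x < 1"
begin

lemma integrable_f_wkernel:
  assumes "A \<in> sets borel" "A \<subseteq> {0<..<1}"
  shows "set_integrable lborel A (\<lambda>\<epsilon>. f \<epsilon> * wkernel \<alpha> \<epsilon> x)"
proof (rule set_integrable_f_mult[OF assms _ measurable_wkernel])
  show "set_integrable lborel {0<..<1} (\<lambda>\<epsilon>. exp 4 * sqrt \<alpha> * f \<epsilon>)"
    using integrable_f by (intro set_integrable_mult_right) auto
  fix \<epsilon> assume "\<epsilon> \<in> A"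
  then have e: "0 < \<epsilon>" "\<epsilon> < 1" using assms by auto
  have "f \<epsilon> * wkernel \<alpha> \<epsilon> x \<le> f \<epsilon> * (exp 4 * sqrt \<alpha>)"
    using e x \<alpha> by (intro mult_left_mono wkernel_le f_nonneg)
  moreover have "0 \<le> f \<epsilon> * wkernel \<alpha> \<epsilon> x"
    using e \<alpha> wkernel_pos[OF e, of \<alpha> x] f_nonneg[OF e] by simp
  ultimately show "\<bar>f \<epsilon> * wkernel \<alpha> \<epsilon> x\<bar> \<le> exp 4 * sqrt \<alpha> * f \<epsilon>"
    by (simp add: mult.commute)
qed

lemma mix_eq: "wt x * beta_mix_density \<alpha> f x = (LINT \<epsilon>:{0<..<1}|lborel. f \<epsilon> * wkernel \<alpha> \<epsilon> x)"
proof -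
  have "beta_mix_density \<alpha> f x = (LINT \<epsilon>:{0<..<1}|lborel. f \<epsilon> * wkernel \<alpha> \<epsilon> x / wt x)"
    unfolding beta_mix_density_def by (intro set_lebesgue_integral_cong) (auto simp: wkernel_eq x)
  then show ?thesis using wt_pos[OF x] by simp
qed

lemma mix_nonneg: "0 \<le> wt x * beta_mix_density \<alpha> f x"
  unfolding mix_eq set_lebesgue_integral_def using \<alpha>
  by (intro Bochner_Integration.integral_nonneg)
    (auto simp: indicator_def intro!: mult_nonneg_nonneg f_nonneg less_imp_le[OF wkernel_pos])

text \<open>The square-root decay in \<open>wt x\<close> makes the smooth mixture small near the
  endpoints: it confines large values to the range where the approximation holds, and it supplies
  the powers of \<open>wt x\<close> for the final integration.\<close>

lemma mix_le: "wt x * beta_mix_density \<alpha> f x \<le> exp 5 * M * sqrt \<alpha> * wt x powr (1/2)"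
proof -
  have "(LINT \<epsilon>:{0<..<1}|lborel. f \<epsilon> * wkernel \<alpha> \<epsilon> x) \<le>
    (LINT \<epsilon>:{0<..<1}|lborel. (exp 5 * sqrt \<alpha> * wt x powr (1/2)) * (f \<epsilon> * wt \<epsilon> powr (- (1/2))))"
  proof (rule set_integral_mono)
    fix \<epsilon> :: real assume "\<epsilon> \<in> {0<..<1}"
    then have e: "0 < \<epsilon>" "\<epsilon> < 1" by auto
    have "f \<epsilon> * wkernel \<alpha> \<epsilon> x \<le> f \<epsilon> * (exp 5 * sqrt \<alpha> * wt x powr (1/2) * wt \<epsilon> powr (- (1/2)))"
      by (intro mult_left_mono wkernel_le_wt e x \<alpha> f_nonneg)
    then show "f \<epsilon> * wkernel \<alpha> \<epsilon> x \<le> (exp 5 * sqrt \<alpha> * wt x powr (1/2)) * (f \<epsilon> * wt \<epsilon> powr (- (1/2)))"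
      by (simp add: mult_ac)
  qed (auto intro!: integrable_f_wkernel set_integrable_mult_right int_wt)
  also have "\<dots> = exp 5 * M * sqrt \<alpha> * wt x powr (1/2)" by (simp add: M_def)
  finally show ?thesis unfolding mix_eq .
qed

end

context
  fixes \<theta> :: real
  assumes \<theta>: "0 < \<theta>" "\<theta> < 1/2"
begin

lemma split_integral:
  assumes "set_integrable lborel {0<..<1} g"
  shows "(LINT \<epsilon>:{0<..<1}|lborel. g \<epsilon>) = (LINT \<epsilon>:{\<theta>..1 - \<theta>}|lborel. g \<epsilon>)
    + (LINT \<epsilon>:{0<..<1} - {\<theta>..1 - \<theta>}|lborel. g \<epsilon> :: real)"
proof -
  have "{0<..<1} = {\<theta>..1 - \<theta>} \<union> ({0<..<1} - {\<theta>..1 - \<theta>})" using \<theta> by auto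
  moreover have "(LINT \<epsilon>:{\<theta>..1 - \<theta>} \<union> ({0<..<1} - {\<theta>..1 - \<theta>})|lborel. g \<epsilon>)
    = (LINT \<epsilon>:{\<theta>..1 - \<theta>}|lborel. g \<epsilon>) + (LINT \<epsilon>:{0<..<1} - {\<theta>..1 - \<theta>}|lborel. g \<epsilon>)"
    using \<theta> by (intro set_integral_Un set_integrable_subset[OF assms]) auto
  ultimately show ?thesis by metis
qed

text \<open>Markov's inequality for the weight \<open>wt \<epsilon> powr (- (1/2))\<close>, since
  \<open>wt \<epsilon> \<le> \<theta>\<close> outside the core interval.\<close>

lemma tail_mass: "(LINT \<epsilon>:{0<..<1} - {\<theta>..1 - \<theta>}|lborel. f \<epsilon>) \<le> M * \<theta> powr (1/2)"
proof -
  let ?T = "{0<..<1} - {\<theta>..1 - \<theta>}"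
  have T: "?T \<in> sets borel" by simp
  have "(LINT \<epsilon>:?T|lborel. f \<epsilon>) \<le> (LINT \<epsilon>:?T|lborel. \<theta> powr (1/2) * (f \<epsilon> * wt \<epsilon> powr (- (1/2))))"
  proof (rule set_integral_mono)
    fix \<epsilon> :: real assume "\<epsilon> \<in> ?T"
    then have e: "0 < \<epsilon>" "\<epsilon> < 1" "\<epsilon> < \<theta> \<or> 1 - \<epsilon> < \<theta>" by auto
    then have "wt \<epsilon> \<le> \<theta>" using wt_le[of \<epsilon>] by linarith
    then have "wt \<epsilon> powr (1/2) \<le> \<theta> powr (1/2)" using wt_pos[of \<epsilon>] e by (intro powr_mono2) auto
    then have "1 \<le> \<theta> powr (1/2) * wt \<epsilon> powr (- (1/2))"
      using wt_pos[of \<epsilon>] e by (simp add: powr_minus field_simps)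
    then have "f \<epsilon> * 1 \<le> f \<epsilon> * (\<theta> powr (1/2) * wt \<epsilon> powr (- (1/2)))"
      using e by (intro mult_left_mono f_nonneg) auto
    then show "f \<epsilon> \<le> \<theta> powr (1/2) * (f \<epsilon> * wt \<epsilon> powr (- (1/2)))" by (simp add: mult_ac)
  qed (auto intro!: set_integrable_mult_right set_integrable_subset[OF int_wt] set_integrable_subset[OF integrable_f])
  also have "\<dots> = \<theta> powr (1/2) * (LINT \<epsilon>:?T|lborel. f \<epsilon> * wt \<epsilon> powr (- (1/2)))" by simp
  also have "\<dots> \<le> \<theta> powr (1/2) * M"
  proof (intro mult_left_mono)
    have "0 \<le> (LINT \<epsilon>:{\<theta>..1 - \<theta>}|lborel. f \<epsilon> * wt \<epsilon> powr (- (1/2)))"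
      unfolding set_lebesgue_integral_def using \<theta>
      by (intro Bochner_Integration.integral_nonneg) (auto simp: indicator_def intro!: mult_nonneg_nonneg f_nonneg)
    then show "(LINT \<epsilon>:?T|lborel. f \<epsilon> * wt \<epsilon> powr (- (1/2))) \<le> M"
      unfolding M_def using split_integral[OF int_wt] by simp
  qed simp
  finally show ?thesis by (simp add: mult.commute)
qed

lemma core_mass:
  "1 - M * \<theta> powr (1/2) \<le> (LINT \<epsilon>:{\<theta>..1 - \<theta>}|lborel. f \<epsilon>)"
  "(LINT \<epsilon>:{\<theta>..1 - \<theta>}|lborel. f \<epsilon>) \<le> 1"
proof -
  have "0 \<le> (LINT \<epsilon>:{0<..<1} - {\<theta>..1 - \<theta>}|lborel. f \<epsilon>)"
    unfolding set_lebesgue_integral_def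
    by (intro Bochner_Integration.integral_nonneg) (auto simp: indicator_def intro!: f_nonneg)
  then show "1 - M * \<theta> powr (1/2) \<le> (LINT \<epsilon>:{\<theta>..1 - \<theta>}|lborel. f \<epsilon>)"
    "(LINT \<epsilon>:{\<theta>..1 - \<theta>}|lborel. f \<epsilon>) \<le> 1"
    using split_integral[OF integrable_f] tail_mass integral_f by auto
qed

lemma core_mix:
  assumes "1 \<le> \<alpha>" "0 < x" "x < 1"
  shows "\<bar>wt x * beta_mix_density \<alpha> f x - (LINT \<epsilon>:{\<theta>..1 - \<theta>}|lborel. f \<epsilon> * wkernel \<alpha> \<epsilon> x)\<bar>
    \<le> exp 4 * sqrt \<alpha> * (M * \<theta> powr (1/2))"
proof -
  let ?T = "{0<..<1} - {\<theta>..1 - \<theta>}"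
  have "wt x * beta_mix_density \<alpha> f x - (LINT \<epsilon>:{\<theta>..1 - \<theta>}|lborel. f \<epsilon> * wkernel \<alpha> \<epsilon> x)
    = (LINT \<epsilon>:?T|lborel. f \<epsilon> * wkernel \<alpha> \<epsilon> x)"
    unfolding mix_eq[OF assms] using assms by (subst split_integral) (auto intro!: integrable_f_wkernel)
  moreover have "0 \<le> (LINT \<epsilon>:?T|lborel. f \<epsilon> * wkernel \<alpha> \<epsilon> x)"
    unfolding set_lebesgue_integral_def using assms
    by (intro Bochner_Integration.integral_nonneg)
      (auto simp: indicator_def intro!: mult_nonneg_nonneg f_nonneg less_imp_le[OF wkernel_pos])
  moreover have "(LINT \<epsilon>:?T|lborel. f \<epsilon> * wkernel \<alpha> \<epsilon> x) \<le> (LINT \<epsilon>:?T|lborel. (exp 4 * sqrt \<alpha>) * f \<epsilon>)"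
  proof (rule set_integral_mono)
    fix \<epsilon> :: real assume "\<epsilon> \<in> ?T"
    then have e: "0 < \<epsilon>" "\<epsilon> < 1" by auto
    have "f \<epsilon> * wkernel \<alpha> \<epsilon> x \<le> f \<epsilon> * (exp 4 * sqrt \<alpha>)"
      using e assms by (intro mult_left_mono wkernel_le f_nonneg)
    then show "f \<epsilon> * wkernel \<alpha> \<epsilon> x \<le> (exp 4 * sqrt \<alpha>) * f \<epsilon>" by (simp add: mult_ac)
  qed (use assms in \<open>auto intro!: integrable_f_wkernel set_integrable_mult_right set_integrable_subset[OF integrable_f]\<close>)
  moreover have "(LINT \<epsilon>:?T|lborel. (exp 4 * sqrt \<alpha>) * f \<epsilon>) \<le> exp 4 * sqrt \<alpha> * (M * \<theta> powr (1/2))"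
    using tail_mass assms by (simp add: mult_left_mono)
  ultimately show ?thesis by linarith
qed

end

lemma measurable_mix_density [measurable]: "(\<lambda>x. beta_mix_density \<alpha> f x) \<in> borel_measurable borel"
proof -
  have "(\<lambda>x. LINT \<epsilon>|lborel. (indicator {0<..<1} \<epsilon> * f \<epsilon>) * beta_kernel \<alpha> \<epsilon> x) \<in> borel_measurable borel"
    by (rule lborel.borel_measurable_lebesgue_integral) (use measurable_f in measurable)
  then show ?thesis
    by (simp add: beta_mix_density_def[abs_def] set_lebesgue_integral_def mult.assoc)
qed

end

text \<open>Near the endpoints the asymptotics bound \<open>f\<close> by 2 c0 + 2 c1, and
  \<open>wt \<epsilon> powr (- (1/2))\<close> is integrable; away from them this weight is bounded
  and \<open>f\<close> itself is integrable. The sum of both bounds is the dominating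
  function.\<close>

lemma mixing_density_intro:
  assumes dens: "prob_density_01 f"
    and asymp: "f \<sim>[at_right 0] (\<lambda>x. c0 * x ^ k0)" "f \<sim>[at_left 1] (\<lambda>x. c1 * (1 - x) ^ k1)"
    and c: "c0 > 0" "c1 > 0"
  shows "mixing_density f"
proof -
  interpret density_01 f by unfold_locales fact
  have "\<forall>\<^sub>F x in at_right 0. norm (f x) \<le> 2 * norm (c0 * x ^ k0)"
    by (rule asymp_equiv_imp_eventually_le[OF asymp(1)]) simp
  then obtain a where a: "a > 0" "\<And>x. 0 < x \<Longrightarrow> x < a \<Longrightarrow> \<bar>f x\<bar> \<le> 2 * \<bar>c0 * x ^ k0\<bar>"
    unfolding eventually_at_right_field by auto
  have "\<forall>\<^sub>F x in at_left 1. norm (f x) \<le> 2 * norm (c1 * (1 - x) ^ k1)"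
    by (rule asymp_equiv_imp_eventually_le[OF asymp(2)]) simp
  then obtain b where b: "b < 1" "\<And>x. b < x \<Longrightarrow> x < 1 \<Longrightarrow> \<bar>f x\<bar> \<le> 2 * \<bar>c1 * (1 - x) ^ k1\<bar>"
    unfolding eventually_at_left_field by auto
  define \<delta> where "\<delta> = min (min a (1 - b)) (1/2)"
  have \<delta>: "0 < \<delta>" "\<delta> \<le> a" "\<delta> \<le> 1 - b" "\<delta> \<le> 1/2"
    using a b unfolding \<delta>_def by linarith+
  have "set_integrable lborel {0<..<1} (\<lambda>\<epsilon>. f \<epsilon> * wt \<epsilon> powr (- (1/2)))"
  proof (rule set_integrable_f_mult)
    have "set_integrable lborel {0<..<1} (\<lambda>\<epsilon>. wt \<epsilon> powr (- (1/2)))"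
      by (rule set_integrable_subset[OF set_integrable_wt_powr]) auto
    then show "set_integrable lborel {0<..<1}
      (\<lambda>\<epsilon>. (2 * c0 + 2 * c1) * wt \<epsilon> powr (- (1/2)) + wt \<delta> powr (- (1/2)) * f \<epsilon>)"
      by (intro set_integral_add set_integrable_mult_right integrable_f impI)
    show "(\<lambda>\<epsilon>. wt \<epsilon> powr (- (1/2))) \<in> borel_measurable borel" unfolding wt_def by measurable
    fix \<epsilon> :: real assume "\<epsilon> \<in> {0<..<1}"
    then have e: "0 < \<epsilon>" "\<epsilon> < 1" by auto
    have f0: "0 \<le> f \<epsilon>" using f_nonneg e by simp
    have "f \<epsilon> * wt \<epsilon> powr (- (1/2)) \<le> (2 * c0 + 2 * c1) * wt \<epsilon> powr (- (1/2)) + wt \<delta> powr (- (1/2)) * f \<epsilon>"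
    proof (cases "\<epsilon> < \<delta> \<or> 1 - \<epsilon> < \<delta>")
      case True
      have le1: "c0 * \<epsilon> ^ k0 \<le> c0 * 1" "c1 * (1 - \<epsilon>) ^ k1 \<le> c1 * 1"
        using e c by (intro mult_left_mono power_le_one, auto)+
      have "f \<epsilon> \<le> 2 * c0 + 2 * c1"
        using True
      proof
        assume "\<epsilon> < \<delta>"
        then have "f \<epsilon> \<le> 2 * \<bar>c0 * \<epsilon> ^ k0\<bar>" using a(2)[of \<epsilon>] e \<delta> by simp
        also have "\<bar>c0 * \<epsilon> ^ k0\<bar> = c0 * \<epsilon> ^ k0" using e c by simp
        finally show ?thesis using le1 c by linarith
      next
        assume "1 - \<epsilon> < \<delta>"
        then have "f \<epsilon> \<le> 2 * \<bar>c1 * (1 - \<epsilon>) ^ k1\<bar>" using b(2)[of \<epsilon>] e \<delta> by simp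
        also have "\<bar>c1 * (1 - \<epsilon>) ^ k1\<bar> = c1 * (1 - \<epsilon>) ^ k1" using e c by simp
        finally show ?thesis using le1 c by linarith
      qed
      then have "f \<epsilon> * wt \<epsilon> powr (- (1/2)) \<le> (2 * c0 + 2 * c1) * wt \<epsilon> powr (- (1/2))"
        by (intro mult_right_mono) auto
      then show ?thesis using f0 by (simp add: add_increasing2)
    next
      case False
      have "wt \<epsilon> - wt \<delta> = (\<epsilon> - \<delta>) * (1 - \<epsilon> - \<delta>)" by (simp add: wt_def algebra_simps)
      also have "\<dots> \<ge> 0" using False by (intro mult_nonneg_nonneg) auto
      finally have "wt \<epsilon> powr (- (1/2)) \<le> wt \<delta> powr (- (1/2))"
        using wt_pos[of \<delta>] \<delta> by (intro powr_mono2') auto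
      then have "f \<epsilon> * wt \<epsilon> powr (- (1/2)) \<le> wt \<delta> powr (- (1/2)) * f \<epsilon>"
        using f0 by (simp add: mult_left_mono mult.commute)
      then show ?thesis using c by (simp add: add_increasing)
    qed
    then show "\<bar>f \<epsilon> * wt \<epsilon> powr (- (1/2))\<bar> \<le> (2 * c0 + 2 * c1) * wt \<epsilon> powr (- (1/2)) + wt \<delta> powr (- (1/2)) * f \<epsilon>"
      using f0 by (simp add: abs_mult)
  qed auto
  then show ?thesis by unfold_locales
qed

section \<open>Local expansion and compression of the kernel\<close>

lemma power_div_fact_le_exp: "x ^ n / fact n \<le> exp x" if "0 \<le> x" for x :: real
proof -
  obtain t where "exp x = (\<Sum>m<Suc n. x ^ m / fact m) + exp t / fact (Suc n) * x ^ Suc n"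
    using Maclaurin_exp_le[of x "Suc n"] by blast
  moreover have "0 \<le> exp t / fact (Suc n) * x ^ Suc n"
    using that by (intro mult_nonneg_nonneg divide_nonneg_nonneg) auto
  moreover have "0 \<le> (\<Sum>m<n. x ^ m / fact m)" using that by (intro sum_nonneg) auto
  ultimately show ?thesis by simp
qed

text \<open>The Lagrange remainder is combined with \<tau>^n/n! = e^(-n) (e \<tau>)^n/n! \<le>
  e^(-n) e^(e \<tau>). So n proportional to \<tau> terms already give an exponentially small error,
  without Stirling's formula.\<close>

lemma exp_taylor_error:
  assumes "\<bar>t\<bar> \<le> \<tau>"
  shows "\<bar>exp t - (\<Sum>m<n. t ^ m / fact m)\<bar> \<le> exp (- real n) * exp ((exp 1 + 1) * \<tau>)"
proof -
  obtain u where u: "\<bar>u\<bar> \<le> \<bar>t\<bar>" "exp t = (\<Sum>m<n. t ^ m / fact m) + exp u / fact n * t ^ n"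
    using Maclaurin_exp_le by blast
  have \<tau>: "0 \<le> \<tau>" using assms by linarith
  have "\<bar>exp t - (\<Sum>m<n. t ^ m / fact m)\<bar> = exp u * (\<bar>t\<bar> ^ n / fact n)"
    using u(2) by (simp add: abs_mult power_abs)
  also have "\<dots> \<le> exp \<tau> * (\<tau> ^ n / fact n)"
    using u(1) assms by (intro mult_mono divide_right_mono power_mono) auto
  also have "\<tau> ^ n / fact n = exp (- real n) * ((exp 1 * \<tau>) ^ n / fact n)"
    by (simp add: power_mult_distrib exp_minus exp_of_nat_mult[of n 1, simplified])
  also have "\<dots> \<le> exp (- real n) * exp (exp 1 * \<tau>)"
    using \<tau> by (intro mult_left_mono power_div_fact_le_exp) auto
  finally have "\<bar>exp t - (\<Sum>m<n. t ^ m / fact m)\<bar> \<le> exp \<tau> * (exp (- real n) * exp (exp 1 * \<tau>))"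
    by (simp add: mult_left_mono)
  also have "\<dots> = exp (- real n) * exp ((exp 1 + 1) * \<tau>)"
    unfolding exp_add[symmetric] by (simp add: distrib_right algebra_simps)
  finally show ?thesis .
qed

lemma kdiv_le:
  assumes "0 < \<epsilon>" "\<epsilon> < 1" "0 < x" "x < 1" and d: "\<bar>logit x - logit \<epsilon>\<bar> \<le> \<delta>" "\<delta> \<le> 1"
  shows "kdiv \<epsilon> x \<le> exp 1 * \<delta>\<^sup>2 / 2"
proof -
  have "kdiv \<epsilon> x \<le> exp 1 * \<bar>logit x - logit \<epsilon>\<bar>\<^sup>2 / 2" using d by (intro kdiv_upper assms) auto
  also have "\<dots> \<le> exp 1 * \<delta>\<^sup>2 / 2" using d(1) by (intro divide_right_mono mult_left_mono power_mono) auto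
  finally show ?thesis .
qed

text \<open>The cross term of the kernel exponent is linear in the odds \<open>r\<close> of \<open>\<epsilon>\<close> and in \<open>1 / r\<close>,
  so its powers span only \<open>O(n)\<close> functions of \<open>\<epsilon>\<close>.\<close>
lemma kernel_local_expansion:
  assumes \<epsilon>0: "0 < \<epsilon>0" "\<epsilon>0 < 1" and x: "0 < x" "x < 1" and \<alpha>: "1 \<le> \<alpha>"
  shows "\<exists>c. \<forall>\<epsilon>. 0 < \<epsilon> \<longrightarrow> \<epsilon> < 1 \<longrightarrow> \<bar>\<alpha> * (kdiv \<epsilon> \<epsilon>0 + kdiv \<epsilon>0 x - kdiv \<epsilon> x)\<bar> \<le> \<tau> \<longrightarrow>
    \<bar>wkernel \<alpha> \<epsilon> x - (\<Sum>j\<le>2 * n. c j * (wkernel \<alpha> \<epsilon> \<epsilon>0 * (\<epsilon> / (1 - \<epsilon>)) ^ j / (\<epsilon> / (1 - \<epsilon>)) ^ n))\<bar>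
      \<le> exp 4 * sqrt \<alpha> * (exp (- real n) * exp ((exp 1 + 1) * \<tau>))"
proof -
  define A where "A = \<alpha> * (ln x - ln \<epsilon>0)"
  define B where "B = \<alpha> * (ln (1 - x) - ln (1 - \<epsilon>0))"
  define r0 where "r0 = \<epsilon>0 / (1 - \<epsilon>0)"
  define C where "C = - (A * r0 + B / r0)"
  \<comment> \<open>With T the cross term, T r is the quadratic polynomial B + C r + A r^2 in the
    odds r. Multiplying the Taylor polynomial of exp T by r^n clears the powers of 1/r, since r^n
    T^m = r^(n-m) (T r)^m.\<close>
  define p where "p = (\<Sum>m<n. smult (1 / fact m) (monom 1 (n - m) * [:B, C, A:] ^ m))"
  have deg: "degree p \<le> 2 * n" unfolding p_def
  proof (rule degree_sum_le)
    fix m assume "m \<in> {..<n}"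
    then have "m < n" by simp
    have "degree ([:B, C, A:] ^ m) \<le> degree [:B, C, A:] * m" by (rule degree_power_le)
    also have "\<dots> \<le> 2 * m" by simp
    finally have "degree ([:B, C, A:] ^ m) \<le> 2 * m" .
    moreover have "degree (monom (1::real) (n - m)) = n - m" by (rule degree_monom_eq) simp
    moreover have "degree (monom 1 (n - m) * [:B, C, A:] ^ m) \<le>
      degree (monom (1::real) (n - m)) + degree ([:B, C, A:] ^ m)" by (rule degree_mult_le)
    ultimately have "degree (monom 1 (n - m) * [:B, C, A:] ^ m) \<le> 2 * n" using \<open>m < n\<close> by linarith
    then show "degree (smult (1 / fact m) (monom 1 (n - m) * [:B, C, A:] ^ m)) \<le> 2 * n"
      using degree_smult_le order.trans by blast
  qed simp
  \<comment> \<open>All dependence on x sits in the coefficients \<open>c\<close>; the functions of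
    \<epsilon> they multiply are the same for every x. This is what makes a common
    finite-dimensional space possible.\<close>
  define c where "c j = exp (- \<alpha> * kdiv \<epsilon>0 x) * coeff p j" for j
  show ?thesis
  proof (intro exI[of _ c] allI impI)
    fix \<epsilon> :: real
    assume \<epsilon>: "0 < \<epsilon>" "\<epsilon> < 1"
    define T where "T = \<alpha> * (kdiv \<epsilon> \<epsilon>0 + kdiv \<epsilon>0 x - kdiv \<epsilon> x)"
    assume "\<bar>\<alpha> * (kdiv \<epsilon> \<epsilon>0 + kdiv \<epsilon>0 x - kdiv \<epsilon> x)\<bar> \<le> \<tau>"
    then have T: "\<bar>T\<bar> \<le> \<tau>" by (simp add: T_def)
    define r where "r = \<epsilon> / (1 - \<epsilon>)"
    have r: "r > 0" "r0 > 0" using \<epsilon> \<epsilon>0 by (auto simp: r_def r0_def)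
    have odds: "1 / (1 - \<epsilon>) = 1 + r" "1 / \<epsilon> = 1 + 1 / r" "1 / (1 - \<epsilon>0) = 1 + r0" "1 / \<epsilon>0 = 1 + 1 / r0"
      using \<epsilon> \<epsilon>0 by (auto simp: r_def r0_def field_simps)
    have kd: "kdiv \<epsilon> y = (ln \<epsilon> - ln y) * (1 + r) + (ln (1 - \<epsilon>) - ln (1 - y)) * (1 + 1 / r)"
      "kdiv \<epsilon>0 y = (ln \<epsilon>0 - ln y) * (1 + r0) + (ln (1 - \<epsilon>0) - ln (1 - y)) * (1 + 1 / r0)" for y
      unfolding kdiv_def odds[symmetric] by simp_all
    \<comment> \<open>The logarithms of \<epsilon> and 1 - \<epsilon> cancel between the two
      divergences based at \<epsilon>, leaving A (r - r0) + B (1/r - 1/r0).\<close>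
    have Tr: "T = A * r + B * (1 / r) + C"
      unfolding T_def kd A_def B_def C_def divide_inverse by algebra
    then have Tr': "T * r = poly [:B, C, A:] r" using r by (simp add: field_simps power2_eq_square)
    have "poly p r = (\<Sum>m<n. 1 / fact m * (r ^ (n - m) * (T * r) ^ m))"
      unfolding p_def Tr' by (simp add: poly_sum poly_monom)
    also have "\<dots> = (\<Sum>m<n. r ^ n * (T ^ m / fact m))"
    proof (rule sum.cong)
      fix m assume "m \<in> {..<n}"
      then have "r ^ (n - m) * r ^ m = r ^ n" by (simp flip: power_add)
      then show "1 / fact m * (r ^ (n - m) * (T * r) ^ m) = r ^ n * (T ^ m / fact m)"
        by (simp add: power_mult_distrib mult_ac)
    qed simp
    also have "\<dots> = r ^ n * (\<Sum>m<n. T ^ m / fact m)" by (simp add: sum_distrib_left)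
    finally have pr0: "poly p r = r ^ n * (\<Sum>m<n. T ^ m / fact m)" .
    have "poly p r = poly (\<Sum>j\<le>2 * n. monom (coeff p j) j) r"
      by (simp only: poly_as_sum_of_monoms'[OF deg])
    also have "\<dots> = (\<Sum>j\<le>2 * n. coeff p j * r ^ j)" by (simp add: poly_sum poly_monom)
    finally have "(\<Sum>j\<le>2 * n. coeff p j * r ^ j) = r ^ n * (\<Sum>m<n. T ^ m / fact m)"
      using pr0 by simp
    then have pr: "(\<Sum>j\<le>2 * n. coeff p j * r ^ j) / r ^ n = (\<Sum>m<n. T ^ m / fact m)"
      using r by simp
    let ?W = "wkernel \<alpha> \<epsilon> \<epsilon>0 * exp (- \<alpha> * kdiv \<epsilon>0 x)"
    have "(\<Sum>j\<le>2 * n. c j * (wkernel \<alpha> \<epsilon> \<epsilon>0 * r ^ j / r ^ n)) = ?W * ((\<Sum>j\<le>2 * n. coeff p j * r ^ j) / r ^ n)"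
      by (simp add: c_def sum_distrib_left sum_divide_distrib mult_ac)
    also have "\<dots> = ?W * (\<Sum>m<n. T ^ m / fact m)" unfolding pr ..
    finally have app: "(\<Sum>j\<le>2 * n. c j * (wkernel \<alpha> \<epsilon> \<epsilon>0 * r ^ j / r ^ n)) = ?W * (\<Sum>m<n. T ^ m / fact m)" .
    have "- \<alpha> * kdiv \<epsilon> x = - \<alpha> * kdiv \<epsilon> \<epsilon>0 + - \<alpha> * kdiv \<epsilon>0 x + T"
      by (simp add: T_def algebra_simps)
    then have "exp (- \<alpha> * kdiv \<epsilon> x) = exp (- \<alpha> * kdiv \<epsilon> \<epsilon>0) * exp (- \<alpha> * kdiv \<epsilon>0 x) * exp T"
      by (simp only: exp_add)
    then have "wkernel \<alpha> \<epsilon> x = ?W * exp T" by (simp only: wkernel_def mult_ac)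
    then have "\<bar>wkernel \<alpha> \<epsilon> x - (\<Sum>j\<le>2 * n. c j * (wkernel \<alpha> \<epsilon> \<epsilon>0 * r ^ j / r ^ n))\<bar>
      = \<bar>?W * (exp T - (\<Sum>m<n. T ^ m / fact m))\<bar>"
      unfolding app by (simp add: right_diff_distrib)
    also have "\<dots> = ?W * \<bar>exp T - (\<Sum>m<n. T ^ m / fact m)\<bar>"
      using wkernel_pos[OF \<epsilon>, of \<alpha> \<epsilon>0] \<alpha> by (simp add: abs_mult)
    also have "\<dots> \<le> exp 4 * sqrt \<alpha> * 1 * (exp (- real n) * exp ((exp 1 + 1) * \<tau>))"
      using \<alpha> kdiv_nonneg[OF \<epsilon>0 x] wkernel_pos[OF \<epsilon>, of \<alpha> \<epsilon>0]
      by (intro mult_mono exp_taylor_error T wkernel_le \<epsilon> \<epsilon>0) auto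
    finally show "\<bar>wkernel \<alpha> \<epsilon> x - (\<Sum>j\<le>2 * n. c j * (wkernel \<alpha> \<epsilon> \<epsilon>0 * (\<epsilon> / (1 - \<epsilon>)) ^ j / (\<epsilon> / (1 - \<epsilon>)) ^ n))\<bar>
      \<le> exp 4 * sqrt \<alpha> * (exp (- real n) * exp ((exp 1 + 1) * \<tau>))"
      by (simp add: r_def)
  qed
qed

text \<open>Each basis function lives on one cell. For given x, cells within R \<Delta> of its logit
  use the local expansion, and on all others the kernel is so small that 0 approximates it;
  \<open>\<eta>\<close> is the larger of the two errors. The condition (R + 1) \<Delta> \<le> 1
  keeps all nearby pairs in the quadratic regime of \<open>kdiv\<close>, and \<open>\<tau>\<close>
  sums the three quadratic upper bounds.\<close>

lemma kernel_span_approx: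
  fixes m n :: nat and \<alpha> \<Delta> R :: real
  assumes \<alpha>: "1 \<le> \<alpha>" and \<Delta>: "0 < \<Delta>" "(R + 1) * \<Delta> \<le> 1" and R: "1 \<le> R"
  defines "\<tau> \<equiv> \<alpha> * (exp 1 / 2 * ((R + 1)\<^sup>2 + 1 + R\<^sup>2) * \<Delta>\<^sup>2)"
  defines "\<eta> \<equiv> exp 4 * sqrt \<alpha> * max (exp (- real n) * exp ((exp 1 + 1) * \<tau>)) (exp (- (\<alpha> * ((R - 1)\<^sup>2 * \<Delta>\<^sup>2) / (2 * exp 1))))"
  shows "\<exists>I \<psi>. finite I \<and> card I = (2 * m + 1) * (2 * n + 1) \<and>
    (\<forall>x. 0 < x \<longrightarrow> x < 1 \<longrightarrow> (\<exists>c. \<forall>\<epsilon>. 0 < \<epsilon> \<longrightarrow> \<epsilon> < 1 \<longrightarrow> \<bar>logit \<epsilon>\<bar> + \<Delta> \<le> real m * \<Delta> \<longrightarrow>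
      \<bar>wkernel \<alpha> \<epsilon> x - (\<Sum>i\<in>I. c i * \<psi> (i :: int \<times> nat) \<epsilon>)\<bar> \<le> \<eta>))"
proof -
  define e where "e i = expit (of_int i * \<Delta>)" for i :: int
  have e: "0 < e i" "e i < 1" "logit (e i) = of_int i * \<Delta>" for i
    by (auto simp: e_def expit_bounds)
  define cell where "cell \<epsilon> = \<lfloor>logit \<epsilon> / \<Delta>\<rfloor>" for \<epsilon>
  have cell: "of_int (cell \<epsilon>) * \<Delta> \<le> logit \<epsilon>" "logit \<epsilon> < (of_int (cell \<epsilon>) + 1) * \<Delta>" for \<epsilon>
  proof -
    have "of_int (cell \<epsilon>) \<le> logit \<epsilon> / \<Delta>" "logit \<epsilon> / \<Delta> < of_int (cell \<epsilon>) + 1"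
      unfolding cell_def by linarith+
    then show "of_int (cell \<epsilon>) * \<Delta> \<le> logit \<epsilon>" "logit \<epsilon> < (of_int (cell \<epsilon>) + 1) * \<Delta>"
      using \<Delta> by (simp_all add: field_simps)
  qed
  define \<psi> where "\<psi> = (\<lambda>(i, j) \<epsilon>. if cell \<epsilon> = i
    then wkernel \<alpha> \<epsilon> (e i) * (\<epsilon> / (1 - \<epsilon>)) ^ j / (\<epsilon> / (1 - \<epsilon>)) ^ n else 0)"
  define I where "I = {- int m..int m} \<times> {..2 * n}"
  have "card {- int m..int m} = 2 * m + 1" unfolding card_atLeastAtMost_int by linarith
  then have "finite I" "card I = (2 * m + 1) * (2 * n + 1)"
    by (simp_all add: I_def card_cartesian_product)
  moreover have "\<exists>c. \<forall>\<epsilon>. 0 < \<epsilon> \<longrightarrow> \<epsilon> < 1 \<longrightarrow> \<bar>logit \<epsilon>\<bar> + \<Delta> \<le> real m * \<Delta> \<longrightarrow>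
      \<bar>wkernel \<alpha> \<epsilon> x - (\<Sum>i\<in>I. c i * \<psi> i \<epsilon>)\<bar> \<le> \<eta>" if x: "0 < x" "x < 1" for x
  proof -
    have "\<forall>i. \<exists>c. \<forall>\<epsilon>. 0 < \<epsilon> \<longrightarrow> \<epsilon> < 1 \<longrightarrow> \<bar>\<alpha> * (kdiv \<epsilon> (e i) + kdiv (e i) x - kdiv \<epsilon> x)\<bar> \<le> \<tau> \<longrightarrow>
      \<bar>wkernel \<alpha> \<epsilon> x - (\<Sum>j\<le>2 * n. c j * (wkernel \<alpha> \<epsilon> (e i) * (\<epsilon> / (1 - \<epsilon>)) ^ j / (\<epsilon> / (1 - \<epsilon>)) ^ n))\<bar>
        \<le> exp 4 * sqrt \<alpha> * (exp (- real n) * exp ((exp 1 + 1) * \<tau>))"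
      by (intro allI kernel_local_expansion e x \<alpha>)
    from choice[OF this] obtain c where c: "\<And>i \<epsilon>. 0 < \<epsilon> \<Longrightarrow> \<epsilon> < 1 \<Longrightarrow>
      \<bar>\<alpha> * (kdiv \<epsilon> (e i) + kdiv (e i) x - kdiv \<epsilon> x)\<bar> \<le> \<tau> \<Longrightarrow>
      \<bar>wkernel \<alpha> \<epsilon> x - (\<Sum>j\<le>2 * n. c i j * (wkernel \<alpha> \<epsilon> (e i) * (\<epsilon> / (1 - \<epsilon>)) ^ j / (\<epsilon> / (1 - \<epsilon>)) ^ n))\<bar>
        \<le> exp 4 * sqrt \<alpha> * (exp (- real n) * exp ((exp 1 + 1) * \<tau>))" by blast
    \<comment> \<open>Dropping the far cells is essential: there the exponent would be too large for
      a Taylor polynomial of degree below n.\<close>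
    define c' where "c' = (\<lambda>(i, j). if \<bar>logit x - of_int i * \<Delta>\<bar> \<le> R * \<Delta> then c i j else 0)"
    show ?thesis
    proof (intro exI[of _ c'] allI impI)
      fix \<epsilon> assume \<epsilon>: "0 < \<epsilon>" "\<epsilon> < 1" and m: "\<bar>logit \<epsilon>\<bar> + \<Delta> \<le> real m * \<Delta>"
      define i where "i = cell \<epsilon>"
      have ci: "of_int i * \<Delta> \<le> logit \<epsilon>" "logit \<epsilon> < of_int i * \<Delta> + \<Delta>"
        using cell[of \<epsilon>] by (auto simp: i_def distrib_right)
      \<comment> \<open>The spare \<Delta> in the assumption on \<open>logit \<epsilon>\<close> pays
        for rounding down to the left end of the cell.\<close>
      have "of_int i * \<Delta> \<le> real m * \<Delta>" "(- real m) * \<Delta> \<le> of_int i * \<Delta>"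
        using ci m by linarith+
      then have "of_int i \<le> real m" "- real m \<le> of_int i"
        using \<Delta> unfolding mult_le_cancel_right_pos[OF \<Delta>(1)] by auto
      then have i: "i \<in> {- int m..int m}" by auto
      have "(\<Sum>k\<in>I. c' k * \<psi> k \<epsilon>) = (\<Sum>k\<in>{- int m..int m}. \<Sum>j\<le>2 * n. c' (k, j) * \<psi> (k, j) \<epsilon>)"
        unfolding I_def sum.cartesian_product by (simp add: case_prod_unfold)
      also have "\<dots> = (\<Sum>k\<in>{- int m..int m}. if k = i then \<Sum>j\<le>2 * n. c' (i, j) * \<psi> (i, j) \<epsilon> else 0)"
        by (intro sum.cong) (auto simp: \<psi>_def i_def)
      also have "\<dots> = (\<Sum>j\<le>2 * n. c' (i, j) * \<psi> (i, j) \<epsilon>)" using i by (simp add: sum.delta)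
      finally have S: "(\<Sum>k\<in>I. c' k * \<psi> k \<epsilon>) = (\<Sum>j\<le>2 * n. c' (i, j) * \<psi> (i, j) \<epsilon>)" .
      show "\<bar>wkernel \<alpha> \<epsilon> x - (\<Sum>i\<in>I. c' i * \<psi> i \<epsilon>)\<bar> \<le> \<eta>"
      proof (cases "\<bar>logit x - of_int i * \<Delta>\<bar> \<le> R * \<Delta>")
        case True
        have S': "(\<Sum>k\<in>I. c' k * \<psi> k \<epsilon>) = (\<Sum>j\<le>2 * n. c i j * (wkernel \<alpha> \<epsilon> (e i) * (\<epsilon> / (1 - \<epsilon>)) ^ j / (\<epsilon> / (1 - \<epsilon>)) ^ n))"
          unfolding S using True by (simp add: c'_def \<psi>_def i_def)
        have R\<Delta>: "R * \<Delta> \<le> 1" "\<Delta> \<le> 1" "0 \<le> R * \<Delta>" using \<Delta> R by (auto simp: distrib_right)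
          (smt (verit) mult_nonneg_nonneg)
        have k1: "kdiv \<epsilon> (e i) \<le> exp 1 * \<Delta>\<^sup>2 / 2"
          using ci e R\<Delta> by (intro kdiv_le \<epsilon>) auto
        have k2: "kdiv (e i) x \<le> exp 1 * (R * \<Delta>)\<^sup>2 / 2"
          using True e R\<Delta> by (intro kdiv_le x) auto
        have k3: "kdiv \<epsilon> x \<le> exp 1 * ((R + 1) * \<Delta>)\<^sup>2 / 2"
        proof (rule kdiv_le[OF \<epsilon> x])
          have "\<bar>logit x - logit \<epsilon>\<bar> \<le> R * \<Delta> + \<Delta>" using True ci by linarith
          then show "\<bar>logit x - logit \<epsilon>\<bar> \<le> (R + 1) * \<Delta>" by (simp add: distrib_right)
        qed (use \<Delta> in auto)
        have "\<bar>\<alpha> * (kdiv \<epsilon> (e i) + kdiv (e i) x - kdiv \<epsilon> x)\<bar>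
          = \<alpha> * \<bar>kdiv \<epsilon> (e i) + kdiv (e i) x - kdiv \<epsilon> x\<bar>" using \<alpha> by (simp add: abs_mult)
        also have "\<dots> \<le> \<alpha> * (exp 1 * ((R + 1) * \<Delta>)\<^sup>2 / 2 + exp 1 * \<Delta>\<^sup>2 / 2 + exp 1 * (R * \<Delta>)\<^sup>2 / 2)"
        proof (intro mult_left_mono)
          have "0 \<le> kdiv \<epsilon> (e i)" "0 \<le> kdiv (e i) x" "0 \<le> kdiv \<epsilon> x"
            using kdiv_nonneg e x \<epsilon> by auto
          then show "\<bar>kdiv \<epsilon> (e i) + kdiv (e i) x - kdiv \<epsilon> x\<bar>
            \<le> exp 1 * ((R + 1) * \<Delta>)\<^sup>2 / 2 + exp 1 * \<Delta>\<^sup>2 / 2 + exp 1 * (R * \<Delta>)\<^sup>2 / 2"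
            using k1 k2 k3 by linarith
        qed (use \<alpha> in auto)
        also have "\<dots> = \<tau>"
        proof -
          have "\<alpha> * (b * (u * w) / 2 + b * w / 2 + b * (v * w) / 2) = \<alpha> * (b / 2 * (u + 1 + v) * w)"
            for b u v w :: real by (simp add: field_simps)
          then show ?thesis unfolding \<tau>_def power_mult_distrib .
        qed
        finally have "\<bar>wkernel \<alpha> \<epsilon> x - (\<Sum>i\<in>I. c' i * \<psi> i \<epsilon>)\<bar> \<le> exp 4 * sqrt \<alpha> * (exp (- real n) * exp ((exp 1 + 1) * \<tau>))"
          unfolding S' by (intro c \<epsilon>)
        also have "\<dots> \<le> \<eta>" unfolding \<eta>_def using \<alpha> by (intro mult_left_mono) auto
        finally show ?thesis .
      next
        case False
        have S': "(\<Sum>k\<in>I. c' k * \<psi> k \<epsilon>) = 0"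
          unfolding S using False by (simp add: c'_def)
        \<comment> \<open>\<epsilon> lies within \<Delta> of the left end of its cell, which turns
          distance R \<Delta> from the cell end into (R - 1) \<Delta> from \<epsilon>.\<close>
        have d: "(R - 1) * \<Delta> \<le> \<bar>logit x - logit \<epsilon>\<bar>" using False ci by (simp add: left_diff_distrib)
        have r0: "0 \<le> (R - 1) * \<Delta>" "(R - 1) * \<Delta> \<le> 1" using R \<Delta> by (auto simp: algebra_simps)
        have "(R - 1)\<^sup>2 * \<Delta>\<^sup>2 = ((R - 1) * \<Delta>)\<^sup>2" by (simp add: power_mult_distrib)
        also have "\<dots> \<le> min (\<bar>logit x - logit \<epsilon>\<bar>\<^sup>2) 1"
          by (intro min.boundedI power_mono power_le_one d r0)
        finally have "(R - 1)\<^sup>2 * \<Delta>\<^sup>2 / (2 * exp 1) \<le> kdiv \<epsilon> x"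
          using kdiv_lower[OF \<epsilon> x] by (smt (verit) divide_right_mono exp_ge_zero)
        then have "\<alpha> * ((R - 1)\<^sup>2 * \<Delta>\<^sup>2 / (2 * exp 1)) \<le> \<alpha> * kdiv \<epsilon> x" using \<alpha> by (intro mult_left_mono) auto
        then have ex: "exp (- \<alpha> * kdiv \<epsilon> x) \<le> exp (- (\<alpha> * ((R - 1)\<^sup>2 * \<Delta>\<^sup>2) / (2 * exp 1)))" by simp
        have "wkernel \<alpha> \<epsilon> x \<le> exp 4 * sqrt \<alpha> * exp (- (\<alpha> * ((R - 1)\<^sup>2 * \<Delta>\<^sup>2) / (2 * exp 1)))"
          unfolding wkernel_def using knorm_pos[OF \<epsilon>, of \<alpha>] \<alpha> by (intro mult_mono knorm_upper \<epsilon> ex) auto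
        also have "\<dots> \<le> \<eta>" unfolding \<eta>_def using \<alpha> by (intro mult_left_mono) auto
        finally show ?thesis unfolding S' using wkernel_pos[OF \<epsilon>, of \<alpha> x] \<alpha> by simp
      qed
    qed
  qed
  ultimately show ?thesis by blast
qed

lemma abs_logit_le_ln:
  assumes "\<theta> \<le> \<epsilon>" "\<epsilon> \<le> 1 - \<theta>" "0 < \<theta>"
  shows "\<bar>logit \<epsilon>\<bar> \<le> - ln \<theta>"
proof -
  have "ln \<theta> \<le> ln \<epsilon>" "ln \<epsilon> \<le> 0" "ln \<theta> \<le> ln (1 - \<epsilon>)" "ln (1 - \<epsilon>) \<le> 0"
    using assms by auto
  then show ?thesis by (simp add: logit_def)
qed

text \<open>The choice \<Delta>^2 = ln \<alpha>/\<alpha> makes \<alpha> \<Delta>^2 = ln \<alpha>, so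
  both errors of the preceding lemma become powers of \<alpha>, and \<open>R\<close> and
  \<open>\<kappa>\<close> can be tuned to reach any exponent.\<close>

lemma kernel_span_approx_asymp:
  fixes T E :: real
  assumes "0 < T" "0 < E"
  shows "\<exists>C>0. \<forall>\<^sub>F \<alpha> in at_top. \<exists>(I :: (int \<times> nat) set) \<psi>. finite I \<and>
    real (card I) \<le> C * sqrt \<alpha> * ln \<alpha> powr (3/2) \<and>
    (\<forall>x. 0 < x \<longrightarrow> x < 1 \<longrightarrow> (\<exists>c. \<forall>\<epsilon>\<in>{\<alpha> powr (-T)..1 - \<alpha> powr (-T)}.
      \<bar>wkernel \<alpha> \<epsilon> x - (\<Sum>i\<in>I. c i * \<psi> i \<epsilon>)\<bar> \<le> \<alpha> powr (-E)))"
proof -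
  \<comment> \<open>Solves (R - 1)^2/(2 e) = E + 1, so the kernel outside the near cells carries the
    factor \<alpha>^(-(E + 1)). The surplus 1 absorbs the prefactor e^4 sqrt \<alpha>.\<close>
  define R where "R = 1 + sqrt (2 * exp 1 * (E + 1))"
  have R: "1 \<le> R" "(R - 1)\<^sup>2 = 2 * exp 1 * (E + 1)" using assms by (auto simp: R_def)
  define \<kappa>0 where "\<kappa>0 = exp 1 / 2 * ((R + 1)\<^sup>2 + 1 + R\<^sup>2)"
  \<comment> \<open>With n \<ge> \<kappa> ln \<alpha>, the gain exp(-n) beats the Taylor factor
    exp((e + 1) \<kappa>0 ln \<alpha>) by the same \<alpha>^(-(E + 1)).\<close>
  define \<kappa> where "\<kappa> = (exp 1 + 1) * \<kappa>0 + E + 1"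
  have "0 \<le> \<kappa>0" unfolding \<kappa>0_def by (intro mult_nonneg_nonneg add_nonneg_nonneg) auto
  then have \<kappa>: "0 < \<kappa>" using assms unfolding \<kappa>_def by (intro add_nonneg_pos add_nonneg_nonneg mult_nonneg_nonneg) auto
  define C where "C = (2 * T + 5) * (2 * \<kappa> + 3)"
  have "C > 0" using assms \<kappa> by (auto simp: C_def intro!: mult_pos_pos)
  moreover have "\<forall>\<^sub>F \<alpha> in at_top. \<exists>(I :: (int \<times> nat) set) \<psi>. finite I \<and>
    real (card I) \<le> C * sqrt \<alpha> * ln \<alpha> powr (3/2) \<and>
    (\<forall>x. 0 < x \<longrightarrow> x < 1 \<longrightarrow> (\<exists>c. \<forall>\<epsilon>\<in>{\<alpha> powr (-T)..1 - \<alpha> powr (-T)}.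
      \<bar>wkernel \<alpha> \<epsilon> x - (\<Sum>i\<in>I. c i * \<psi> i \<epsilon>)\<bar> \<le> \<alpha> powr (-E)))"
  proof -
    have "\<forall>\<^sub>F \<alpha> in at_top. (R + 1) * sqrt (ln \<alpha> / \<alpha>) \<le> 1"
    proof -
      have "((\<lambda>\<alpha>. (R + 1) * sqrt (ln \<alpha> / \<alpha>)) \<longlongrightarrow> 0) at_top" by real_asymp
      then show ?thesis by (rule eventually_mono[OF order_tendstoD(2)[of _ 0 _ 1]]) auto
    qed
    \<comment> \<open>ln \<alpha> \<ge> 8 is exactly what 4 + (ln \<alpha>)/2 \<le> ln \<alpha>
      requires, the comparison of e^4 sqrt \<alpha> with \<alpha>.\<close>
    then show ?thesis using eventually_ge_at_top[of "exp 8"]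
    proof eventually_elim
      case (elim \<alpha>)
      have "1 \<le> exp (8::real)" by simp
      then have \<alpha>: "1 \<le> \<alpha>" using elim(2) by linarith
      define L where "L = ln \<alpha>"
      have "ln (exp 8) \<le> L" unfolding L_def using elim(2) \<alpha> by (subst ln_le_cancel_iff) auto
      then have L: "8 \<le> L" by simp
      have \<alpha>L: "\<alpha> powr u = exp (u * L)" for u using \<alpha> by (simp add: L_def powr_def)
      define \<Delta> where "\<Delta> = sqrt (L / \<alpha>)"
      have "0 < L / \<alpha>" using \<alpha> L by (intro divide_pos_pos) auto
      then have \<Delta>: "0 < \<Delta>" "(R + 1) * \<Delta> \<le> 1" "\<alpha> * \<Delta>\<^sup>2 = L"
        using elim(1) \<alpha> L by (auto simp: \<Delta>_def L_def)
      define m where "m = nat \<lceil>T * L / \<Delta>\<rceil> + 1"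
      define n where "n = nat \<lceil>\<kappa> * L\<rceil>"
      have TL: "0 \<le> T * L / \<Delta>" "0 \<le> \<kappa> * L" using assms L \<Delta> \<kappa> by auto
      have m: "T * L / \<Delta> + 1 \<le> real m" "real m \<le> T * L / \<Delta> + 2"
        using TL unfolding m_def by linarith+
      have n: "\<kappa> * L \<le> real n" "real n \<le> \<kappa> * L + 1"
        using TL unfolding n_def by linarith+
      obtain I :: "(int \<times> nat) set" and \<psi> where I: "finite I" "card I = (2 * m + 1) * (2 * n + 1)"
        and app: "\<And>x. 0 < x \<Longrightarrow> x < 1 \<Longrightarrow> (\<exists>c. \<forall>\<epsilon>. 0 < \<epsilon> \<longrightarrow> \<epsilon> < 1 \<longrightarrow> \<bar>logit \<epsilon>\<bar> + \<Delta> \<le> real m * \<Delta> \<longrightarrow>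
         \<bar>wkernel \<alpha> \<epsilon> x - (\<Sum>i\<in>I. c i * \<psi> i \<epsilon>)\<bar> \<le> exp 4 * sqrt \<alpha> *
            max (exp (- real n) * exp ((exp 1 + 1) * (\<alpha> * (exp 1 / 2 * ((R + 1)\<^sup>2 + 1 + R\<^sup>2) * \<Delta>\<^sup>2))))
              (exp (- (\<alpha> * ((R - 1)\<^sup>2 * \<Delta>\<^sup>2) / (2 * exp 1)))))"
        using kernel_span_approx[OF \<alpha> \<Delta>(1,2) R(1), of m n] by blast
      have 1: "\<alpha> * (exp 1 / 2 * ((R + 1)\<^sup>2 + 1 + R\<^sup>2) * \<Delta>\<^sup>2) = \<kappa>0 * L"
        unfolding \<Delta>(3)[symmetric] \<kappa>0_def by simp
      have 2: "\<alpha> * ((R - 1)\<^sup>2 * \<Delta>\<^sup>2) / (2 * exp 1) = (E + 1) * L"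
        unfolding \<Delta>(3)[symmetric] R by simp
      have "exp (- real n) * exp ((exp 1 + 1) * (\<kappa>0 * L)) = exp (- real n + (exp 1 + 1) * (\<kappa>0 * L))"
        by (simp only: exp_add)
      also have "\<dots> \<le> exp (- ((E + 1) * L))"
        using n(1) by (simp add: \<kappa>_def algebra_simps)
      finally have 3: "max (exp (- real n) * exp ((exp 1 + 1) * (\<kappa>0 * L))) (exp (- ((E + 1) * L))) = exp (- ((E + 1) * L))"
        by simp
      have "exp 4 * sqrt \<alpha> * exp (- ((E + 1) * L)) = exp (4 + L / 2 - (E + 1) * L)"
      proof -
        have "sqrt \<alpha> = exp (L / 2)" using \<alpha> \<alpha>L[of "1/2"] by (simp add: powr_half_sqrt)
        then show ?thesis by (simp flip: exp_add)
      qed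
      also have "\<dots> \<le> exp (- E * L)" using L by (simp add: algebra_simps)
      finally have err: "exp 4 * sqrt \<alpha> * exp (- ((E + 1) * L)) \<le> \<alpha> powr (- E)" by (simp add: \<alpha>L)
      have "1 * 1 \<le> sqrt \<alpha> * sqrt L" using \<alpha> L by (intro mult_mono) auto
      then have s: "1 \<le> sqrt \<alpha> * sqrt L" by simp
      have sL: "sqrt L * L = L powr (3/2)"
        using L powr_add[of L "1/2" 1] by (simp add: powr_half_sqrt)
      have LD: "L / \<Delta> = sqrt \<alpha> * sqrt L"
      proof -
        have "L / \<Delta> = (L / sqrt L) * sqrt \<alpha>" by (simp add: \<Delta>_def real_sqrt_divide)
        also have "L / sqrt L = sqrt L" using L by (intro real_div_sqrt) auto
        finally show ?thesis by simp
      qed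
      have "real (card I) = (2 * real m + 1) * (2 * real n + 1)" by (simp add: I(2) algebra_simps)
      also have "\<dots> \<le> ((2 * T + 5) * (sqrt \<alpha> * sqrt L)) * ((2 * \<kappa> + 3) * L)"
      proof (intro mult_mono)
        have "2 * real m + 1 \<le> 2 * T * (L / \<Delta>) + 5 * 1" using m by simp
        also have "\<dots> \<le> 2 * T * (L / \<Delta>) + 5 * (sqrt \<alpha> * sqrt L)" using s by simp
        finally show "2 * real m + 1 \<le> (2 * T + 5) * (sqrt \<alpha> * sqrt L)" unfolding LD by (simp add: distrib_right)
        show "2 * real n + 1 \<le> (2 * \<kappa> + 3) * L" using n L by (simp add: distrib_right)
        show "0 \<le> (2 * T + 5) * (sqrt \<alpha> * sqrt L)" using assms(1) s
          by (intro mult_nonneg_nonneg[of "2 * T + 5"]) auto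
      qed simp
      also have "\<dots> = C * sqrt \<alpha> * (sqrt L * L)" by (simp add: C_def)
      finally have cardI: "real (card I) \<le> C * sqrt \<alpha> * ln \<alpha> powr (3/2)" by (simp only: sL L_def[symmetric])
      have "\<exists>c. \<forall>\<epsilon>\<in>{\<alpha> powr (-T)..1 - \<alpha> powr (-T)}.
        \<bar>wkernel \<alpha> \<epsilon> x - (\<Sum>i\<in>I. c i * \<psi> i \<epsilon>)\<bar> \<le> \<alpha> powr (-E)" if x: "0 < x" "x < 1" for x
      proof -
        obtain c where c: "\<And>\<epsilon>. 0 < \<epsilon> \<Longrightarrow> \<epsilon> < 1 \<Longrightarrow> \<bar>logit \<epsilon>\<bar> + \<Delta> \<le> real m * \<Delta> \<Longrightarrow>
         \<bar>wkernel \<alpha> \<epsilon> x - (\<Sum>i\<in>I. c i * \<psi> i \<epsilon>)\<bar> \<le> exp 4 * sqrt \<alpha> * exp (- ((E + 1) * L))"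
          using app[OF x] unfolding 1 2 3 by blast
        show ?thesis
        proof (intro exI[of _ c] ballI)
          fix \<epsilon> assume e: "\<epsilon> \<in> {\<alpha> powr (-T)..1 - \<alpha> powr (-T)}"
          have th: "0 < \<alpha> powr (-T)" using \<alpha> by simp
          have "\<bar>logit \<epsilon>\<bar> \<le> - ln (\<alpha> powr (-T))" using e th by (intro abs_logit_le_ln) auto
          also have "\<dots> = T * L" using \<alpha> by (simp add: L_def ln_powr)
          finally have "\<bar>logit \<epsilon>\<bar> + \<Delta> \<le> (T * L / \<Delta> + 1) * \<Delta>" using \<Delta> by (simp add: distrib_right)
          also have "\<dots> \<le> real m * \<Delta>" using m \<Delta> by (intro mult_right_mono) auto
          finally have "\<bar>logit \<epsilon>\<bar> + \<Delta> \<le> real m * \<Delta>" .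
          moreover have "0 < \<epsilon>" "\<epsilon> < 1" using e th by (simp_all, linarith+)
          ultimately have "\<bar>wkernel \<alpha> \<epsilon> x - (\<Sum>i\<in>I. c i * \<psi> i \<epsilon>)\<bar> \<le> exp 4 * sqrt \<alpha> * exp (- ((E + 1) * L))"
            using c by simp
          then show "\<bar>wkernel \<alpha> \<epsilon> x - (\<Sum>i\<in>I. c i * \<psi> i \<epsilon>)\<bar> \<le> \<alpha> powr (-E)"
            using err by linarith
        qed
      qed
      with I(1) cardI show ?case by blast
    qed
  qed
  ultimately show ?thesis by blast
qed

text \<open>Two measures with equal sums against every basis function differ on the kernel only by
  approximation errors, one for each measure; hence the factor 2. The coefficients vary with x but
  the new weights do not, so a single reduction serves all x.\<close>

lemma kernel_compression:
  fixes T E :: real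
  assumes "0 < T" "0 < E"
  shows "\<exists>C>0. \<forall>\<^sub>F \<alpha> in at_top. \<forall>S \<mu>. finite S \<longrightarrow> S \<subseteq> {\<alpha> powr (-T)..1 - \<alpha> powr (-T)} \<longrightarrow> (\<forall>s\<in>S. 0 \<le> \<mu> s) \<longrightarrow>
    (\<exists>S' \<nu>. S' \<subseteq> S \<and> real (card S') \<le> C * sqrt \<alpha> * ln \<alpha> powr (3/2) \<and> (\<forall>s\<in>S'. 0 \<le> \<nu> s) \<and>
      (\<Sum>s\<in>S'. \<nu> s) = (\<Sum>s\<in>S. \<mu> s) \<and>
      (\<forall>x. 0 < x \<longrightarrow> x < 1 \<longrightarrow>
        \<bar>(\<Sum>s\<in>S'. \<nu> s * wkernel \<alpha> s x) - (\<Sum>s\<in>S. \<mu> s * wkernel \<alpha> s x)\<bar> \<le> 2 * \<alpha> powr (-E) * (\<Sum>s\<in>S. \<mu> s)))"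
proof -
  obtain C where C: "C > 0" and ev: "\<forall>\<^sub>F \<alpha> in at_top. \<exists>(I :: (int \<times> nat) set) \<psi>. finite I \<and>
    real (card I) \<le> C * sqrt \<alpha> * ln \<alpha> powr (3/2) \<and>
    (\<forall>x. 0 < x \<longrightarrow> x < 1 \<longrightarrow> (\<exists>c. \<forall>\<epsilon>\<in>{\<alpha> powr (-T)..1 - \<alpha> powr (-T)}.
      \<bar>wkernel \<alpha> \<epsilon> x - (\<Sum>i\<in>I. c i * \<psi> i \<epsilon>)\<bar> \<le> \<alpha> powr (-E)))"
    using kernel_span_approx_asymp[OF assms] by blast
  have big: "\<forall>\<^sub>F \<alpha> in at_top. 1 \<le> sqrt \<alpha> * ln \<alpha> powr (3/2)" by real_asymp
  show ?thesis
  proof (intro exI[of _ "C + 1"] conjI)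
    show "0 < C + 1" using C by simp
    show "\<forall>\<^sub>F \<alpha> in at_top. \<forall>S \<mu>. finite S \<longrightarrow> S \<subseteq> {\<alpha> powr (-T)..1 - \<alpha> powr (-T)} \<longrightarrow> (\<forall>s\<in>S. 0 \<le> \<mu> s) \<longrightarrow>
    (\<exists>S' \<nu>. S' \<subseteq> S \<and> real (card S') \<le> (C + 1) * sqrt \<alpha> * ln \<alpha> powr (3/2) \<and> (\<forall>s\<in>S'. 0 \<le> \<nu> s) \<and>
      (\<Sum>s\<in>S'. \<nu> s) = (\<Sum>s\<in>S. \<mu> s) \<and>
      (\<forall>x. 0 < x \<longrightarrow> x < 1 \<longrightarrow>
        \<bar>(\<Sum>s\<in>S'. \<nu> s * wkernel \<alpha> s x) - (\<Sum>s\<in>S. \<mu> s * wkernel \<alpha> s x)\<bar> \<le> 2 * \<alpha> powr (-E) * (\<Sum>s\<in>S. \<mu> s)))"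
      using ev big
    proof eventually_elim
      case (elim \<alpha>)
      then obtain I :: "(int \<times> nat) set" and \<psi> where I: "finite I" "real (card I) \<le> C * sqrt \<alpha> * ln \<alpha> powr (3/2)"
        and app: "\<And>x. 0 < x \<Longrightarrow> x < 1 \<Longrightarrow> (\<exists>c. \<forall>\<epsilon>\<in>{\<alpha> powr (-T)..1 - \<alpha> powr (-T)}.
          \<bar>wkernel \<alpha> \<epsilon> x - (\<Sum>i\<in>I. c i * \<psi> i \<epsilon>)\<bar> \<le> \<alpha> powr (-E))" by blast
      show ?case
      proof (intro allI impI)
        fix S :: "real set" and \<mu> :: "real \<Rightarrow> real"
        assume S: "finite S" "S \<subseteq> {\<alpha> powr (-T)..1 - \<alpha> powr (-T)}" and \<mu>: "\<forall>s\<in>S. 0 \<le> \<mu> s"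
        \<comment> \<open>\<open>None\<close> stands for the constant function 1, which preserves
          the mass. This extra functional is the \<open>+ 1\<close> in the constant
          \<open>C + 1\<close>.\<close>
        define J where "J = insert None (Some ` I)"
        define \<phi> where "\<phi> i s = (case i of None \<Rightarrow> 1 | Some k \<Rightarrow> \<psi> k s)" for i s
        have J: "finite J" "card J = card I + 1"
          using I(1) by (auto simp: J_def card_image card_insert_if)
        obtain S' \<nu> where S': "S' \<subseteq> S" "card S' \<le> card J" and \<nu>: "\<forall>s\<in>S'. 0 \<le> \<nu> s"
          and eq: "\<And>i. i \<in> J \<Longrightarrow> (\<Sum>s\<in>S'. \<nu> s * \<phi> i s) = (\<Sum>s\<in>S. \<mu> s * \<phi> i s)"
          using caratheodory_reduction[OF J(1) S(1), of \<mu> \<phi>] \<mu> by blast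
        have mass: "(\<Sum>s\<in>S'. \<nu> s) = (\<Sum>s\<in>S. \<mu> s)" using eq[of None] by (simp add: J_def \<phi>_def)
        have eqI: "(\<Sum>s\<in>S'. \<nu> s * \<psi> i s) = (\<Sum>s\<in>S. \<mu> s * \<psi> i s)" if "i \<in> I" for i
          using eq[of "Some i"] that by (simp add: J_def \<phi>_def)
        have "real (card S') \<le> real (card I) + 1" using S'(2) J(2) by simp
        also have "\<dots> \<le> (C + 1) * sqrt \<alpha> * ln \<alpha> powr (3/2)"
          using I(2) elim(2) by (simp add: algebra_simps)
        finally have card: "real (card S') \<le> (C + 1) * sqrt \<alpha> * ln \<alpha> powr (3/2)" .
        have "\<bar>(\<Sum>s\<in>S'. \<nu> s * wkernel \<alpha> s x) - (\<Sum>s\<in>S. \<mu> s * wkernel \<alpha> s x)\<bar>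
            \<le> 2 * \<alpha> powr (-E) * (\<Sum>s\<in>S. \<mu> s)" if x: "0 < x" "x < 1" for x
        proof -
          obtain c where c: "\<And>\<epsilon>. \<epsilon> \<in> {\<alpha> powr (-T)..1 - \<alpha> powr (-T)} \<Longrightarrow>
            \<bar>wkernel \<alpha> \<epsilon> x - (\<Sum>i\<in>I. c i * \<psi> i \<epsilon>)\<bar> \<le> \<alpha> powr (-E)" using app[OF x] by blast
          define A where "A s = (\<Sum>i\<in>I. c i * \<psi> i s)" for s
          have swap: "(\<Sum>s\<in>B. v s * A s) = (\<Sum>i\<in>I. c i * (\<Sum>s\<in>B. v s * \<psi> i s))" for B v
            unfolding A_def sum_distrib_left by (subst sum.swap) (simp add: mult_ac)
          have same: "(\<Sum>s\<in>S'. \<nu> s * A s) = (\<Sum>s\<in>S. \<mu> s * A s)"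
            unfolding swap by (intro sum.cong) (auto simp: eqI)
          have dev: "\<bar>(\<Sum>s\<in>B. v s * wkernel \<alpha> s x) - (\<Sum>s\<in>B. v s * A s)\<bar> \<le> \<alpha> powr (-E) * (\<Sum>s\<in>B. v s)"
            if "B \<subseteq> S" "\<forall>s\<in>B. 0 \<le> v s" for B v
          proof -
            have "\<bar>(\<Sum>s\<in>B. v s * wkernel \<alpha> s x) - (\<Sum>s\<in>B. v s * A s)\<bar> = \<bar>\<Sum>s\<in>B. v s * (wkernel \<alpha> s x - A s)\<bar>"
              by (simp add: sum_subtractf right_diff_distrib)
            also have "\<dots> \<le> (\<Sum>s\<in>B. \<bar>v s * (wkernel \<alpha> s x - A s)\<bar>)" by (rule sum_abs)
            also have "\<dots> \<le> (\<Sum>s\<in>B. v s * \<alpha> powr (-E))"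
            proof (rule sum_mono)
              fix s assume "s \<in> B"
              then have "\<bar>wkernel \<alpha> s x - A s\<bar> \<le> \<alpha> powr (-E)" "0 \<le> v s"
                unfolding A_def using that S(2) by (auto intro!: c)
              then show "\<bar>v s * (wkernel \<alpha> s x - A s)\<bar> \<le> v s * \<alpha> powr (-E)"
                by (simp add: abs_mult mult_left_mono)
            qed
            finally show ?thesis by (simp add: sum_distrib_right[symmetric] mult.commute)
          qed
          show ?thesis using dev[OF S'(1) \<nu>] dev[OF order.refl \<mu>] unfolding same mass by linarith
        qed
        with S'(1) card \<nu> mass show "\<exists>S' \<nu>. S' \<subseteq> S \<and> real (card S') \<le> (C + 1) * sqrt \<alpha> * ln \<alpha> powr (3/2) \<and>
          (\<forall>s\<in>S'. 0 \<le> \<nu> s) \<and> (\<Sum>s\<in>S'. \<nu> s) = (\<Sum>s\<in>S. \<mu> s) \<and>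
          (\<forall>x. 0 < x \<longrightarrow> x < 1 \<longrightarrow>
            \<bar>(\<Sum>s\<in>S'. \<nu> s * wkernel \<alpha> s x) - (\<Sum>s\<in>S. \<mu> s * wkernel \<alpha> s x)\<bar> \<le> 2 * \<alpha> powr (-E) * (\<Sum>s\<in>S. \<mu> s))"
          by blast
      qed
    qed
  qed
qed

section \<open>The approximating distributions\<close>

lemma logit_grid:
  fixes \<Delta> b y :: real
  assumes "0 < \<Delta>" "\<bar>y\<bar> \<le> b"
  defines "m \<equiv> nat \<lceil>b / \<Delta>\<rceil> + 1"
  shows "\<exists>s\<in>(\<lambda>i. expit (of_int i * \<Delta>)) ` {- int m..int m}. \<bar>y - logit s\<bar> \<le> \<Delta> \<and> \<bar>logit s\<bar> \<le> b + \<Delta>"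
proof -
  define i where "i = \<lfloor>y / \<Delta>\<rfloor>"
  have 1: "of_int i \<le> y / \<Delta>" "y / \<Delta> < of_int i + 1" unfolding i_def by linarith+
  have i: "of_int i * \<Delta> \<le> y" "y < of_int i * \<Delta> + \<Delta>"
    using 1 assms by (simp_all add: field_simps)
  have "y / \<Delta> \<le> b / \<Delta>" "- (b / \<Delta>) \<le> y / \<Delta>"
    using assms by (auto simp: divide_le_cancel minus_divide_left simp del: minus_divide_left[symmetric])
  moreover have "b / \<Delta> + 1 \<le> real m" "b / \<Delta> \<le> of_int \<lceil>b / \<Delta>\<rceil>" unfolding m_def by linarith+
  ultimately have "of_int i \<le> real m" "- real m \<le> of_int i" using 1 by linarith+
  then have im: "i \<in> {- int m..int m}" by auto
  show ?thesis
    by (rule bexI[of _ "expit (of_int i * \<Delta>)"]) (use i assms(2) im in auto)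
qed

lemma embed_finite_pmf:
  assumes "finite S" "\<And>s. s \<in> S \<Longrightarrow> 0 < \<rho> s" "(\<Sum>s\<in>S. \<rho> s) = 1"
  shows "\<exists>P. set_pmf P = S \<and> (\<forall>s\<in>S. pmf P s = \<rho> s)"
proof -
  define g where "g s = (if s \<in> S then \<rho> s else 0)" for s
  have g0: "0 \<le> g s" for s using assms(2)[of s] by (auto simp: g_def)
  have "(\<integral>\<^sup>+ s. ennreal (g s) \<partial>count_space UNIV) = (\<Sum>s\<in>S. ennreal (g s))"
    by (rule nn_integral_count_space') (auto simp: g_def assms)
  also have "\<dots> = ennreal (\<Sum>s\<in>S. g s)" using g0 by (intro sum_ennreal) auto
  also have "(\<Sum>s\<in>S. g s) = 1" using assms(3) by (simp add: g_def)
  finally have g1: "(\<integral>\<^sup>+ s. ennreal (g s) \<partial>count_space UNIV) = 1" by simp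
  have p: "pmf (embed_pmf g) s = g s" for s using pmf_embed_pmf[OF g0 g1] .
  moreover have "set_pmf (embed_pmf g) = S"
    unfolding set_pmf_iff set_eq_iff p using assms(2) by (auto simp: g_def set_pmf_iff p) (metis less_irrefl)
  ultimately show ?thesis by (intro exI[of _ "embed_pmf g"]) (auto simp: g_def)
qed

context mixing_density
begin

text \<open>T = 2 E + 1 is chosen so that sqrt \<alpha> times the square root of the cutoff
  \<alpha>^(-T) is \<alpha>^(-E); the kernel bound times the tail mass then costs e^4 M
  \<alpha>^(-E). In the constant 3 + e^4 M, discretisation contributes 1 and compression 2. The
  missing mass is recorded for completion to a probability, and x is kept in a compact interval for
  the sake of the discretisation.\<close>

lemma sparse_core:
  assumes E: "0 < E"
  defines "T \<equiv> 2 * E + 1"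
  shows "\<exists>C>0. \<forall>\<^sub>F \<alpha> in at_top. \<exists>S \<nu>. finite S \<and> S \<subseteq> {\<alpha> powr (-T)..1 - \<alpha> powr (-T)} \<and>
    real (card S) \<le> C * sqrt \<alpha> * ln \<alpha> powr (3/2) \<and> (\<forall>s\<in>S. 0 \<le> \<nu> s) \<and>
    sum \<nu> S \<le> 1 \<and> exp 4 * sqrt \<alpha> * (1 - sum \<nu> S) \<le> exp 4 * M * \<alpha> powr (-E) \<and>
    (\<forall>x\<in>{\<alpha> powr (-T)..1 - \<alpha> powr (-T)}.
      \<bar>(\<Sum>s\<in>S. \<nu> s * wkernel \<alpha> s x) - wt x * beta_mix_density \<alpha> f x\<bar> \<le> (3 + exp 4 * M) * \<alpha> powr (-E))"
proof -
  have T: "0 < T" using E by (simp add: T_def)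
  obtain C where C: "C > 0" and ev: "\<forall>\<^sub>F \<alpha> in at_top. \<forall>S \<mu>. finite S \<longrightarrow> S \<subseteq> {\<alpha> powr (-T)..1 - \<alpha> powr (-T)} \<longrightarrow> (\<forall>s\<in>S. 0 \<le> \<mu> s) \<longrightarrow>
    (\<exists>S' \<nu>. S' \<subseteq> S \<and> real (card S') \<le> C * sqrt \<alpha> * ln \<alpha> powr (3/2) \<and> (\<forall>s\<in>S'. 0 \<le> \<nu> s) \<and>
      (\<Sum>s\<in>S'. \<nu> s) = (\<Sum>s\<in>S. \<mu> s) \<and>
      (\<forall>x. 0 < x \<longrightarrow> x < 1 \<longrightarrow>
        \<bar>(\<Sum>s\<in>S'. \<nu> s * wkernel \<alpha> s x) - (\<Sum>s\<in>S. \<mu> s * wkernel \<alpha> s x)\<bar> \<le> 2 * \<alpha> powr (-E) * (\<Sum>s\<in>S. \<mu> s)))"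
    using kernel_compression[OF T E] by blast
  have small: "\<forall>\<^sub>F \<alpha> in at_top. \<alpha> powr (-T) < 1/2" using T by real_asymp
  show ?thesis
  proof (intro exI[of _ C] conjI C)
    show "\<forall>\<^sub>F \<alpha> in at_top. \<exists>S \<nu>. finite S \<and> S \<subseteq> {\<alpha> powr (-T)..1 - \<alpha> powr (-T)} \<and>
    real (card S) \<le> C * sqrt \<alpha> * ln \<alpha> powr (3/2) \<and> (\<forall>s\<in>S. 0 \<le> \<nu> s) \<and>
    sum \<nu> S \<le> 1 \<and> exp 4 * sqrt \<alpha> * (1 - sum \<nu> S) \<le> exp 4 * M * \<alpha> powr (-E) \<and>
    (\<forall>x\<in>{\<alpha> powr (-T)..1 - \<alpha> powr (-T)}.
      \<bar>(\<Sum>s\<in>S. \<nu> s * wkernel \<alpha> s x) - wt x * beta_mix_density \<alpha> f x\<bar> \<le> (3 + exp 4 * M) * \<alpha> powr (-E))"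
      using ev small eventually_ge_at_top[of 1]
    proof eventually_elim
      case (elim \<alpha>)
      define \<theta> where "\<theta> = \<alpha> powr (-T)"
      have \<theta>: "0 < \<theta>" "\<theta> < 1/2" using elim by (auto simp: \<theta>_def)
      let ?m = "LINT t:{\<theta>..1 - \<theta>}|lborel. f t"
      have "(-T) * (1/2) = -E - 1/2" by (simp add: T_def)
      then have "\<theta> powr (1/2) = \<alpha> powr (-E - 1/2)" by (simp only: \<theta>_def powr_powr)
      then have "sqrt \<alpha> * \<theta> powr (1/2) = \<alpha> powr (1/2 + (-E - 1/2))"
        using elim(3) by (simp only: powr_add powr_half_sqrt)
      then have s\<theta>: "sqrt \<alpha> * \<theta> powr (1/2) = \<alpha> powr (-E)" by simp
      have icore: "set_integrable lborel {\<theta>..1 - \<theta>} f"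
        by (rule set_integrable_subset[OF integrable_f]) (use \<theta> in auto)
      have "\<exists>S \<mu>. finite S \<and> S \<subseteq> {\<theta>..1 - \<theta>} \<and> (\<forall>s\<in>S. 0 \<le> \<mu> s) \<and> sum \<mu> S = ?m \<and>
        (\<forall>x\<in>{\<theta>..1 - \<theta>}. \<bar>(\<Sum>s\<in>S. \<mu> s * wkernel \<alpha> s x) - (LINT t:{\<theta>..1 - \<theta>}|lborel. f t * wkernel \<alpha> t x)\<bar>
          \<le> \<alpha> powr (-E) * ?m)"
        using \<theta> elim(3) f_nonneg
        by (intro discretize_density compact_Icc continuous_on_wkernel icore) auto
      then obtain S \<mu> where S: "finite S" "S \<subseteq> {\<theta>..1 - \<theta>}" "\<forall>s\<in>S. 0 \<le> \<mu> s" "sum \<mu> S = ?m"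
        and disc: "\<forall>x\<in>{\<theta>..1 - \<theta>}. \<bar>(\<Sum>s\<in>S. \<mu> s * wkernel \<alpha> s x) - (LINT t:{\<theta>..1 - \<theta>}|lborel. f t * wkernel \<alpha> t x)\<bar>
          \<le> \<alpha> powr (-E) * ?m"
        by blast
      from elim(1)[folded \<theta>_def, THEN spec, THEN spec, THEN mp, THEN mp, THEN mp, OF S(1,2,3)]
      obtain S' \<nu> where S': "S' \<subseteq> S" "real (card S') \<le> C * sqrt \<alpha> * ln \<alpha> powr (3/2)" "\<forall>s\<in>S'. 0 \<le> \<nu> s"
          "sum \<nu> S' = sum \<mu> S"
        and comp: "\<forall>x. 0 < x \<longrightarrow> x < 1 \<longrightarrow> \<bar>(\<Sum>s\<in>S'. \<nu> s * wkernel \<alpha> s x) - (\<Sum>s\<in>S. \<mu> s * wkernel \<alpha> s x)\<bar>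
          \<le> 2 * \<alpha> powr (-E) * sum \<mu> S"
        by blast
      have mass: "sum \<nu> S' \<le> 1" "1 - sum \<nu> S' \<le> M * \<theta> powr (1/2)"
        using core_mass[OF \<theta>] S(4) S'(4) by auto
      have "exp 4 * sqrt \<alpha> * (1 - sum \<nu> S') \<le> exp 4 * sqrt \<alpha> * (M * \<theta> powr (1/2))"
        using mass elim by (intro mult_left_mono) auto
      also have "\<dots> = exp 4 * M * (sqrt \<alpha> * \<theta> powr (1/2))" by simp
      finally have rest: "exp 4 * sqrt \<alpha> * (1 - sum \<nu> S') \<le> exp 4 * M * \<alpha> powr (-E)" unfolding s\<theta> .
      have "\<bar>(\<Sum>s\<in>S'. \<nu> s * wkernel \<alpha> s x) - wt x * beta_mix_density \<alpha> f x\<bar> \<le> (3 + exp 4 * M) * \<alpha> powr (-E)"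
        if x: "x \<in> {\<theta>..1 - \<theta>}" for x
      proof -
        have x01: "0 < x" "x < 1" using x \<theta> by auto
        have "exp 4 * sqrt \<alpha> * (M * \<theta> powr (1/2)) = exp 4 * M * \<alpha> powr (-E)" unfolding s\<theta>[symmetric] by simp
        moreover have "\<alpha> powr (-E) * ?m \<le> \<alpha> powr (-E)" using core_mass(2)[OF \<theta>] by (simp add: mult_left_le)
        ultimately show ?thesis
          using disc[THEN bspec, OF x] comp[rule_format, OF x01] core_mix[OF \<theta> elim(3) x01] unfolding S(4) distrib_right by linarith
      qed
      moreover have "finite S'" "S' \<subseteq> {\<theta>..1 - \<theta>}" using S S' finite_subset by auto
      ultimately show ?case using S'(2,3) mass(1) rest unfolding \<theta>_def by blast
    qed
  qed
qed

text \<open>The distribution has to serve all \<open>p\<close> at once, so the logarithm of the mixture may grow only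
  polylogarithmically in \<open>\<alpha>\<close> outside a region of superpolynomially small mass. This is why support
  points are required up to logit \<open>(ln \<alpha>)\<^sup>2\<close>, far beyond the polynomial range on which the
  mixture itself is approximated.\<close>
definition good_pmf :: "real \<Rightarrow> real \<Rightarrow> real pmf \<Rightarrow> bool" where
  "good_pmf E \<alpha> P \<longleftrightarrow> finite (set_pmf P) \<and> set_pmf P \<subseteq> {0<..<1} \<and>
    (\<forall>s\<in>set_pmf P. \<alpha> powr (- (E + 2)) < pmf P s) \<and> 1/2 \<in> set_pmf P \<and>
    (\<forall>y. \<bar>y\<bar> \<le> (ln \<alpha>)\<^sup>2 \<longrightarrow> (\<exists>s\<in>set_pmf P. \<bar>y - logit s\<bar> \<le> sqrt (ln \<alpha> / \<alpha>) \<and> \<bar>logit s\<bar> \<le> (ln \<alpha>)\<^sup>2 + 1)) \<and>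
    (\<forall>x\<in>{\<alpha> powr (- (2 * E + 1))..1 - \<alpha> powr (- (2 * E + 1))}.
      \<bar>(\<Sum>s\<in>set_pmf P. pmf P s * wkernel \<alpha> s x) - wt x * beta_mix_density \<alpha> f x\<bar> \<le> \<alpha> powr (1 - E))"

text \<open>Three modifications turn the sparse core into a distribution: the grid joins the
  support, the missing mass goes to the grid point 1/2, and a share \<alpha>^(-E) is spread
  uniformly. Each changes the mixture by at most a constant times sqrt \<alpha> * \<alpha>^(-E),
  which \<alpha>^(1 - E) absorbs.\<close>

lemma sparse_mixture:
  assumes E: "0 < E"
  shows "\<exists>C>0. \<forall>\<^sub>F \<alpha> in at_top. \<exists>P. good_pmf E \<alpha> P \<and>
    real (card (set_pmf P)) \<le> C * sqrt \<alpha> * ln \<alpha> powr (3/2)"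
proof -
  define T where "T = 2 * E + 1"
  obtain C where C: "C > 0" and ev: "\<forall>\<^sub>F \<alpha> in at_top. \<exists>S \<nu>. finite S \<and> S \<subseteq> {\<alpha> powr (-T)..1 - \<alpha> powr (-T)} \<and>
    real (card S) \<le> C * sqrt \<alpha> * ln \<alpha> powr (3/2) \<and> (\<forall>s\<in>S. 0 \<le> \<nu> s) \<and>
    sum \<nu> S \<le> 1 \<and> exp 4 * sqrt \<alpha> * (1 - sum \<nu> S) \<le> exp 4 * M * \<alpha> powr (-E) \<and>
    (\<forall>x\<in>{\<alpha> powr (-T)..1 - \<alpha> powr (-T)}.
      \<bar>(\<Sum>s\<in>S. \<nu> s * wkernel \<alpha> s x) - wt x * beta_mix_density \<alpha> f x\<bar> \<le> (3 + exp 4 * M) * \<alpha> powr (-E))"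
    using sparse_core[OF E] unfolding T_def by blast
  have ev1: "\<forall>\<^sub>F \<alpha> in at_top. (C + 7) * sqrt \<alpha> * ln \<alpha> powr (3/2) < \<alpha>"
    by real_asymp
  have ev2: "\<forall>\<^sub>F \<alpha> in at_top. (3 + 2 * (exp 4 * M)) * \<alpha> powr (-E) + 2 * exp 4 * sqrt \<alpha> * \<alpha> powr (-E) \<le> \<alpha> powr (1 - E)"
  proof -
    define K where "K = 3 + 2 * (exp 4 * M)"
    have "\<forall>\<^sub>F \<alpha> in at_top. K + 2 * exp 4 * sqrt \<alpha> \<le> \<alpha>" by real_asymp
    then show ?thesis using eventually_gt_at_top[of 0]
    proof eventually_elim
      case (elim \<alpha>)
      have "(K + 2 * exp 4 * sqrt \<alpha>) * \<alpha> powr (-E) \<le> \<alpha> * \<alpha> powr (-E)"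
        using elim by (intro mult_right_mono) auto
      also have "\<dots> = \<alpha> powr (1 - E)" using elim powr_add[of \<alpha> 1 "-E"] by simp
      finally show ?case by (simp add: K_def distrib_right)
    qed
  qed
  have ev3: "\<forall>\<^sub>F \<alpha> in at_top. sqrt (ln \<alpha> / \<alpha>) \<le> 1" by real_asymp
  have ev4: "\<forall>\<^sub>F \<alpha> in at_top. 1 \<le> sqrt \<alpha> * ln \<alpha> powr (3/2)" by real_asymp
  show ?thesis
  proof (intro exI[of _ "C + 7"] conjI)
    show "0 < C + 7" using C by simp
    show "\<forall>\<^sub>F \<alpha> in at_top. \<exists>P. good_pmf E \<alpha> P \<and>
      real (card (set_pmf P)) \<le> (C + 7) * sqrt \<alpha> * ln \<alpha> powr (3/2)"
      using ev ev1 ev2 ev3 ev4 eventually_ge_at_top[of "exp 1"]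
    proof eventually_elim
      case (elim \<alpha>)
      have "1 \<le> exp (1::real)" by simp
      then have \<alpha>: "1 \<le> \<alpha>" using elim(6) by linarith
      define L where "L = ln \<alpha>"
      have "ln (exp 1) \<le> L" unfolding L_def using elim(6) \<alpha> by (subst ln_le_cancel_iff) auto
      then have L: "1 \<le> L" by simp
      define \<Delta> where "\<Delta> = sqrt (L / \<alpha>)"
      have "0 < L / \<alpha>" using \<alpha> L by (intro divide_pos_pos) auto
      then have \<Delta>: "0 < \<Delta>" "\<Delta> \<le> 1" using elim(4) by (auto simp: \<Delta>_def L_def)
      obtain S \<nu> where S: "finite S" "S \<subseteq> {\<alpha> powr (-T)..1 - \<alpha> powr (-T)}"
        "real (card S) \<le> C * sqrt \<alpha> * ln \<alpha> powr (3/2)" "\<forall>s\<in>S. 0 \<le> \<nu> s"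
        "sum \<nu> S \<le> 1" "exp 4 * sqrt \<alpha> * (1 - sum \<nu> S) \<le> exp 4 * M * \<alpha> powr (-E)"
        and app: "\<And>x. x \<in> {\<alpha> powr (-T)..1 - \<alpha> powr (-T)} \<Longrightarrow>
          \<bar>(\<Sum>s\<in>S. \<nu> s * wkernel \<alpha> s x) - wt x * beta_mix_density \<alpha> f x\<bar> \<le> (3 + exp 4 * M) * \<alpha> powr (-E)"
        using elim(1) by blast
      \<comment> \<open>Mesh sqrt (L/\<alpha>) up to logit L^2 takes about 2 L^2/\<Delta> = 2 sqrt
        \<alpha> * L^(3/2) points: the square of the logarithm is the farthest range, up to
        constants, that the permitted support size affords. Rounding adds at most 5 points, whence
        the constant 7.\<close>
      define m where "m = nat \<lceil>L\<^sup>2 / \<Delta>\<rceil> + 1"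
      define G where "G = (\<lambda>i. expit (of_int i * \<Delta>)) ` {- int m..int m}"
      have half: "1/2 \<in> G" unfolding G_def by (rule image_eqI[of _ _ 0]) (auto simp: expit_def)
      have G: "finite G" "G \<subseteq> {0<..<1}" by (auto simp: G_def expit_bounds)
      have "real (card G) \<le> real (card {- int m..int m})" unfolding G_def by (intro of_nat_mono card_image_le) auto
      also have "\<dots> = 2 * real m + 1" by simp
      also have "\<dots> \<le> 2 * (L\<^sup>2 / \<Delta>) + 5"
      proof -
        have "0 \<le> L\<^sup>2 / \<Delta>" using \<Delta> by simp
        then have "real m \<le> L\<^sup>2 / \<Delta> + 2" unfolding m_def by linarith
        then show ?thesis by simp
      qed
      also have "L\<^sup>2 / \<Delta> = sqrt \<alpha> * ln \<alpha> powr (3/2)"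
      proof -
        have "L\<^sup>2 / \<Delta> = L * (L / sqrt L) * sqrt \<alpha>" by (simp add: \<Delta>_def real_sqrt_divide power2_eq_square)
        also have "L / sqrt L = sqrt L" using L by (intro real_div_sqrt) auto
        also have "L * sqrt L = L powr (3/2)" using L powr_add[of L 1 "1/2"] by (simp add: powr_half_sqrt)
        finally show ?thesis by (simp add: L_def)
      qed
      also have "2 * (sqrt \<alpha> * ln \<alpha> powr (3/2)) + 5 \<le> 7 * (sqrt \<alpha> * ln \<alpha> powr (3/2))" using elim(5) by simp
      finally have cardG: "real (card G) \<le> 7 * (sqrt \<alpha> * ln \<alpha> powr (3/2))" .
      define S1 where "S1 = S \<union> G"
      have th: "0 < \<alpha> powr (-T)" using \<alpha> by simp
      have S1: "finite S1" "S1 \<subseteq> {0<..<1}" "1/2 \<in> S1"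
      proof -
        have "{u..1 - u} \<subseteq> {0<..<1}" if "0 < u" for u :: real using that by auto
        from this[OF th] have "{\<alpha> powr (-T)..1 - \<alpha> powr (-T)} \<subseteq> {0<..<1}" .
        then show "S1 \<subseteq> {0<..<1}" using S(2) G(2) by (auto simp: S1_def)
      qed (use S(1) G(1) half in \<open>auto simp: S1_def\<close>)
      have "real (card S1) \<le> real (card S) + real (card G)" unfolding S1_def
        by (metis card_Un_le of_nat_add of_nat_mono)
      then have cardS1: "real (card S1) \<le> (C + 7) * sqrt \<alpha> * ln \<alpha> powr (3/2)"
        using S(3) cardG by (simp add: distrib_right)
      have n0: "0 < real (card S1)" using S1 card_gt_0_iff by (metis emptyE of_nat_0_less_iff)
      define \<eta> where "\<eta> = \<alpha> powr (-E)"
      have "\<alpha> powr (-E) \<le> \<alpha> powr 0" using \<alpha> E by (intro powr_mono) auto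
      then have \<eta>: "0 < \<eta>" "\<eta> \<le> 1" using \<alpha> by (auto simp: \<eta>_def)
      define h :: real where "h = 1/2"
      have h: "h \<in> S1" using S1(3) by (simp add: h_def)
      define \<nu>' where "\<nu>' s = (if s \<in> S then \<nu> s else 0) + (if s = h then 1 - sum \<nu> S else 0)" for s
      have \<nu>'0: "0 \<le> \<nu>' s" for s using S(4,5) by (auto simp: \<nu>'_def)
      have \<nu>'sum: "(\<Sum>s\<in>S1. \<nu>' s * g s) = (\<Sum>s\<in>S. \<nu> s * g s) + (1 - sum \<nu> S) * g h" for g :: "real \<Rightarrow> real"
      proof -
        have "(\<Sum>s\<in>S1. \<nu>' s * g s) = (\<Sum>s\<in>S1. if s \<in> S then \<nu> s * g s else 0) + (\<Sum>s\<in>S1. if s = h then (1 - sum \<nu> S) * g h else 0)"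
          unfolding sum.distrib[symmetric] by (intro sum.cong) (auto simp: \<nu>'_def distrib_right)
        also have "(\<Sum>s\<in>S1. if s \<in> S then \<nu> s * g s else 0) = (\<Sum>s\<in>S. \<nu> s * g s)"
          using S1(1) by (subst sum.inter_restrict[symmetric]) (auto simp: S1_def Int_absorb1 Un_Int_eq)
        also have "(\<Sum>s\<in>S1. if s = h then (1 - sum \<nu> S) * g h else 0) = (1 - sum \<nu> S) * g h"
          using S1(1) h by simp
        finally show ?thesis .
      qed
      define \<rho> where "\<rho> s = (1 - \<eta>) * \<nu>' s + \<eta> / real (card S1)" for s
      have \<rho>sum: "(\<Sum>s\<in>S1. \<rho> s * g s) = (1 - \<eta>) * ((\<Sum>s\<in>S. \<nu> s * g s) + (1 - sum \<nu> S) * g h)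
          + \<eta> * ((\<Sum>s\<in>S1. g s) / real (card S1))" for g :: "real \<Rightarrow> real"
      proof -
        have "\<rho> s * g s = (1 - \<eta>) * (\<nu>' s * g s) + \<eta> * (g s / real (card S1))" for s
          by (simp add: \<rho>_def distrib_right)
        then show ?thesis
          unfolding \<nu>'sum[symmetric] by (simp only: sum.distrib sum_distrib_left sum_divide_distrib)
      qed
      \<comment> \<open>The support has fewer than \<alpha> points, so the uniform share alone gives
        each of them more than \<alpha>^(-E - 1).\<close>
      have \<rho>low: "\<alpha> powr (- (E + 2)) < \<rho> s" for s
      proof -
        have "\<alpha> powr (- (E + 2)) \<le> \<alpha> powr (- E - 1)" using \<alpha> by (intro powr_mono) auto
        also have "\<dots> = \<eta> / \<alpha>" using \<alpha> by (simp add: \<eta>_def powr_diff)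
        also have "\<dots> < \<eta> / real (card S1)"
          using n0 cardS1 elim(2) \<eta> by (intro divide_strict_left_mono) (auto intro!: mult_pos_pos)
        also have "\<dots> \<le> \<rho> s" unfolding \<rho>_def using \<nu>'0[of s] \<eta> by simp
        finally show ?thesis .
      qed
      have \<rho>1: "sum \<rho> S1 = 1" using \<rho>sum[of "\<lambda>_. 1"] n0 by simp
      have \<rho>0: "0 < \<rho> s" for s by (rule le_less_trans[OF powr_ge_zero \<rho>low])
      have "\<exists>P. set_pmf P = S1 \<and> (\<forall>s\<in>S1. pmf P s = \<rho> s)"
        by (intro embed_finite_pmf S1(1) \<rho>0 \<rho>1)
      then obtain P where P: "set_pmf P = S1" "\<forall>s\<in>S1. pmf P s = \<rho> s" by (elim exE conjE) (rule that)
      have grid: "\<exists>s\<in>S1. \<bar>y - logit s\<bar> \<le> sqrt (ln \<alpha> / \<alpha>) \<and> \<bar>logit s\<bar> \<le> (ln \<alpha>)\<^sup>2 + 1" if "\<bar>y\<bar> \<le> (ln \<alpha>)\<^sup>2" for y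
      proof -
        have "\<bar>y\<bar> \<le> L\<^sup>2" using that by (simp add: L_def)
        from logit_grid[OF \<Delta>(1) this, folded m_def, folded G_def]
        obtain s where "s \<in> G" "\<bar>y - logit s\<bar> \<le> \<Delta>" "\<bar>logit s\<bar> \<le> L\<^sup>2 + \<Delta>" by (elim bexE conjE)
        moreover from this have "\<bar>logit s\<bar> \<le> L\<^sup>2 + 1" using \<Delta>(2) by linarith
        ultimately show ?thesis unfolding S1_def \<Delta>_def L_def by (intro bexI[of _ s]) auto
      qed
      have dev: "\<bar>(\<Sum>s\<in>S1. \<rho> s * wkernel \<alpha> s x) - wt x * beta_mix_density \<alpha> f x\<bar> \<le> \<alpha> powr (1 - E)"
        if x: "x \<in> {\<alpha> powr (-T)..1 - \<alpha> powr (-T)}" for x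
      proof -
        have x01: "0 < x" "x < 1" using x th by (simp_all only: atLeastAtMost_iff) linarith+
        let ?\<kappa> = "exp 4 * sqrt \<alpha>"
        have K: "0 \<le> wkernel \<alpha> s x" "wkernel \<alpha> s x \<le> ?\<kappa>" if "s \<in> S1" for s
          using that S1(2) x01 \<alpha> wkernel_pos[of s \<alpha> x] wkernel_le[of s x \<alpha>] by auto
        define A where "A = (\<Sum>s\<in>S. \<nu> s * wkernel \<alpha> s x)"
        define B where "B = (1 - sum \<nu> S) * wkernel \<alpha> h x"
        define D where "D = (\<Sum>s\<in>S1. wkernel \<alpha> s x) / real (card S1)"
        have A: "0 \<le> A" unfolding A_def using S(4) K by (intro sum_nonneg mult_nonneg_nonneg) (auto simp: S1_def)
        have B: "0 \<le> B" unfolding B_def using S(5) K[OF h] by simp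
        have AB: "A + B \<le> ?\<kappa>"
        proof -
          have "A \<le> (\<Sum>s\<in>S. \<nu> s * ?\<kappa>)" unfolding A_def
            using S(4) K by (intro sum_mono mult_left_mono) (auto simp: S1_def)
          moreover have "B \<le> (1 - sum \<nu> S) * ?\<kappa>" unfolding B_def using S(5) K[OF h] by (intro mult_left_mono) auto
          ultimately show ?thesis unfolding sum_distrib_right[symmetric] left_diff_distrib by linarith
        qed
        have B2: "B \<le> exp 4 * M * \<alpha> powr (-E)"
        proof -
          have "B \<le> (1 - sum \<nu> S) * ?\<kappa>" unfolding B_def using S(5) K[OF h] by (intro mult_left_mono) auto
          also have "\<dots> = ?\<kappa> * (1 - sum \<nu> S)" by simp
          finally show ?thesis using S(6) by linarith
        qed
        have D: "0 \<le> D" "D \<le> ?\<kappa>"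
        proof -
          show "0 \<le> D" unfolding D_def using K n0 by (intro divide_nonneg_nonneg sum_nonneg) auto
          have "(\<Sum>s\<in>S1. wkernel \<alpha> s x) \<le> (\<Sum>s\<in>S1. ?\<kappa>)" using K by (intro sum_mono) auto
          then show "D \<le> ?\<kappa>" unfolding D_def using n0 by (simp add: pos_divide_le_eq mult.commute)
        qed
        \<comment> \<open>\<open>A\<close> is the compressed core, \<open>B\<close> the completed
          mass at 1/2 and \<open>D\<close> the uniform average. The terms with \<eta> are bounded by
          the supremum of the kernel, and \<open>B\<close> by the recorded missing mass.\<close>
        have "(\<Sum>s\<in>S1. \<rho> s * wkernel \<alpha> s x) - A = B - \<eta> * (A + B) + \<eta> * D"
          unfolding \<rho>sum A_def B_def D_def by (simp add: algebra_simps)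
        moreover have "0 \<le> \<eta> * (A + B)" "\<eta> * (A + B) \<le> \<eta> * ?\<kappa>" "0 \<le> \<eta> * D" "\<eta> * D \<le> \<eta> * ?\<kappa>"
          using A B AB D \<eta> by (auto intro!: mult_left_mono)
        ultimately have "\<bar>(\<Sum>s\<in>S1. \<rho> s * wkernel \<alpha> s x) - A\<bar> \<le> exp 4 * M * \<alpha> powr (-E) + 2 * (\<eta> * ?\<kappa>)"
          using B B2 by linarith
        moreover have "\<bar>A - wt x * beta_mix_density \<alpha> f x\<bar> \<le> (3 + exp 4 * M) * \<alpha> powr (-E)"
          unfolding A_def using app[OF x] .
        ultimately have "\<bar>(\<Sum>s\<in>S1. \<rho> s * wkernel \<alpha> s x) - wt x * beta_mix_density \<alpha> f x\<bar>
          \<le> (3 + exp 4 * M) * \<alpha> powr (-E) + (exp 4 * M * \<alpha> powr (-E) + 2 * (\<eta> * ?\<kappa>))" by linarith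
        also have "\<dots> = (3 + 2 * (exp 4 * M)) * \<alpha> powr (-E) + 2 * exp 4 * sqrt \<alpha> * \<alpha> powr (-E)"
          by (simp add: \<eta>_def algebra_simps)
        finally show ?thesis using elim(3) by linarith
      qed
      have devP: "\<bar>(\<Sum>s\<in>set_pmf P. pmf P s * wkernel \<alpha> s x) - wt x * beta_mix_density \<alpha> f x\<bar> \<le> \<alpha> powr (1 - E)"
        if "x \<in> {\<alpha> powr (- (2 * E + 1))..1 - \<alpha> powr (- (2 * E + 1))}" for x
      proof -
        have "(\<Sum>s\<in>set_pmf P. pmf P s * wkernel \<alpha> s x) = (\<Sum>s\<in>S1. \<rho> s * wkernel \<alpha> s x)"
          unfolding P(1) by (intro sum.cong) (auto simp: P(2))
        then show ?thesis using dev that unfolding T_def by simp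
      qed
      have "good_pmf E \<alpha> P" unfolding good_pmf_def
      proof (intro conjI)
        show "finite (set_pmf P)" "set_pmf P \<subseteq> {0<..<1}" "1/2 \<in> set_pmf P"
          unfolding P(1) by (fact S1)+
        show "\<forall>s\<in>set_pmf P. \<alpha> powr (- (E + 2)) < pmf P s" using \<rho>low P by simp
        show "\<forall>y. \<bar>y\<bar> \<le> (ln \<alpha>)\<^sup>2 \<longrightarrow> (\<exists>s\<in>set_pmf P. \<bar>y - logit s\<bar> \<le> sqrt (ln \<alpha> / \<alpha>) \<and> \<bar>logit s\<bar> \<le> (ln \<alpha>)\<^sup>2 + 1)"
          unfolding P(1) using grid by blast
      qed (use devP in blast)
      then show ?case using cardS1 unfolding P(1)[symmetric] by blast
    qed
  qed
qed

end

section \<open>Elementary estimates for logarithms of ratios\<close>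

lemma expit_logit: "0 < s \<Longrightarrow> s < 1 \<Longrightarrow> expit (logit s) = s"
  by (simp add: expit_def logit_def exp_diff field_simps)

lemma wt_ge_exp_logit:
  assumes "0 < s" "s < 1"
  shows "exp (- \<bar>logit s\<bar>) / 4 \<le> wt s"
  using wt_expit[of "logit s"] expit_logit[OF assms] by simp

text \<open>A power of the logarithm is absorbed by an arbitrarily small power of u: apply ln t
  \<le> t - 1 to t = u^(-c/p), so that the p-th power produces u^(-c).\<close>

lemma log_powr_bound:
  fixes u p c :: real
  assumes u: "0 < u" "u \<le> 1" and p: "1 \<le> p" "0 < c" "c \<le> 1"
  shows "(1 - ln u) powr p \<le> (p / c) powr p * u powr (- c)"
proof -
  define t where "t = u powr (- (c / p))"
  have lnt: "ln t = - (c / p) * ln u" using u by (simp add: t_def ln_powr)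
  have pc: "1 \<le> p / c" using p by simp
  have "t > 0" using u by (simp add: t_def)
  have "1 - ln u = 1 + p / c * ln t" using p by (simp add: lnt)
  also have "\<dots> \<le> 1 + p / c * (t - 1)"
    using ln_le_minus_one[OF \<open>t > 0\<close>] pc by (intro add_left_mono mult_left_mono) auto
  also have "\<dots> \<le> p / c * t" using pc by (simp add: right_diff_distrib)
  finally have "(1 - ln u) powr p \<le> (p / c * t) powr p"
    using u p by (intro powr_mono2) (auto simp: ln_le_zero_iff intro: order.trans[of _ 0])
  also have "\<dots> = (p / c) powr p * u powr (- c)"
  proof -
    have "(p / c * t) powr p = (p / c) powr p * t powr p"
      by (rule powr_mult)
    also have "t powr p = u powr (- c)" using p by (simp add: t_def powr_powr)
    finally show ?thesis .
  qed
  finally show ?thesis .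
qed

text \<open>A quarter power of G pays for |ln G|^p. Since Z \<ge> 1, the sum -ln G + Z is at most
  the product (1 - ln G) Z, which keeps the contribution of Q as a separate factor.\<close>

lemma scaled_log_ratio_bound:
  fixes G Q Z p :: real
  assumes G: "0 < G" "G \<le> 1" and Q: "0 < Q" "\<bar>ln Q\<bar> \<le> Z" and Z: "1 \<le> Z" and p: "1 \<le> p"
  shows "G * \<bar>ln (G / Q)\<bar> powr p \<le> (4 * p) powr p * G powr (3/4) * Z powr p"
proof -
  have lnG: "0 \<le> - ln G" using G by simp
  have "ln (G / Q) = ln G - ln Q" using G Q by (intro ln_divide_pos) auto
  then have "\<bar>ln (G / Q)\<bar> \<le> - ln G + Z" using lnG Q(2) by linarith
  also have "\<dots> \<le> - ln G * Z + Z" using mult_left_mono[OF Z lnG] by simp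
  also have "\<dots> = (1 - ln G) * Z" by (simp add: algebra_simps)
  finally have "\<bar>ln (G / Q)\<bar> powr p \<le> ((1 - ln G) * Z) powr p" using p by (intro powr_mono2) auto
  also have "\<dots> = (1 - ln G) powr p * Z powr p" by (rule powr_mult)
  also have "\<dots> \<le> ((p / (1/4)) powr p * G powr (- (1/4))) * Z powr p"
    using G p by (intro mult_right_mono log_powr_bound) auto
  finally have "G * \<bar>ln (G / Q)\<bar> powr p \<le> G * (((p / (1/4)) powr p * G powr (- (1/4))) * Z powr p)"
    using G by (intro mult_left_mono) auto
  also have "\<dots> = (4 * p) powr p * (G powr 1 * G powr (- (1/4))) * Z powr p"
    using G by (simp add: mult_ac)
  also have "G powr 1 * G powr (- (1/4)) = G powr (3/4)" by (subst powr_add[symmetric]) simp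
  finally show ?thesis .
qed

text \<open>The condition d \<le> 1/2 keeps Q/G at least 1/2, so the logarithm is at most 2 d \<le>
  1, and raising it to a power p \<ge> 1 only decreases it.\<close>

lemma near_log_ratio_bound:
  fixes G Q d p :: real
  assumes G: "0 < G" and d: "\<bar>Q - G\<bar> \<le> d * G" "d \<le> 1/2" and p: "1 \<le> p"
  shows "\<bar>ln (G / Q)\<bar> powr p \<le> 2 * d"
proof -
  define u where "u = Q / G"
  have "0 \<le> d * G" using d(1) by linarith
  then have d0: "0 \<le> d" using G by (simp add: zero_le_mult_iff)
  have "u - 1 = (Q - G) / G" using G by (simp add: u_def diff_divide_distrib)
  then have "\<bar>u - 1\<bar> = \<bar>Q - G\<bar> / G" using G by (simp add: abs_divide)
  also have "\<dots> \<le> d" using d G by (simp add: pos_divide_le_eq)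
  finally have u: "\<bar>u - 1\<bar> \<le> d" .
  then have u0: "1/2 \<le> u" using d by linarith
  then have "ln u \<le> u - 1" by (intro ln_le_minus_one) auto
  moreover have "- ln u \<le> 2 * d"
  proof -
    have "ln (1 / u) \<le> 1 / u - 1" using u0 by (intro ln_le_minus_one) auto
    also have "\<dots> = (1 - u) / u" using u0 by (simp add: field_simps)
    also have "\<dots> \<le> d / (1/2)" using u u0 d0 by (intro frac_le) auto
    finally show ?thesis using u0 by (simp add: ln_div)
  qed
  moreover have "ln (G / Q) = - ln u"
  proof -
    have "G / Q = inverse u" by (simp add: u_def)
    then show ?thesis using u0 by (simp add: ln_inverse)
  qed
  ultimately have l: "\<bar>ln (G / Q)\<bar> \<le> 2 * d" using u by auto
  have "\<bar>ln (G / Q)\<bar> powr p \<le> \<bar>ln (G / Q)\<bar> powr 1"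
    using l d p by (intro powr_mono') auto
  then show ?thesis using l by simp
qed

lemma beta_mix_measure_eq:
  assumes "finite (set_pmf P)"
  shows "beta_mix_measure \<alpha> (measure_pmf P) x = (\<Sum>s\<in>set_pmf P. beta_kernel \<alpha> s x * pmf P s)"
  unfolding beta_mix_measure_def by (rule integral_measure_pmf_real[OF assms]) auto

lemma wt_beta_mix_measure:
  assumes "finite (set_pmf P)" "set_pmf P \<subseteq> {0<..<1}" "0 < x" "x < 1"
  shows "wt x * beta_mix_measure \<alpha> (measure_pmf P) x = (\<Sum>s\<in>set_pmf P. pmf P s * wkernel \<alpha> s x)"
  unfolding beta_mix_measure_eq[OF assms(1)] sum_distrib_left
  using assms wt_pos[of x] by (intro sum.cong) (auto simp: wkernel_eq subset_iff)

context mixing_density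
begin

text \<open>The sum is bounded below by a single atom. If \<open>wt x\<close> is not too small, a
  nearby grid atom s has exponent O(ln \<alpha>), and the dominant loss is (ln \<alpha>)^2/2 from
  sqrt (wt s) in \<open>knorm_lower\<close>; hence the cube. For arbitrary x the atom 1/2 is used.
  The upper bound is the supremum of the kernel.\<close>

lemma good_pmf_log_bounds:
  fixes E :: real
  shows "\<forall>\<^sub>F \<alpha> in at_top. \<forall>P x. good_pmf E \<alpha> P \<longrightarrow> 0 < x \<longrightarrow> x < 1 \<longrightarrow>
    (let Q = (\<Sum>s\<in>set_pmf P. pmf P s * wkernel \<alpha> s x) in 0 < Q \<and>
      (exp (- ((ln \<alpha>)\<^sup>2)) \<le> wt x \<longrightarrow> \<bar>ln Q\<bar> \<le> ln \<alpha> ^ 3) \<and> \<bar>ln Q\<bar> \<le> 2 * \<alpha> * (1 - ln (wt x)))"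
proof -
  \<comment> \<open>ln (e Beta(1/2, 1/2)) comes from \<open>knorm_lower\<close>; ln 2 comes from the
    factor 1/4 in the lower bound for \<open>wt s\<close>, under the square root.\<close>
  define c where "c = ln (2 * exp 1 * Beta (1/2) (1/2 :: real))"
  have beta: "0 < Beta (1/2) (1/2 :: real)" by (rule Beta_pos) auto
  have ev1: "\<forall>\<^sub>F \<alpha> in at_top. (E + 2) * ln \<alpha> + ((ln \<alpha>)\<^sup>2 + 1) / 2 + c + exp 1 / 2 * ln \<alpha> \<le> ln \<alpha> ^ 3"
    by real_asymp
  have ev2: "\<forall>\<^sub>F \<alpha> in at_top. 4 + ln \<alpha> / 2 \<le> ln (\<alpha> :: real) ^ 3" by real_asymp
  have ev3: "\<forall>\<^sub>F \<alpha> in at_top. (E + 2) * ln \<alpha> + c \<le> \<alpha>" by real_asymp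
  have ev4: "\<forall>\<^sub>F \<alpha> in at_top. 4 + ln \<alpha> / 2 \<le> (\<alpha> :: real)" by real_asymp
  have ev5: "\<forall>\<^sub>F \<alpha> in at_top. sqrt (ln \<alpha> / \<alpha> :: real) \<le> 1" by real_asymp
  show ?thesis
    using ev1 ev2 ev3 ev4 ev5 eventually_ge_at_top[of "1"]
  proof eventually_elim
    case (elim \<alpha>)
    define L where "L = ln \<alpha>"
    have L: "0 \<le> L" using elim(6) by (simp add: L_def)
    note \<alpha> = elim(6)
    have \<alpha>L: "\<alpha> powr u = exp (u * L)" for u using \<alpha> by (simp add: L_def powr_def)
    show ?case
    proof (intro allI impI)
      fix P :: "real pmf" and x :: real assume good: "good_pmf E \<alpha> P" and x: "0 < x" "x < 1"
      note P = good[unfolded good_pmf_def]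
      define Q where "Q = (\<Sum>s\<in>set_pmf P. pmf P s * wkernel \<alpha> s x)"
      have s01: "0 < s" "s < 1" if "s \<in> set_pmf P" for s using P that by (auto simp: subset_iff)
      have term_le: "pmf P s * wkernel \<alpha> s x \<le> Q" if "s \<in> set_pmf P" for s
        unfolding Q_def
        by (rule member_le_sum) (use P that s01 \<alpha> in \<open>auto intro!: mult_nonneg_nonneg less_imp_le[OF wkernel_pos]\<close>)
      have low: "- (E + 2) * L + ln (wkernel \<alpha> s x) \<le> ln Q" "0 < Q" if s: "s \<in> set_pmf P" for s
      proof -
        have K: "0 < wkernel \<alpha> s x" using s01[OF s] \<alpha> by (intro wkernel_pos) auto
        have "\<alpha> powr (- (E + 2)) * wkernel \<alpha> s x \<le> pmf P s * wkernel \<alpha> s x"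
          using P s K by (intro mult_right_mono) auto
        also have "\<dots> \<le> Q" by (rule term_le[OF s])
        finally have le: "exp (- (E + 2) * L) * wkernel \<alpha> s x \<le> Q" unfolding \<alpha>L .
        moreover have pos: "0 < exp (- (E + 2) * L) * wkernel \<alpha> s x" using K by simp
        ultimately show Q0: "0 < Q" by linarith
        have "ln (exp (- (E + 2) * L) * wkernel \<alpha> s x) \<le> ln Q"
          using le pos Q0 by (subst ln_le_cancel_iff) auto
        then show "- (E + 2) * L + ln (wkernel \<alpha> s x) \<le> ln Q" using K by (simp add: ln_mult)
      qed
      have half: "1/2 \<in> set_pmf P" using P by blast
      have Q0: "0 < Q" using low(2)[OF half] .
      have "Q \<le> (\<Sum>s\<in>set_pmf P. pmf P s * (exp 4 * sqrt \<alpha>))"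
        unfolding Q_def using s01 x \<alpha> by (intro sum_mono mult_left_mono wkernel_le) auto
      also have "\<dots> = exp 4 * sqrt \<alpha>"
        using P sum_pmf_eq_1[of "set_pmf P" P] by (simp add: sum_distrib_right[symmetric])
      finally have "ln Q \<le> ln (exp 4 * sqrt \<alpha>)" using Q0 \<alpha> by (subst ln_le_cancel_iff) auto
      also have "\<dots> = 4 + L / 2" using \<alpha> by (simp add: ln_mult ln_sqrt L_def)
      finally have up: "ln Q \<le> 4 + L / 2" .
      have lnK: "ln (wt s) / 2 - ln (exp 1 * Beta (1/2) (1/2)) - \<alpha> * kdiv s x \<le> ln (wkernel \<alpha> s x)" if s: "s \<in> set_pmf P" for s
      proof -
        have w: "0 < wt s" using s01[OF s] by (simp add: wt_pos)
        have "wt s powr (1/2) / (exp 1 * Beta (1/2) (1/2)) * exp (- \<alpha> * kdiv s x) \<le> wkernel \<alpha> s x"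
          unfolding wkernel_def using s01[OF s] \<alpha> by (intro mult_right_mono knorm_lower) auto
        then have "ln (wt s powr (1/2) / (exp 1 * Beta (1/2) (1/2)) * exp (- \<alpha> * kdiv s x)) \<le> ln (wkernel \<alpha> s x)"
          using w beta wkernel_pos[OF s01[OF s], of \<alpha> x] \<alpha> by (subst ln_le_cancel_iff) auto
        moreover have "ln (wt s powr (1/2) / (exp 1 * Beta (1/2) (1/2)) * exp (- \<alpha> * kdiv s x))
          = ln (wt s powr (1/2)) - ln (exp 1 * Beta (1/2) (1/2)) + ln (exp (- \<alpha> * kdiv s x))"
          using w beta by (subst ln_mult_pos, simp, simp) (subst ln_divide_pos, auto)
        ultimately show ?thesis using w by (simp add: ln_powr)
      qed
      have c: "c = ln 2 + ln (exp 1 * Beta (1/2) (1/2))"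
        using beta unfolding c_def mult.assoc by (subst ln_mult_pos) auto
      have ln4: "ln (1/4 :: real) = - (2 * ln 2)"
      proof -
        have "ln (4::real) = ln (2 * 2)" by simp
        also have "\<dots> = 2 * ln 2" by (subst ln_mult_pos) auto
        finally show ?thesis by (simp add: ln_div)
      qed
      have A: "\<bar>ln Q\<bar> \<le> ln \<alpha> ^ 3" if w: "exp (- ((ln \<alpha>)\<^sup>2)) \<le> wt x"
      proof -
        have "- L\<^sup>2 \<le> ln (wt x)" using w wt_pos[OF x] ln_ge_iff unfolding L_def by blast
        then have "\<bar>logit x\<bar> \<le> L\<^sup>2" using abs_logit_le[OF x] by linarith
        then obtain s where s: "s \<in> set_pmf P" "\<bar>logit x - logit s\<bar> \<le> sqrt (L / \<alpha>)" "\<bar>logit s\<bar> \<le> L\<^sup>2 + 1"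
          using P unfolding L_def by blast
        have "kdiv s x \<le> exp 1 * (sqrt (L / \<alpha>))\<^sup>2 / 2"
          using s elim(5) x s01[OF s(1)] by (intro kdiv_le) (auto simp: L_def)
        then have "\<alpha> * kdiv s x \<le> \<alpha> * (exp 1 * (sqrt (L / \<alpha>))\<^sup>2 / 2)" using \<alpha> by (intro mult_left_mono) auto
        also have "\<dots> = exp 1 / 2 * L" using \<alpha> L by simp
        finally have k: "\<alpha> * kdiv s x \<le> exp 1 / 2 * L" .
        have "exp (- (L\<^sup>2 + 1)) / 4 \<le> exp (- \<bar>logit s\<bar>) / 4" using s(3) by simp
        also have "\<dots> \<le> wt s" by (rule wt_ge_exp_logit[OF s01[OF s(1)]])
        finally have "ln (exp (- (L\<^sup>2 + 1)) * (1/4)) \<le> ln (wt s)"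
          using wt_pos[OF s01[OF s(1)]] by (subst ln_le_cancel_iff) auto
        moreover have "ln (exp (- (L\<^sup>2 + 1)) * (1/4)) = - (L\<^sup>2 + 1) - 2 * ln 2"
          by (subst ln_mult_pos, simp, simp) (simp add: ln4)
        ultimately have "- (L\<^sup>2 + 1) - 2 * ln 2 \<le> ln (wt s)" by simp
        with lnK[OF s(1)] low(1)[OF s(1)] k c
        have "- ((E + 2) * L + (L\<^sup>2 + 1) / 2 + c + exp 1 / 2 * L) \<le> ln Q" by argo
        with elim(1,2) up show ?thesis unfolding L_def by linarith
      qed
      have B: "\<bar>ln Q\<bar> \<le> 2 * \<alpha> * (1 - ln (wt x))"
      proof -
        have lw: "ln (wt x) \<le> 0" using wt_pos[OF x] wt_le(1)[OF x] x by simp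
        have "kdiv (1/2) x = - 4 * ln 2 - 2 * ln (wt x)"
          using x by (simp add: kdiv_def wt_def ln_mult ln_div)
        also have "\<dots> \<le> - 2 * ln (wt x)" by simp
        finally have "\<alpha> * kdiv (1/2) x \<le> \<alpha> * (- 2 * ln (wt x))" using \<alpha> by (intro mult_left_mono) auto
        moreover have "ln (wt (1/2)) = - (2 * ln 2)" unfolding ln4[symmetric] by (simp add: wt_def)
        ultimately have "- ((E + 2) * L + c) + 2 * \<alpha> * ln (wt x) \<le> ln Q"
          using lnK[OF half] low(1)[OF half] c by argo
        moreover have "2 * \<alpha> * ln (wt x) \<le> 0" using lw \<alpha> by (simp add: mult_nonneg_nonpos)
        ultimately show ?thesis using elim(3,4) up \<alpha> unfolding L_def right_diff_distrib by linarith
      qed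
      show "let Q = (\<Sum>s\<in>set_pmf P. pmf P s * wkernel \<alpha> s x) in 0 < Q \<and>
        (exp (- ((ln \<alpha>)\<^sup>2)) \<le> wt x \<longrightarrow> \<bar>ln Q\<bar> \<le> ln \<alpha> ^ 3) \<and> \<bar>ln Q\<bar> \<le> 2 * \<alpha> * (1 - ln (wt x))"
        unfolding Let_def Q_def[symmetric] using Q0 A B by blast
    qed
  qed
qed

end

section \<open>The integral bound\<close>

context mixing_density
begin

text \<open>With G = w g, three regimes occur: G above \<alpha>^(-B), G below it at moderate w, and
  w below exp(-(ln \<alpha>)^2). In each a factor w^(1/4) is kept, so dividing by w leaves the
  integrable singularity w^(-3/4).\<close>

lemma pointwise_bound:
  fixes H p :: real
  assumes H: "0 < H" and p: "1 \<le> p"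
  defines "E \<equiv> 5 * H + 6"
  shows "\<exists>C. \<forall>\<^sub>F \<alpha> in at_top. \<forall>P x. good_pmf E \<alpha> P \<longrightarrow> 0 < x \<longrightarrow> x < 1 \<longrightarrow>
    beta_mix_density \<alpha> f x *
      \<bar>ln (beta_mix_density \<alpha> f x / beta_mix_measure \<alpha> (measure_pmf P) x)\<bar> powr p
      \<le> C * \<alpha> powr (- H) * wt x powr (- (3/4))"
proof -
  \<comment> \<open>Below the threshold G^(1/4) \<le> \<alpha>^(-H - 1); the spare power of \<alpha>
    covers \<alpha>^(1/4) from the other half of G^(3/4) and \<alpha>^(3/4) for the logarithm. Above
    it, E = B + H + 2 turns the additive error \<alpha>^(1 - E) into the relative error
    \<alpha>^(-(H + 1)).\<close>
  define B where "B = 4 * H + 4"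
  define C1 where "C1 = exp 5 * M + 1"
  have C1: "1 \<le> C1" using M_nonneg by (simp add: C1_def)
  define K where "K = (4 * p) powr p"
  define K3 where "K3 = K * C1 powr (3/4) * (2 powr p * (16 * p) powr p)"
  define C where "C = 2 * C1 + K * C1 powr (1/2) + K3"
  have KK: "0 \<le> K" "0 \<le> K3" by (simp_all add: K_def K3_def)
  have ev1: "\<forall>\<^sub>F \<alpha> in at_top. C1 * \<alpha> powr (- E) < \<alpha> powr (- B)"
    using H unfolding E_def B_def using C1 by real_asymp
  have ev2: "\<forall>\<^sub>F \<alpha> in at_top. \<alpha> powr (- (H + 1)) \<le> (1/2 :: real)" using H by real_asymp
  have ev3: "\<forall>\<^sub>F \<alpha> in at_top. (ln \<alpha> ^ 3) powr p * \<alpha> powr (1/4 - B/4) \<le> \<alpha> powr (- H)"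
  proof -
    have "\<forall>\<^sub>F \<alpha> in at_top. (ln \<alpha> ^ 3) powr p \<le> (\<alpha> :: real) powr (3/4)" using p by real_asymp
    then show ?thesis
    proof eventually_elim
      case (elim \<alpha>)
      then have "(ln \<alpha> ^ 3) powr p * \<alpha> powr (1/4 - B/4) \<le> \<alpha> powr (3/4) * \<alpha> powr (1/4 - B/4)"
        by (intro mult_right_mono) auto
      also have "\<dots> = \<alpha> powr (- H)" by (subst powr_add[symmetric]) (simp add: B_def add_divide_distrib)
      finally show ?case .
    qed
  qed
  have ev4: "\<forall>\<^sub>F \<alpha> in at_top. C1 * sqrt \<alpha> * exp (- (1/2) * (ln \<alpha>)\<^sup>2) \<le> 1" using C1 by real_asymp
  have ev5: "\<forall>\<^sub>F \<alpha> in at_top. \<alpha> powr (p + 3/8) * exp (- (1/16) * (ln \<alpha>)\<^sup>2) \<le> \<alpha> powr (- H)"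
    using H p by real_asymp
  have ev6: "\<forall>\<^sub>F \<alpha> in at_top. 1 \<le> ln (\<alpha> :: real) ^ 3" by real_asymp
  show ?thesis
  proof (rule exI[of _ C])
    show "\<forall>\<^sub>F \<alpha> in at_top. \<forall>P x. good_pmf E \<alpha> P \<longrightarrow> 0 < x \<longrightarrow> x < 1 \<longrightarrow>
      beta_mix_density \<alpha> f x *
      \<bar>ln (beta_mix_density \<alpha> f x / beta_mix_measure \<alpha> (measure_pmf P) x)\<bar> powr p
      \<le> C * \<alpha> powr (- H) * wt x powr (- (3/4))"
      using ev1 ev2 ev3 ev4 ev5 ev6 good_pmf_log_bounds[of E] eventually_ge_at_top[of 1]
    proof eventually_elim
      case (elim \<alpha>)
      note \<alpha> = elim(8)
      show ?case
      proof (intro allI impI)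
        fix P :: "real pmf" and x :: real
        assume good: "good_pmf E \<alpha> P" and x: "0 < x" "x < 1"
        define w where "w = wt x"
        have w: "0 < w" "w \<le> 1" using wt_pos[OF x] wt_le(1)[OF x] x by (auto simp: w_def)
        define g where "g = beta_mix_density \<alpha> f x"
        define G where "G = w * g"
        define Q where "Q = (\<Sum>s\<in>set_pmf P. pmf P s * wkernel \<alpha> s x)"
        have Q: "w * beta_mix_measure \<alpha> (measure_pmf P) x = Q"
          unfolding Q_def w_def using good x by (intro wt_beta_mix_measure) (auto simp: good_pmf_def)
        have ratio: "g / beta_mix_measure \<alpha> (measure_pmf P) x = G / Q"
          using w unfolding Q[symmetric] G_def by simp
        have Q0: "0 < Q" and lnQ: "exp (- ((ln \<alpha>)\<^sup>2)) \<le> w \<Longrightarrow> \<bar>ln Q\<bar> \<le> ln \<alpha> ^ 3"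
          "\<bar>ln Q\<bar> \<le> 2 * \<alpha> * (1 - ln w)"
          using elim(7)[rule_format, OF good x] unfolding Let_def Q_def[symmetric] w_def[symmetric] by auto
        have G0: "0 \<le> G" using mix_nonneg[OF \<alpha> x] by (simp add: G_def g_def w_def)
        have "G \<le> exp 5 * M * (sqrt \<alpha> * w powr (1/2))" using mix_le[OF \<alpha> x] by (simp add: G_def g_def w_def)
        also have "\<dots> \<le> C1 * (sqrt \<alpha> * w powr (1/2))"
          unfolding C1_def using \<alpha> by (intro mult_right_mono) auto
        finally have Gle: "G \<le> C1 * sqrt \<alpha> * w powr (1/2)" by simp
        have Gpow: "G powr t \<le> C1 powr t * \<alpha> powr (t/2) * w powr (t/2)" if "0 \<le> t" for t
        proof -
          have "G powr t \<le> (C1 * sqrt \<alpha> * w powr (1/2)) powr t" using Gle G0 that by (intro powr_mono2) auto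
          also have "\<dots> = C1 powr t * (\<alpha> powr (1/2)) powr t * (w powr (1/2)) powr t"
            using \<alpha> by (simp add: powr_mult powr_half_sqrt)
          finally show ?thesis by (simp add: powr_powr)
        qed
        have main: "G * \<bar>ln (G / Q)\<bar> powr p \<le> C * \<alpha> powr (- H) * w powr (1/4)"
        proof (cases "G = 0")
          case True
          then show ?thesis using KK C1 by (simp add: C_def)
        next
          case False
          with G0 have Gp: "0 < G" by simp
          consider (big) "\<alpha> powr (- B) \<le> G" | (mid) "G < \<alpha> powr (- B)" "exp (- ((ln \<alpha>)\<^sup>2)) \<le> w"
            | (far) "w < exp (- ((ln \<alpha>)\<^sup>2))" by linarith
          then show ?thesis
          proof cases
            case big
            define \<theta> where "\<theta> = \<alpha> powr (- (2 * E + 1))"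
            \<comment> \<open>Closer to an endpoint the square-root decay would force G \<le> C1 *
              \<alpha>^(-E) < \<alpha>^(-B). Large G thus places x where the approximation
              holds.\<close>
            have "\<theta> \<le> w"
            proof (rule ccontr)
              assume "\<not> \<theta> \<le> w"
              then have "w powr (1/2) \<le> \<theta> powr (1/2)" using w by (intro powr_mono2) auto
              also have "\<dots> = \<alpha> powr (- E - 1/2)" by (simp add: \<theta>_def powr_powr diff_divide_distrib)
              finally have "C1 * sqrt \<alpha> * w powr (1/2) \<le> C1 * sqrt \<alpha> * \<alpha> powr (- E - 1/2)"
                using C1 \<alpha> by (intro mult_left_mono) auto
              also have "\<dots> = C1 * (\<alpha> powr (1/2) * \<alpha> powr (- E - 1/2))" using \<alpha> by (simp add: powr_half_sqrt)
              also have "\<dots> = C1 * \<alpha> powr (- E)" by (subst powr_add[symmetric]) simp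
              finally show False using Gle big elim(1) by linarith
            qed
            then have "x \<in> {\<theta>..1 - \<theta>}" using wt_le[OF x] by (auto simp: w_def)
            then have "\<bar>Q - G\<bar> \<le> \<alpha> powr (1 - E)"
              using good unfolding good_pmf_def \<theta>_def Q_def G_def g_def w_def by blast
            also have "1 - E = - (H + 1) + - B" by (simp add: E_def B_def)
            also have "\<alpha> powr (- (H + 1) + - B) = \<alpha> powr (- (H + 1)) * \<alpha> powr (- B)" by (rule powr_add)
            also have "\<dots> \<le> \<alpha> powr (- (H + 1)) * G" using big by (intro mult_left_mono) auto
            finally have "\<bar>ln (G / Q)\<bar> powr p \<le> 2 * \<alpha> powr (- (H + 1))"
              by (rule near_log_ratio_bound[OF Gp _ elim(2) p])
            then have "G * \<bar>ln (G / Q)\<bar> powr p \<le> (C1 * sqrt \<alpha> * w powr (1/2)) * (2 * \<alpha> powr (- (H + 1)))"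
              using Gle Gp by (intro mult_mono) auto
            also have "\<dots> = 2 * C1 * (\<alpha> powr (1/2) * \<alpha> powr (- (H + 1))) * w powr (1/2)"
              using \<alpha> by (simp add: powr_half_sqrt)
            also have "\<alpha> powr (1/2) * \<alpha> powr (- (H + 1)) = \<alpha> powr (- H - 1/2)"
              unfolding powr_add[symmetric] by (rule arg_cong[where f = "\<lambda>t. \<alpha> powr t"]) simp
            also have "2 * C1 * \<alpha> powr (- H - 1/2) * w powr (1/2) \<le> C * \<alpha> powr (- H) * w powr (1/4)"
              using \<alpha> w C1 KK by (intro mult_mono powr_mono powr_mono') (auto simp: C_def)
            finally show ?thesis .
          next
            case mid
            have "\<alpha> powr (- B) \<le> \<alpha> powr 0" using \<alpha> H by (intro powr_mono) (auto simp: B_def)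
            then have G1: "G \<le> 1" using mid \<alpha> by simp
            \<comment> \<open>The quarter power uses the threshold to gain smallness in \<alpha>;
              the half power uses the endpoint decay to gain w^(1/4).\<close>
            have "G powr (3/4) = G powr (1/4) * G powr (1/2)" by (subst powr_add[symmetric]) simp
            also have "\<dots> \<le> \<alpha> powr (- B / 4) * (C1 powr (1/2) * \<alpha> powr (1/4) * w powr (1/4))"
            proof (intro mult_mono)
              have "G powr (1/4) \<le> (\<alpha> powr (- B)) powr (1/4)" using mid G0 by (intro powr_mono2) auto
              then show "G powr (1/4) \<le> \<alpha> powr (- B / 4)" by (simp add: powr_powr)
              show "G powr (1/2) \<le> C1 powr (1/2) * \<alpha> powr (1/4) * w powr (1/4)" using Gpow[of "1/2"] by simp
            qed auto
            also have "\<dots> = C1 powr (1/2) * (\<alpha> powr (1/4) * \<alpha> powr (- B / 4)) * w powr (1/4)" by simp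
            also have "\<alpha> powr (1/4) * \<alpha> powr (- B / 4) = \<alpha> powr (1/4 - B/4)" by (subst powr_add[symmetric]) simp
            finally have G34: "G powr (3/4) \<le> C1 powr (1/2) * \<alpha> powr (1/4 - B/4) * w powr (1/4)" .
            have "G * \<bar>ln (G / Q)\<bar> powr p \<le> K * G powr (3/4) * (ln \<alpha> ^ 3) powr p"
              unfolding K_def by (intro scaled_log_ratio_bound Gp G1 Q0 lnQ(1) mid elim(6) p)
            also have "\<dots> \<le> K * (C1 powr (1/2) * \<alpha> powr (1/4 - B/4) * w powr (1/4)) * (ln \<alpha> ^ 3) powr p"
              using G34 KK by (intro mult_right_mono mult_left_mono) auto
            also have "\<dots> = (K * C1 powr (1/2)) * ((ln \<alpha> ^ 3) powr p * \<alpha> powr (1/4 - B/4)) * w powr (1/4)"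
              by (simp add: mult_ac)
            also have "\<dots> \<le> C * \<alpha> powr (- H) * w powr (1/4)"
              using elim(3) KK C1 by (intro mult_mono) (auto simp: C_def)
            finally show ?thesis .
          next
            case far
            have wp: "w powr t \<le> exp (- t * (ln \<alpha>)\<^sup>2)" if "0 \<le> t" for t
            proof -
              have "w powr t \<le> exp (- ((ln \<alpha>)\<^sup>2)) powr t" using far w that by (intro powr_mono2) auto
              then show ?thesis by (simp add: powr_def)
            qed
            have "G \<le> C1 * sqrt \<alpha> * w powr (1/2)" by (rule Gle)
            also have "\<dots> \<le> C1 * sqrt \<alpha> * exp (- (1/2) * (ln \<alpha>)\<^sup>2)"
              using wp[of "1/2"] C1 \<alpha> by (intro mult_left_mono) auto
            finally have G1: "G \<le> 1" using elim(4) by linarith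
            have lw: "ln w \<le> 0" using w by simp
            have Z1: "1 \<le> 2 * \<alpha> * (1 - ln w)"
              using mult_mono[of 1 "2 * \<alpha>" 1 "1 - ln w"] \<alpha> lw by simp
            have "G * \<bar>ln (G / Q)\<bar> powr p \<le> K * G powr (3/4) * (2 * \<alpha> * (1 - ln w)) powr p"
              unfolding K_def by (intro scaled_log_ratio_bound Gp G1 Q0 lnQ(2) Z1 p)
            also have "(2 * \<alpha> * (1 - ln w)) powr p = 2 powr p * \<alpha> powr p * (1 - ln w) powr p"
              by (simp only: powr_mult)
            also have "K * G powr (3/4) * (2 powr p * \<alpha> powr p * (1 - ln w) powr p) \<le>
              K * (C1 powr (3/4) * \<alpha> powr (3/8) * w powr (3/8)) * (2 powr p * \<alpha> powr p * ((p / (1/16)) powr p * w powr (- (1/16))))"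
              using Gpow[of "3/4"] KK p w
              by (intro mult_mono mult_left_mono log_powr_bound) auto
            also have "\<dots> = K3 * (\<alpha> powr p * \<alpha> powr (3/8)) * (w powr (3/8) * w powr (- (1/16)))"
              by (simp add: K3_def mult_ac)
            also have "\<alpha> powr p * \<alpha> powr (3/8) = \<alpha> powr (p + 3/8)" by (simp only: powr_add)
            \<comment> \<open>Of the remaining exponent 3/8 - 1/16 = 5/16, the part 1/4 is kept for
              integrability; the part 1/16 gives exp(-(ln \<alpha>)^2/16), which beats \<alpha>^(p +
              3/8) for every p.\<close>
            also have "w powr (3/8) * w powr (- (1/16)) = w powr (1/16) * w powr (1/4)"
              unfolding powr_add[symmetric] by simp
            also have "K3 * \<alpha> powr (p + 3/8) * (w powr (1/16) * w powr (1/4)) \<le>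
              K3 * \<alpha> powr (p + 3/8) * (exp (- (1/16) * (ln \<alpha>)\<^sup>2) * w powr (1/4))"
              using wp[of "1/16"] KK by (intro mult_left_mono mult_right_mono) auto
            also have "\<dots> = K3 * (\<alpha> powr (p + 3/8) * exp (- (1/16) * (ln \<alpha>)\<^sup>2)) * w powr (1/4)" by simp
            also have "\<dots> \<le> C * \<alpha> powr (- H) * w powr (1/4)"
              using elim(5) KK C1 by (intro mult_mono) (auto simp: C_def)
            finally show ?thesis .
          qed
        qed
        have "g * \<bar>ln (G / Q)\<bar> powr p = G * \<bar>ln (G / Q)\<bar> powr p / w" using w by (simp add: G_def)
        also have "\<dots> \<le> C * \<alpha> powr (- H) * w powr (1/4) / w" using main w by (intro divide_right_mono) auto
        also have "\<dots> = C * \<alpha> powr (- H) * (w powr (1/4) / w powr 1)" using w by simp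
        also have "w powr (1/4) / w powr 1 = w powr (- (3/4))" by (subst powr_diff[symmetric]) simp
        finally show "beta_mix_density \<alpha> f x *
          \<bar>ln (beta_mix_density \<alpha> f x / beta_mix_measure \<alpha> (measure_pmf P) x)\<bar> powr p
          \<le> C * \<alpha> powr (- H) * wt x powr (- (3/4))"
          unfolding g_def[symmetric] w_def[symmetric] ratio .
      qed
    qed
  qed
qed

lemma beta_mix_density_endpoints: "beta_mix_density \<alpha> f 0 = 0" "beta_mix_density \<alpha> f 1 = 0"
  by (simp_all add: beta_mix_density_def set_lebesgue_integral_def)

text \<open>Integrability is asserted along with the inequality because a non-integrable function
  has integral 0 by convention, and the inequality alone could then hold vacuously.\<close>

lemma integral_bound:
  fixes H p :: real
  assumes H: "0 < H" and p: "1 \<le> p"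
  shows "\<exists>C. \<forall>\<^sub>F \<alpha> in at_top. \<forall>P. good_pmf (5 * H + 6) \<alpha> P \<longrightarrow>
    set_integrable lborel {0..1} (\<lambda>x. beta_mix_density \<alpha> f x *
      \<bar>ln (beta_mix_density \<alpha> f x / beta_mix_measure \<alpha> (measure_pmf P) x)\<bar> powr p) \<and>
    (LINT x:{0..1}|lborel. beta_mix_density \<alpha> f x *
      \<bar>ln (beta_mix_density \<alpha> f x / beta_mix_measure \<alpha> (measure_pmf P) x)\<bar> powr p) \<le> C * \<alpha> powr (- H)"
proof -
  obtain C where ev: "\<forall>\<^sub>F \<alpha> in at_top. \<forall>P x. good_pmf (5 * H + 6) \<alpha> P \<longrightarrow> 0 < x \<longrightarrow> x < 1 \<longrightarrow>
    beta_mix_density \<alpha> f x *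
      \<bar>ln (beta_mix_density \<alpha> f x / beta_mix_measure \<alpha> (measure_pmf P) x)\<bar> powr p
      \<le> C * \<alpha> powr (- H) * wt x powr (- (3/4))"
    using pointwise_bound[OF H p] by blast
  define I where "I = (LINT x:{0..1}|lborel. wt x powr (- (3/4)))"
  have wt_int: "set_integrable lborel {0..1} (\<lambda>x. wt x powr (- (3/4)))" by (rule set_integrable_wt_powr) simp
  show ?thesis
  proof (rule exI[of _ "C * I"])
    show "\<forall>\<^sub>F \<alpha> in at_top. \<forall>P. good_pmf (5 * H + 6) \<alpha> P \<longrightarrow>
      set_integrable lborel {0..1} (\<lambda>x. beta_mix_density \<alpha> f x *
        \<bar>ln (beta_mix_density \<alpha> f x / beta_mix_measure \<alpha> (measure_pmf P) x)\<bar> powr p) \<and>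
      (LINT x:{0..1}|lborel. beta_mix_density \<alpha> f x *
        \<bar>ln (beta_mix_density \<alpha> f x / beta_mix_measure \<alpha> (measure_pmf P) x)\<bar> powr p) \<le> C * I * \<alpha> powr (- H)"
      using ev eventually_ge_at_top[of 1]
    proof eventually_elim
      case (elim \<alpha>)
      show ?case
      proof (intro allI impI)
        fix P :: "real pmf" assume good: "good_pmf (5 * H + 6) \<alpha> P"
        then have fin: "finite (set_pmf P)" by (simp add: good_pmf_def)
        let ?h = "\<lambda>x. beta_mix_density \<alpha> f x *
          \<bar>ln (beta_mix_density \<alpha> f x / beta_mix_measure \<alpha> (measure_pmf P) x)\<bar> powr p"
        let ?b = "\<lambda>x. C * \<alpha> powr (- H) * wt x powr (- (3/4))"
        have nn: "0 \<le> ?h x" and le: "?h x \<le> ?b x" if x01: "x \<in> {0..1}" for x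
        proof -
          consider "x = 0" | "x = 1" | "0 < x \<and> x < 1" using x01 by fastforce
          then have "0 \<le> ?h x \<and> ?h x \<le> ?b x"
          proof cases
            case 3
            then have 3: "0 < x" "x < 1" by auto
            have "0 \<le> beta_mix_density \<alpha> f x"
              using mix_nonneg[OF elim(2) 3] wt_pos[OF 3] by (simp add: zero_le_mult_iff)
            moreover have "?h x \<le> ?b x" using elim(1) good 3 by blast
            ultimately show ?thesis by simp
          qed (auto simp: beta_mix_density_endpoints wt_def)
          then show "0 \<le> ?h x" "?h x \<le> ?b x" by blast+
        qed
        have [measurable]: "(\<lambda>x. beta_mix_measure \<alpha> (measure_pmf P) x) \<in> borel_measurable borel"
          unfolding beta_mix_measure_eq[OF fin] by measurable
        have b_int: "set_integrable lborel {0..1} ?b"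
          using wt_int by (intro set_integrable_mult_right) auto
        have h_int: "set_integrable lborel {0..1} ?h"
          unfolding set_integrable_def
        proof (rule Bochner_Integration.integrable_bound)
          show "integrable lborel (\<lambda>x. indicat_real {0..1} x *\<^sub>R ?b x)"
            using b_int by (simp only: set_integrable_def)
          show "AE x in lborel. norm (indicat_real {0..1} x *\<^sub>R ?h x) \<le> norm (indicat_real {0..1} x *\<^sub>R ?b x)"
          proof (rule AE_I2)
            fix x
            show "norm (indicat_real {0..1} x *\<^sub>R ?h x) \<le> norm (indicat_real {0..1} x *\<^sub>R ?b x)"
            proof (cases "x \<in> {0..1}")
              case True
              then have "norm (indicat_real {0..1} x *\<^sub>R ?h x) = \<bar>?h x\<bar>" by (simp only: indicator_simps scaleR_one real_norm_def)
              also have "\<dots> \<le> \<bar>?b x\<bar>" using nn[OF True] le[OF True] by linarith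
              also have "\<dots> = norm (indicat_real {0..1} x *\<^sub>R ?b x)"
                using True by (simp only: indicator_simps scaleR_one real_norm_def)
              finally show ?thesis .
            next
              case False
              then have "indicat_real {0..1} x = 0" by (rule indicator_simps(2))
              then show ?thesis by (simp only: scaleR_zero_left norm_zero order.refl)
            qed
          qed
        qed measurable
        have "(LINT x:{0..1}|lborel. ?h x) \<le> (LINT x:{0..1}|lborel. ?b x)"
          using le by (intro set_integral_mono h_int b_int)
        also have "\<dots> = C * I * \<alpha> powr (- H)" by (simp add: I_def)
        finally show "set_integrable lborel {0..1} ?h \<and> (LINT x:{0..1}|lborel. ?h x) \<le> C * I * \<alpha> powr (- H)"
          using h_int by blast
      qed
    qed
  qed
qed

end

theorem theorem3p2:
  fixes f :: "real \<Rightarrow> real" and k0 k1 :: nat and c0 c1 H :: real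
  assumes "prob_density_01 f"
    and "\<And>x. 0 < x \<Longrightarrow> x < 1 \<Longrightarrow> 0 < f x"
    and "c0 > 0" and "c1 > 0"
    and "f \<sim>[at_right 0] (\<lambda>x. c0 * x ^ k0)"
    and "f \<sim>[at_left 1] (\<lambda>x. c1 * (1 - x) ^ k1)"
    and "H > 0"
  shows "\<exists>N0 A :: real. N0 > 0 \<and> A > 0 \<and>
    (\<exists>P :: real \<Rightarrow> real pmf.
      (\<forall>\<^sub>F \<alpha> in at_top.
         finite (set_pmf (P \<alpha>)) \<and> set_pmf (P \<alpha>) \<subseteq> {0<..<1} \<and>
         real (card (set_pmf (P \<alpha>))) \<le> N0 * sqrt \<alpha> * ln \<alpha> powr (3/2) \<and>
         (\<forall>\<epsilon>\<in>set_pmf (P \<alpha>). pmf (P \<alpha>) \<epsilon> > \<alpha> powr (-A))) \<and>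
      (\<forall>p::real. p \<ge> 1 \<longrightarrow> (\<exists>C::real. \<forall>\<^sub>F \<alpha> in at_top.
         set_integrable lborel {0..1} (\<lambda>x. beta_mix_density \<alpha> f x *
           \<bar>ln (beta_mix_density \<alpha> f x / beta_mix_measure \<alpha> (measure_pmf (P \<alpha>)) x)\<bar> powr p) \<and>
         (LINT x:{0..1}|lborel. beta_mix_density \<alpha> f x *
           \<bar>ln (beta_mix_density \<alpha> f x / beta_mix_measure \<alpha> (measure_pmf (P \<alpha>)) x)\<bar> powr p)
           \<le> C * \<alpha> powr (-H))))"
proof -
  interpret mixing_density f using assms by (intro mixing_density_intro)
  define E where "E = 5 * H + 6"
  have E: "0 < E" using assms by (simp add: E_def)
  obtain C where C: "C > 0" and ev: "\<forall>\<^sub>F \<alpha> in at_top. \<exists>P. good_pmf E \<alpha> P \<and>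
      real (card (set_pmf P)) \<le> C * sqrt \<alpha> * ln \<alpha> powr (3/2)"
    using sparse_mixture[OF E] by (elim exE conjE) (rule that)
  \<comment> \<open>The selection is made once for each \<alpha>, before p is introduced;
    \<open>good_pmf\<close> involves only H, through E.\<close>
  define P where "P \<alpha> = (SOME P. good_pmf E \<alpha> P \<and>
      real (card (set_pmf P)) \<le> C * sqrt \<alpha> * ln \<alpha> powr (3/2))" for \<alpha>
  have P: "\<forall>\<^sub>F \<alpha> in at_top. good_pmf E \<alpha> (P \<alpha>) \<and>
      real (card (set_pmf (P \<alpha>))) \<le> C * sqrt \<alpha> * ln \<alpha> powr (3/2)"
    using ev unfolding P_def by (rule eventually_mono) (rule someI_ex)
  show ?thesis
  \<comment> \<open>A = E + 2 is the exponent of the weight bound in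
    \<open>good_pmf\<close>.\<close>
  proof (rule exI[of _ C], rule exI[of _ "E + 2"], intro conjI exI[of _ P] allI impI)
    show "\<forall>\<^sub>F \<alpha> in at_top.
         finite (set_pmf (P \<alpha>)) \<and> set_pmf (P \<alpha>) \<subseteq> {0<..<1} \<and>
         real (card (set_pmf (P \<alpha>))) \<le> C * sqrt \<alpha> * ln \<alpha> powr (3/2) \<and>
         (\<forall>\<epsilon>\<in>set_pmf (P \<alpha>). pmf (P \<alpha>) \<epsilon> > \<alpha> powr (-(E + 2)))"
      using P by (rule eventually_mono) (simp add: good_pmf_def)
    fix p :: real assume "p \<ge> 1"
    from integral_bound[OF assms(7) this] obtain C' where
      "\<forall>\<^sub>F \<alpha> in at_top. \<forall>P. good_pmf E \<alpha> P \<longrightarrow>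
        set_integrable lborel {0..1} (\<lambda>x. beta_mix_density \<alpha> f x *
          \<bar>ln (beta_mix_density \<alpha> f x / beta_mix_measure \<alpha> (measure_pmf P) x)\<bar> powr p) \<and>
        (LINT x:{0..1}|lborel. beta_mix_density \<alpha> f x *
          \<bar>ln (beta_mix_density \<alpha> f x / beta_mix_measure \<alpha> (measure_pmf P) x)\<bar> powr p) \<le> C' * \<alpha> powr (- H)"
      unfolding E_def by blast
    then show "\<exists>C. \<forall>\<^sub>F \<alpha> in at_top.
         set_integrable lborel {0..1} (\<lambda>x. beta_mix_density \<alpha> f x *
           \<bar>ln (beta_mix_density \<alpha> f x / beta_mix_measure \<alpha> (measure_pmf (P \<alpha>)) x)\<bar> powr p) \<and>
         (LINT x:{0..1}|lborel. beta_mix_density \<alpha> f x *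
           \<bar>ln (beta_mix_density \<alpha> f x / beta_mix_measure \<alpha> (measure_pmf (P \<alpha>)) x)\<bar> powr p)
           \<le> C * \<alpha> powr (-H)"
      using P by (intro exI[of _ C']) (rule eventually_mono[OF eventually_conj], assumption+, blast)
  qed (use C E in auto)
qed

end
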